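(* Let $n\in\mathbb N$, let $E$ be a Banach space, let $\mathfrak U$ be an ultrafilter on a set $I$, and let $\alpha$ be a finitely generated s-tensor norm of order $n$. Let $h_E:E\to(E)_{\mathfrak U}$ and $\kappa_E:E\to E''$ be the canonical embeddings. Then the natural maps $$\otimes^{n,s} h_E: \otimes^{n,s}_{\alpha} E \longrightarrow \otimes^{n,s}_{\alpha} (E)_{\mathfrak U},\qquad \otimes^{n,s}\kappa_E: \otimes^{n,s}_{\alpha} E \longrightarrow \otimes^{n,s}_{\alpha} E''$$ are isometries (i.e. norm-preserving, not necessarily surjective).
   Context: Banach spaces are over $\mathbb K=\mathbb R$ or $\mathbb C$; $E''$ is the bidual of $E$, and $FIN(E)$ is the set of finite-dimensional subspaces of $E$. Ultrapower: $(E)_{\mathfrak U}$ is the Banach space of classes $(z_{\mathfrak i})_{\mathfrak U}$ of bounded families $(z_{\mathfrak i})_{\mathfrak i\in I}$ in $E$, where $(z_{\mathfrak i})$ and $(y_{\mathfrak i})$ are identified if $\lim_{\mathfrak i,\mathfrak U}\|z_{\mathfrak i}-y_{\mathfrak i}\|=0$, with norm $\|(z_{\mathfrak i})_{\mathfrak U}\|=\lim_{\mathfrak i,\mathfrak U}\|z_{\mathfrak i}\|$. The canonical embedding is $h_Ex=(x_{\mathfrak i})_{\mathfrak U}$ with $x_{\mathfrak i}=x$ for all $\mathfrak i$. s-tensor norms: $\otimes^{n,s}E$ is the $n$-fold symmetric tensor product of $E$, spanned by the elements $\otimes^n x=x\otimes\cdots\otimes x$; for linear $T:E\to F$, $\otimes^{n,s}T:\otimes^{n,s}E\to\otimes^{n,s}F$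 is the linear map with $\otimes^n x\mapsto\otimes^n Tx$. An s-tensor norm $\alpha$ of order $n$ assigns to each normed space $E$ a norm $\alpha(\cdot\,;\otimes^{n,s}E)$ on $\otimes^{n,s}E$ such that $\alpha(\otimes^n 1;\otimes^{n,s}\mathbb K)=1$ and (metric mapping property) for each bounded linear $T:E\to F$, $\alpha(\otimes^{n,s}T(w);\otimes^{n,s}F)\le\|T\|^n\alpha(w;\otimes^{n,s}E)$. It is finitely generated if for every Banach space $E$ and $z\in\otimes^{n,s}E$, $\alpha(z;\otimes^{n,s}E)=\inf\{\alpha(z;\otimes^{n,s}M): M\in FIN(E),\ z\in\otimes^{n,s}M\}$. $\otimes^{n,s}_\alpha E$ denotes $\otimes^{n,s}E$ with the norm $\alpha(\cdot\,;\otimes^{n,s}E)$. *)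

theory Defs
  imports Complex_Main "HOL-Algebra.Module"
begin

section \<open>Scalars\<close>

text \<open>A type of this class is a copy of \<open>\<real>\<close> or of \<open>\<complex>\<close>, with its usual absolute value.\<close>

class real_or_complex = real_normed_field +
  assumes real_or_complex:
    "(\<forall>c. \<exists>a::real. c = a *\<^sub>R 1) \<or>
     (\<exists>j. j * j = - 1 \<and>
        (\<forall>c. \<exists>a b. c = a *\<^sub>R 1 + b *\<^sub>R j \<and> norm c = sqrt (a\<^sup>2 + b\<^sup>2)))"

instance real :: real_or_complex
  by standard auto

instance complex :: real_or_complex
proof
  have "c = Re c *\<^sub>R 1 + Im c *\<^sub>R \<i> \<and> norm c = sqrt ((Re c)\<^sup>2 + (Im c)\<^sup>2)" for c
    by (simp add: complex_eq_iff cmod_def)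
  then show "(\<forall>c::complex. \<exists>a. c = a *\<^sub>R 1) \<or>
     (\<exists>j::complex. j * j = - 1 \<and>
        (\<forall>c. \<exists>a b. c = a *\<^sub>R 1 + b *\<^sub>R j \<and> norm c = sqrt (a\<^sup>2 + b\<^sup>2)))"
    by (metis i_squared)
qed


section \<open>Normed spaces\<close>

text \<open>Normed spaces have explicit carriers, so that subspaces, duals and ultrapowers are again
  objects of the same kind. The fields \<^const>\<open>mult\<close> and \<^const>\<open>one\<close> inherited from the module
  record play no role in a space.\<close>

record ('k, 'a) nspace = "('k, 'a) module" +
  vnorm :: "'a \<Rightarrow> real"

text \<open>The field \<open>\<K>\<close>, both as a ring of scalars and as a one-dimensional normed space.\<close>

definition scalar_space :: "('k::real_or_complex, 'k) nspace" where
  "scalar_space = \<lparr>carrier = UNIV, mult = (*), one = 1, zero = 0, add = (+), smult = (*),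
     vnorm = norm\<rparr>"

locale normed_space = Module.module scalar_space E
  for E :: "('k::real_or_complex, 'a) nspace" (structure) +
  assumes vnorm_nonneg: "x \<in> carrier E \<Longrightarrow> 0 \<le> vnorm E x"
    and vnorm_eq_0_iff: "x \<in> carrier E \<Longrightarrow> vnorm E x = 0 \<longleftrightarrow> x = \<zero>\<^bsub>E\<^esub>"
    and vnorm_triangle: "x \<in> carrier E \<Longrightarrow> y \<in> carrier E \<Longrightarrow>
      vnorm E (x \<oplus>\<^bsub>E\<^esub> y) \<le> vnorm E x + vnorm E y"
    and vnorm_smult: "x \<in> carrier E \<Longrightarrow> vnorm E (c \<odot>\<^bsub>E\<^esub> x) = norm c * vnorm E x"

locale banach_space = normed_space +
  assumes complete:
    "(\<forall>m. X m \<in> carrier E) \<Longrightarrow>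
     (\<forall>e>0. \<exists>N. \<forall>m\<ge>N. \<forall>k\<ge>N. vnorm E (X m \<ominus>\<^bsub>E\<^esub> X k) < e) \<Longrightarrow>
     \<exists>x\<in>carrier E. (\<lambda>m. vnorm E (X m \<ominus>\<^bsub>E\<^esub> x)) \<longlonglongrightarrow> 0"

definition linear_span :: "('k::real_or_complex, 'a, 'm) module_scheme \<Rightarrow> 'a set \<Rightarrow> 'a set" where
  "linear_span E B = (\<lambda>H. submodule H scalar_space E) hull B"

definition FIN :: "('k::real_or_complex, 'a) nspace \<Rightarrow> ('k, 'a) nspace set" where
  "FIN E = {E\<lparr>carrier := linear_span E B\<rparr> | B. finite B \<and> B \<subseteq> carrier E}"

definition linear_map :: "('a \<Rightarrow> 'b) \<Rightarrow> ('k::real_or_complex, 'a, 'm) module_scheme \<Rightarrow>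
    ('k, 'b, 'l) module_scheme \<Rightarrow> bool" where
  "linear_map T E F \<longleftrightarrow>
     T \<in> carrier E \<rightarrow> carrier F \<and>
     (\<forall>x\<in>carrier E. \<forall>y\<in>carrier E. T (x \<oplus>\<^bsub>E\<^esub> y) = T x \<oplus>\<^bsub>F\<^esub> T y) \<and>
     (\<forall>c. \<forall>x\<in>carrier E. T (c \<odot>\<^bsub>E\<^esub> x) = c \<odot>\<^bsub>F\<^esub> T x)"

definition bounded_linear_map :: "('a \<Rightarrow> 'b) \<Rightarrow> ('k::real_or_complex, 'a) nspace \<Rightarrow>
    ('k, 'b) nspace \<Rightarrow> bool" where
  "bounded_linear_map T E F \<longleftrightarrow>
     linear_map T E F \<and> (\<exists>C. \<forall>x\<in>carrier E. vnorm F (T x) \<le> C * vnorm E x)"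

definition opnorm :: "('k::real_or_complex, 'a) nspace \<Rightarrow> ('k, 'b) nspace \<Rightarrow> ('a \<Rightarrow> 'b) \<Rightarrow> real"
  where "opnorm E F T = (SUP x\<in>{x \<in> carrier E. vnorm E x \<le> 1}. vnorm F (T x))"

definition isometry :: "('a \<Rightarrow> 'b) \<Rightarrow> ('k::real_or_complex, 'a) nspace \<Rightarrow> ('k, 'b) nspace \<Rightarrow> bool"
  where "isometry T E F \<longleftrightarrow> linear_map T E F \<and> (\<forall>x\<in>carrier E. vnorm F (T x) = vnorm E x)"

definition isometric_isomorphism ::
    "('a \<Rightarrow> 'b) \<Rightarrow> ('k::real_or_complex, 'a) nspace \<Rightarrow> ('k, 'b) nspace \<Rightarrow> bool" where
  "isometric_isomorphism T E F \<longleftrightarrow> isometry T E F \<and> T ` carrier E = carrier F"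


section \<open>Bidual\<close>

definition dual_space :: "('k::real_or_complex, 'a) nspace \<Rightarrow> ('k, 'a \<Rightarrow> 'k) nspace" where
  "dual_space E =
     \<lparr>carrier = {f \<in> extensional (carrier E). bounded_linear_map f E scalar_space},
      mult = undefined, one = undefined,
      zero = (\<lambda>x\<in>carrier E. 0),
      add = (\<lambda>f g. \<lambda>x\<in>carrier E. f x + g x),
      smult = (\<lambda>c f. \<lambda>x\<in>carrier E. c * f x),
      vnorm = opnorm E scalar_space\<rparr>"

abbreviation bidual :: "('k::real_or_complex, 'a) nspace \<Rightarrow> ('k, ('a \<Rightarrow> 'k) \<Rightarrow> 'k) nspace" where
  "bidual E \<equiv> dual_space (dual_space E)"

definition bidual_emb :: "('k::real_or_complex, 'a) nspace \<Rightarrow> 'a \<Rightarrow> ('a \<Rightarrow> 'k) \<Rightarrow> 'k" where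
  "bidual_emb E x = (\<lambda>f\<in>carrier (dual_space E). f x)"


section \<open>Ultrapowers\<close>

definition is_ultrafilter :: "'i filter \<Rightarrow> bool" where
  "is_ultrafilter U \<longleftrightarrow>
     U \<noteq> bot \<and> (\<forall>P. eventually P U \<or> eventually (\<lambda>i. \<not> P i) U)"

definition bounded_families :: "('k::real_or_complex, 'a) nspace \<Rightarrow> ('i \<Rightarrow> 'a) set" where
  "bounded_families E = {z. (\<forall>i. z i \<in> carrier E) \<and> (\<exists>C. \<forall>i. vnorm E (z i) \<le> C)}"

definition ultra_rel ::
    "'i filter \<Rightarrow> ('k::real_or_complex, 'a) nspace \<Rightarrow> (('i \<Rightarrow> 'a) \<times> ('i \<Rightarrow> 'a)) set" where
  "ultra_rel U E = {(z, y). z \<in> bounded_families E \<and> y \<in> bounded_families E \<and>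
     ((\<lambda>i. vnorm E (z i \<ominus>\<^bsub>E\<^esub> y i)) \<longlongrightarrow> 0) U}"

abbreviation ultra_class ::
    "'i filter \<Rightarrow> ('k::real_or_complex, 'a) nspace \<Rightarrow> ('i \<Rightarrow> 'a) \<Rightarrow> ('i \<Rightarrow> 'a) set" where
  "ultra_class U E z \<equiv> ultra_rel U E `` {z}"

text \<open>The operations are computed on representatives; the union over all representatives is a
  union of equal classes, and the norms of all representatives have the same limit.\<close>

definition ultrapower ::
    "'i filter \<Rightarrow> ('k::real_or_complex, 'a) nspace \<Rightarrow> ('k, ('i \<Rightarrow> 'a) set) nspace" where
  "ultrapower U E =
     \<lparr>carrier = bounded_families E // ultra_rel U E,
      mult = undefined, one = undefined,
      zero = ultra_class U E (\<lambda>i. \<zero>\<^bsub>E\<^esub>),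
      add = (\<lambda>Z Y. \<Union>z\<in>Z. \<Union>y\<in>Y. ultra_class U E (\<lambda>i. z i \<oplus>\<^bsub>E\<^esub> y i)),
      smult = (\<lambda>c Z. \<Union>z\<in>Z. ultra_class U E (\<lambda>i. c \<odot>\<^bsub>E\<^esub> z i)),
      vnorm = (\<lambda>Z. the_elem ((\<lambda>z. Lim U (\<lambda>i. vnorm E (z i))) ` Z))\<rparr>"

definition ultrapower_emb ::
    "'i filter \<Rightarrow> ('k::real_or_complex, 'a) nspace \<Rightarrow> 'a \<Rightarrow> ('i \<Rightarrow> 'a) set" where
  "ultrapower_emb U E x = ultra_class U E (\<lambda>i. x)"


section \<open>Symmetric tensor products\<close>

text \<open>An elementary tensor \<open>x\<^sub>0 \<otimes> \<dots> \<otimes> x\<^sub>n\<^sub>-\<^sub>1\<close> is modelled by the evaluation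
  \<open>\<phi> \<mapsto> \<phi> (x\<^sub>0, \<dots>, x\<^sub>n\<^sub>-\<^sub>1)\<close> on all (not necessarily continuous) \<open>n\<close>-linear forms. Since the
  \<open>n\<close>-linear forms separate the points of the algebraic tensor product of vector spaces, the
  linear span of these evaluations is the algebraic tensor product, and the span of the
  evaluations \<open>\<otimes>\<^sup>n x\<close> at constant tuples is the symmetric tensor product.\<close>

type_synonym ('k, 'a) tensor = "((nat \<Rightarrow> 'a) \<Rightarrow> 'k) \<Rightarrow> 'k"

definition tuples :: "nat \<Rightarrow> ('k::real_or_complex, 'a) nspace \<Rightarrow> (nat \<Rightarrow> 'a) set" where
  "tuples n E = {..<n} \<rightarrow>\<^sub>E carrier E"

definition multilinear_forms ::
    "nat \<Rightarrow> ('k::real_or_complex, 'a) nspace \<Rightarrow> ((nat \<Rightarrow> 'a) \<Rightarrow> 'k) set" where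
  "multilinear_forms n E =
     {\<phi> \<in> extensional (tuples n E). \<forall>x\<in>tuples n E. \<forall>i<n.
        linear_map (\<lambda>u. \<phi> (x(i := u))) E scalar_space}"

definition tensor_power :: "nat \<Rightarrow> ('k::real_or_complex, 'a) nspace \<Rightarrow> 'a \<Rightarrow> ('k, 'a) tensor" where
  "tensor_power n E x = (\<lambda>\<phi>. if \<phi> \<in> multilinear_forms n E then \<phi> (\<lambda>i\<in>{..<n}. x) else 0)"

definition function_module :: "('k::real_or_complex, 'x \<Rightarrow> 'k) module" where
  "function_module =
     \<lparr>carrier = UNIV, mult = undefined, one = undefined, zero = (\<lambda>_. 0),
      add = (\<lambda>v w p. v p + w p), smult = (\<lambda>c w p. c * w p)\<rparr>"

definition sym_tensors :: "nat \<Rightarrow> ('k::real_or_complex, 'a) nspace \<Rightarrow> ('k, 'a) tensor set" where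
  "sym_tensors n E = linear_span function_module (tensor_power n E ` carrier E)"

text \<open>The \<open>n\<close>-fold symmetric tensor product of \<open>E\<close>, equipped with the function \<open>N\<close> as norm.\<close>

definition sym_tensor_space ::
    "nat \<Rightarrow> (('k, 'a) tensor \<Rightarrow> real) \<Rightarrow> ('k::real_or_complex, 'a) nspace \<Rightarrow>
     ('k, ('k, 'a) tensor) nspace" where
  "sym_tensor_space n N E =
     module.extend (function_module\<lparr>carrier := sym_tensors n E\<rparr>) \<lparr>vnorm = N\<rparr>"

text \<open>\<open>\<otimes>\<^sup>n\<^sup>,\<^sup>sT\<close> for a linear map \<open>T\<close> from \<open>E\<close> to \<open>F\<close>: the transpose of \<open>\<psi> \<mapsto> \<psi> \<circ> (T \<times> \<dots> \<times> T)\<close>.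
  By \<open>sym_tensor_map_power\<close> and \<open>sym_tensor_map_linear\<close> below it is the linear map with \<open>\<otimes>\<^sup>n x \<mapsto> \<otimes>\<^sup>n (T x)\<close>.\<close>

definition sym_tensor_map ::
    "nat \<Rightarrow> ('a \<Rightarrow> 'b) \<Rightarrow> ('k::real_or_complex, 'a) nspace \<Rightarrow> ('k, 'b) nspace \<Rightarrow>
     ('k, 'a) tensor \<Rightarrow> ('k, 'b) tensor" where
  "sym_tensor_map n T E F w =
     (\<lambda>\<psi>. if \<psi> \<in> multilinear_forms n F
           then w (\<lambda>x\<in>tuples n E. \<psi> (\<lambda>i\<in>{..<n}. T (x i))) else 0)"

lemma multilinear_forms_compose:
  fixes E :: "('k::real_or_complex, 'a) nspace"
  assumes T: "linear_map T E F" and E: "normed_space E" and \<psi>: "\<psi> \<in> multilinear_forms n F"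
  shows "(\<lambda>x\<in>tuples n E. \<psi> (\<lambda>i\<in>{..<n}. T (x i))) \<in> multilinear_forms n E"
proof -
  interpret E: normed_space E by (fact E)
  have lin: "linear_map (\<lambda>u. \<psi> (\<lambda>j\<in>{..<n}. T ((x(i := u)) j))) E scalar_space"
    if x: "x \<in> tuples n E" and i: "i < n" for x i
  proof -
    have "(\<lambda>j\<in>{..<n}. T (x j)) \<in> tuples n F"
      using x T by (auto simp: tuples_def linear_map_def)
    then have L: "linear_map (\<lambda>v. \<psi> ((\<lambda>j\<in>{..<n}. T (x j))(i := v))) F scalar_space"
      using \<psi> i by (auto simp: multilinear_forms_def)
    have *: "(\<lambda>j\<in>{..<n}. T ((x(i := u)) j)) = (\<lambda>j\<in>{..<n}. T (x j))(i := T u)" for u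
      using i by (auto simp: fun_eq_iff)
    show ?thesis
      unfolding * using L T by (auto simp: linear_map_def Pi_iff)
  qed
  have upd: "x(i := u) \<in> tuples n E" if "x \<in> tuples n E" "i < n" "u \<in> carrier E" for x i u
    using that by (auto simp: tuples_def PiE_def extensional_def)
  have sc: "c \<in> carrier scalar_space" for c :: 'k
    by (simp add: scalar_space_def)
  show ?thesis
    unfolding multilinear_forms_def
  proof (intro CollectI conjI ballI allI impI)
    fix x i assume x: "x \<in> tuples n E" and i: "i < n"
    show "linear_map (\<lambda>u. (\<lambda>x\<in>tuples n E. \<psi> (\<lambda>i\<in>{..<n}. T (x i))) (x(i := u))) E scalar_space"
      using lin[OF x i] upd[OF x i] E.smult_closed[OF sc]
      by (simp add: linear_map_def Pi_iff)
  qed auto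
qed

lemma sym_tensor_map_power:
  assumes "linear_map T E F" "normed_space E" "x \<in> carrier E"
  shows "sym_tensor_map n T E F (tensor_power n E x) = tensor_power n F (T x)"
proof -
  have "(\<lambda>i\<in>{..<n}. x) \<in> tuples n E"
    using assms by (auto simp: tuples_def)
  moreover have "(\<lambda>i\<in>{..<n}. T ((\<lambda>i\<in>{..<n}. x) i)) = (\<lambda>i\<in>{..<n}. T x)"
    by (auto simp: fun_eq_iff)
  ultimately show ?thesis
    using multilinear_forms_compose[OF assms(1,2)]
    by (intro ext) (simp add: sym_tensor_map_def tensor_power_def del: restrict_apply add: restrict_apply')
qed

lemma module_function_module:
  "Module.module scalar_space (function_module :: ('k::real_or_complex, 'x \<Rightarrow> 'k) module)"
proof (rule moduleI)
  show "cring (scalar_space :: ('k, 'k) nspace)"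
  proof (rule cringI)
    show "abelian_group (scalar_space :: ('k, 'k) nspace)"
    proof (rule abelian_groupI)
      fix x :: 'k
      show "\<exists>y\<in>carrier scalar_space. y \<oplus>\<^bsub>scalar_space\<^esub> x = \<zero>\<^bsub>scalar_space\<^esub>"
        by (rule bexI[of _ "- x"]) (auto simp: scalar_space_def)
    qed (auto simp: scalar_space_def)
    show "Group.comm_monoid (scalar_space :: ('k, 'k) nspace)"
      by (rule comm_monoidI) (auto simp: scalar_space_def)
  qed (auto simp: scalar_space_def algebra_simps)
  show "abelian_group (function_module :: ('k, 'x \<Rightarrow> 'k) module)"
  proof (rule abelian_groupI)
    fix w :: "'x \<Rightarrow> 'k"
    show "\<exists>v\<in>carrier function_module. v \<oplus>\<^bsub>function_module\<^esub> w = \<zero>\<^bsub>function_module\<^esub>"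
      by (rule bexI[of _ "\<lambda>p. - w p"]) (auto simp: function_module_def)
  qed (auto simp: function_module_def)
qed (auto simp: function_module_def scalar_space_def algebra_simps)

lemma submodule_function_moduleI:
  fixes H :: "('x \<Rightarrow> 'k::real_or_complex) set"
  assumes "(\<lambda>_. 0) \<in> H" "\<And>v w. v \<in> H \<Longrightarrow> w \<in> H \<Longrightarrow> (\<lambda>p. v p + w p) \<in> H"
    and smult: "\<And>c w. w \<in> H \<Longrightarrow> (\<lambda>p. c * w p) \<in> H"
  shows "submodule H scalar_space function_module"
proof -
  interpret M: Module.module scalar_space "function_module :: ('k, 'x \<Rightarrow> 'k) module"
    by (rule module_function_module)
  have inv: "\<ominus>\<^bsub>function_module\<^esub> w = (\<lambda>p. - 1 * w p)" for w :: "'x \<Rightarrow> 'k"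
    by (rule M.minus_equality) (auto simp: function_module_def)
  show ?thesis
    by (rule M.submoduleI) (use assms smult[of _ "- 1"] inv in \<open>auto simp: function_module_def\<close>)
qed

lemma submodule_function_moduleD:
  assumes "submodule H scalar_space (function_module :: ('k::real_or_complex, 'x \<Rightarrow> 'k) module)"
  shows "(\<lambda>_. 0) \<in> H" "\<And>v w. v \<in> H \<Longrightarrow> w \<in> H \<Longrightarrow> (\<lambda>p. v p + w p) \<in> H"
    and "\<And>c w. w \<in> H \<Longrightarrow> (\<lambda>p. c * w p) \<in> H"
proof -
  interpret H: submodule H scalar_space "function_module :: ('k, 'x \<Rightarrow> 'k) module"
    by (fact assms)
  show "(\<lambda>_. 0) \<in> H" "\<And>v w. v \<in> H \<Longrightarrow> w \<in> H \<Longrightarrow> (\<lambda>p. v p + w p) \<in> H"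
    using H.one_closed H.m_closed by (auto simp: function_module_def)
  show "(\<lambda>p. c * w p) \<in> H" if "w \<in> H" for c w
    using H.smult_closed[of c w] that by (auto simp: function_module_def scalar_space_def)
qed

lemma submodule_sym_tensors: "submodule (sym_tensors n E) scalar_space function_module"
  by (rule submodule_function_moduleI)
    (auto simp: sym_tensors_def linear_span_def hull_def dest: submodule_function_moduleD)

lemma sym_tensor_map_linear:
  assumes "linear_map T E F" "normed_space E"
  shows "linear_map (sym_tensor_map n T E F) (sym_tensor_space n N E) (sym_tensor_space n N' F)"
proof -
  note sub = submodule_function_moduleD[OF submodule_sym_tensors[of n F]]
  have "tensor_power n E ` carrier E \<subseteq> {w. sym_tensor_map n T E F w \<in> sym_tensors n F}"
  proof clarify
    fix x assume x: "x \<in> carrier E"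
    then have "T x \<in> carrier F"
      using assms by (auto simp: linear_map_def)
    then have "tensor_power n F (T x) \<in> sym_tensors n F"
      by (auto simp: sym_tensors_def linear_span_def hull_def)
    then show "sym_tensor_map n T E F (tensor_power n E x) \<in> sym_tensors n F"
      by (simp add: sym_tensor_map_power[OF assms x])
  qed
  moreover have "submodule {w. sym_tensor_map n T E F w \<in> sym_tensors n F}
      scalar_space function_module"
  proof (rule submodule_function_moduleI)
    have *: "sym_tensor_map n T E F (\<lambda>p. 0) = (\<lambda>p. 0)"
      "sym_tensor_map n T E F (\<lambda>p. v p + w p) =
        (\<lambda>p. sym_tensor_map n T E F v p + sym_tensor_map n T E F w p)"
      "sym_tensor_map n T E F (\<lambda>p. c * w p) = (\<lambda>p. c * sym_tensor_map n T E F w p)" for v w c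
      by (auto simp: sym_tensor_map_def)
    show "(\<lambda>_. 0) \<in> {w. sym_tensor_map n T E F w \<in> sym_tensors n F}"
      using sub(1) by (simp add: *)
    show "(\<lambda>p. v p + w p) \<in> {w. sym_tensor_map n T E F w \<in> sym_tensors n F}"
      if "v \<in> {w. sym_tensor_map n T E F w \<in> sym_tensors n F}"
        "w \<in> {w. sym_tensor_map n T E F w \<in> sym_tensors n F}" for v w
      using that sub(2) by (simp add: *)
    show "(\<lambda>p. c * w p) \<in> {w. sym_tensor_map n T E F w \<in> sym_tensors n F}"
      if "w \<in> {w. sym_tensor_map n T E F w \<in> sym_tensors n F}" for c w
      using that sub(3) by (simp add: *)
  qed
  ultimately have "sym_tensors n E \<subseteq> {w. sym_tensor_map n T E F w \<in> sym_tensors n F}"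
    unfolding sym_tensors_def[of n E] linear_span_def by (rule hull_minimal)
  then show ?thesis
    by (auto simp: linear_map_def sym_tensor_space_def module.extend_def function_module_def
        sym_tensor_map_def fun_eq_iff)
qed


section \<open>s-tensor norms\<close>

text \<open>There is no type of all normed spaces. An s-tensor norm is therefore given on all normed
  spaces whose points belong to a type \<open>'u\<close>, an arbitrary universe. A normed space \<open>X\<close> over any
  other type enters this universe through an isometric isomorphism \<open>J\<close> onto a normed space \<open>F\<close>
  in it; by \<open>normed_space_copy\<close> below there is one as soon as \<open>'u\<close> is large enough. The same
  applies to \<open>\<K>\<close> in the normalisation \<open>\<alpha>(\<otimes>\<^sup>n 1; \<otimes>\<^sup>n\<^sup>,\<^sup>s\<K>) = 1\<close>.\<close>

definition s_tensor_norm ::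
    "nat \<Rightarrow> (('k::real_or_complex, 'u) nspace \<Rightarrow> ('k, 'u) tensor \<Rightarrow> real) \<Rightarrow> bool" where
  "s_tensor_norm n \<alpha> \<longleftrightarrow>
     (\<forall>E. normed_space E \<longrightarrow> normed_space (sym_tensor_space n (\<alpha> E) E)) \<and>
     (\<forall>K J. normed_space K \<and> isometric_isomorphism J scalar_space K \<longrightarrow>
        \<alpha> K (sym_tensor_map n J scalar_space K (tensor_power n scalar_space 1)) = 1) \<and>
     (\<forall>E F T. normed_space E \<and> normed_space F \<and> bounded_linear_map T E F \<longrightarrow>
        (\<forall>w\<in>sym_tensors n E. \<alpha> F (sym_tensor_map n T E F w) \<le> opnorm E F T ^ n * \<alpha> E w))"

text \<open>That \<open>z \<in> \<otimes>\<^sup>n\<^sup>,\<^sup>sE\<close> lies in \<open>\<otimes>\<^sup>n\<^sup>,\<^sup>sM\<close> means that \<open>z\<close> is the image of some \<open>w \<in> \<otimes>\<^sup>n\<^sup>,\<^sup>sM\<close>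
  under the canonical embedding induced by the inclusion of \<open>M\<close> in \<open>E\<close>.\<close>

definition finitely_generated ::
    "nat \<Rightarrow> (('k::real_or_complex, 'u) nspace \<Rightarrow> ('k, 'u) tensor \<Rightarrow> real) \<Rightarrow> bool" where
  "finitely_generated n \<alpha> \<longleftrightarrow>
     (\<forall>E. banach_space E \<longrightarrow> (\<forall>z\<in>sym_tensors n E.
        \<alpha> E z = Inf {\<alpha> M w | M w. M \<in> FIN E \<and> w \<in> sym_tensors n M \<and>
                                  sym_tensor_map n (\<lambda>x. x) M E w = z}))"

text \<open>The norm \<open>\<alpha>(\<cdot>; \<otimes>\<^sup>n\<^sup>,\<^sup>sX)\<close>, read off from the copy \<open>F\<close> of \<open>X\<close> in the universe of \<open>\<alpha>\<close>.
  By the metric mapping property it does not depend on the choice of \<open>F\<close> and \<open>J\<close>.\<close>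

definition norm_via ::
    "nat \<Rightarrow> (('k::real_or_complex, 'u) nspace \<Rightarrow> ('k, 'u) tensor \<Rightarrow> real) \<Rightarrow>
     ('k, 'b) nspace \<Rightarrow> ('b \<Rightarrow> 'u) \<Rightarrow> ('k, 'u) nspace \<Rightarrow> ('k, 'b) tensor \<Rightarrow> real" where
  "norm_via n \<alpha> X J F w = \<alpha> F (sym_tensor_map n J X F w)"

lemma normed_space_copy:
  fixes X :: "('k::real_or_complex, 'b) nspace" and j :: "'b \<Rightarrow> 'u"
  assumes X: "normed_space X" and j: "inj_on j (carrier X)"
  shows "\<exists>F. normed_space F \<and> isometric_isomorphism j X F"
proof -
  interpret X: normed_space X by (fact X)
  define r where "r = inv_into (carrier X) j"
  define F :: "('k, 'u) nspace" where
    "F = \<lparr>carrier = j ` carrier X, mult = undefined, one = undefined, zero = j \<zero>\<^bsub>X\<^esub>,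
       add = (\<lambda>a b. j (r a \<oplus>\<^bsub>X\<^esub> r b)), smult = (\<lambda>c a. j (c \<odot>\<^bsub>X\<^esub> r a)),
       vnorm = (\<lambda>a. vnorm X (r a))\<rparr>"
  have r [simp]: "r (j x) = x" if "x \<in> carrier X" for x
    using that j by (simp add: r_def)
  have sc [simp]: "c \<in> carrier scalar_space" for c :: 'k
    by (simp add: scalar_space_def)
  have "abelian_group F"
  proof (rule abelian_groupI)
    fix a assume "a \<in> carrier F"
    then obtain x where x: "x \<in> carrier X" "a = j x"
      by (auto simp: F_def)
    show "\<exists>b\<in>carrier F. b \<oplus>\<^bsub>F\<^esub> a = \<zero>\<^bsub>F\<^esub>"
      by (rule bexI[of _ "j (\<ominus>\<^bsub>X\<^esub> x)"]) (use x in \<open>auto simp: F_def X.M.l_neg\<close>)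
  qed (auto simp: F_def X.M.a_ac)
  then have "Module.module scalar_space F"
    by (intro moduleI)
      (auto simp: F_def X.R.is_cring X.smult_l_distr X.smult_r_distr X.smult_assoc1)
  moreover have "normed_space_axioms F"
    using j by unfold_locales
      (auto simp: F_def X.vnorm_nonneg X.vnorm_eq_0_iff X.vnorm_triangle X.vnorm_smult inj_on_eq_iff)
  ultimately have "normed_space F"
    by (simp add: normed_space_def)
  moreover have "isometric_isomorphism j X F"
    by (auto simp: isometric_isomorphism_def isometry_def linear_map_def F_def)
  ultimately show ?thesis
    by blast
qed

end

theory Submission
  imports Defs "HOL-Analysis.Elementary_Normed_Spaces"
begin

text \<open>Call an isometry \<open>T: E \<rightarrow> F\<close> locally retractable if for every finite \<open>N \<subseteq> F\<close> and \<open>\<eta> > 0\<close> there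
  is a linear, possibly unbounded \<open>S: F \<rightarrow> E\<close> with \<open>S \<circ> T = id\<close> and \<open>\<parallel>S x\<parallel> \<le> \<parallel>x\<parallel> + \<eta>\<close> for \<open>x \<in> N\<close>.
  If \<open>\<otimes>\<^sup>n\<^sup>,\<^sup>sT(w)\<close> is the image of some \<open>v \<in> \<otimes>\<^sup>n\<^sup>,\<^sup>sM\<close> with \<open>M\<close> finite-dimensional, take for \<open>N\<close> a net
  of the unit ball of \<open>M\<close>. Then \<open>\<parallel>S|M\<parallel> \<le> 1 + \<epsilon>\<close>, and \<open>\<otimes>\<^sup>n\<^sup>,\<^sup>s(S|M)\<close> maps \<open>v\<close> to \<open>w\<close>, so the metric
  mapping property gives \<open>\<alpha>(w) \<le> (1 + \<epsilon>)\<^sup>n \<alpha>(v)\<close>. As \<open>\<alpha>\<close> is finitely generated, \<open>\<otimes>\<^sup>n\<^sup>,\<^sup>sT\<close> is an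
  isometry.

  For the ultrapower, \<open>S\<close> is a coordinate of a linear choice of representatives that takes \<open>h\<^sub>E x\<close> to
  the constant family \<open>x\<close>. For the bidual it comes from the Hahn--Banach theorem in a power of \<open>E\<close>,
  as in the classical proof of local reflexivity.\<close>

text \<open>The two demands on a retraction are of different kinds. The norm bound concerns finitely
  many points, so in the ultrapower it can be met at a common index, and in the bidual it is
  expressed by one seminorm. The identity S o T = id is exact, so that v is sent to w itself and not
  to a perturbation of w; being algebraic, it can be imposed from the start. In the bidual the
  algebraic retractions form an affine space, and the question is whether it meets a ball. A
  functional separating the two would amount to a finite family in E', and on such a family every
  point of E'' agrees with some point of E.

  All algebraic maps arise from linear relations by Zorn's lemma, of which the Hahn-Banach theorem
  is another instance. A net controls a seminorm on M only once the seminorm is known to be bounded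
  there; this is the reason for the study of finite dimension. Since \<alpha> lives on one universe
  of points, the argument is run in isometric copies of the ultrapower and the bidual.\<close>

lemma scalar_space_simps [simp]:
  "carrier scalar_space = UNIV" "zero scalar_space = 0" "one scalar_space = 1"
  "add scalar_space = (+)" "mult scalar_space = (*)" "smult scalar_space = (*)"
  "vnorm scalar_space = norm"
  by (simp_all add: scalar_space_def)

section \<open>Linear relations\<close>

definition linear_relation ::
    "('k::real_or_complex, 'a, 'm) module_scheme \<Rightarrow> ('k, 'b, 'l) module_scheme \<Rightarrow> ('a \<times> 'b) set \<Rightarrow> bool"
  where "linear_relation V W G \<longleftrightarrow>
     G \<subseteq> carrier V \<times> carrier W \<and> (\<zero>\<^bsub>V\<^esub>, \<zero>\<^bsub>W\<^esub>) \<in> G \<and>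
     (\<forall>u t v w. (u, t) \<in> G \<longrightarrow> (v, w) \<in> G \<longrightarrow> (u \<oplus>\<^bsub>V\<^esub> v, t \<oplus>\<^bsub>W\<^esub> w) \<in> G) \<and>
     (\<forall>c u t. (u, t) \<in> G \<longrightarrow> (c \<odot>\<^bsub>V\<^esub> u, c \<odot>\<^bsub>W\<^esub> t) \<in> G)"

lemma module_add_swap:
  assumes "Module.module scalar_space V" "a \<in> carrier V" "b \<in> carrier V" "c \<in> carrier V" "d \<in> carrier V"
  shows "(a \<oplus>\<^bsub>V\<^esub> b) \<oplus>\<^bsub>V\<^esub> (c \<oplus>\<^bsub>V\<^esub> d) = (a \<oplus>\<^bsub>V\<^esub> c) \<oplus>\<^bsub>V\<^esub> (b \<oplus>\<^bsub>V\<^esub> d)"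
proof -
  interpret V: Module.module scalar_space V by fact
  show ?thesis using assms(2-) by (simp add: V.M.a_ac)
qed

lemma module_smult_0:
  assumes "Module.module scalar_space (V :: ('k::real_or_complex, 'a, 'm) module_scheme)" "x \<in> carrier V"
  shows "0 \<odot>\<^bsub>V\<^esub> x = \<zero>\<^bsub>V\<^esub>"
proof -
  interpret V: Module.module scalar_space V by fact
  show ?thesis using V.smult_l_null[OF assms(2)] by simp
qed

lemma module_smult_zero:
  assumes "Module.module scalar_space (V :: ('k::real_or_complex, 'a, 'm) module_scheme)"
  shows "c \<odot>\<^bsub>V\<^esub> \<zero>\<^bsub>V\<^esub> = \<zero>\<^bsub>V\<^esub>"
proof -
  interpret V: Module.module scalar_space V by fact
  show ?thesis using V.smult_r_null[of c] by simp
qed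

lemma module_smult:
  assumes "Module.module scalar_space (V :: ('k::real_or_complex, 'a, 'm) module_scheme)" "x \<in> carrier V"
  shows "c \<odot>\<^bsub>V\<^esub> x \<in> carrier V" "1 \<odot>\<^bsub>V\<^esub> x = x"
    "c \<odot>\<^bsub>V\<^esub> (d \<odot>\<^bsub>V\<^esub> x) = (c * d) \<odot>\<^bsub>V\<^esub> x"
    "(c + d) \<odot>\<^bsub>V\<^esub> x = c \<odot>\<^bsub>V\<^esub> x \<oplus>\<^bsub>V\<^esub> d \<odot>\<^bsub>V\<^esub> x"
    "y \<in> carrier V \<Longrightarrow> c \<odot>\<^bsub>V\<^esub> (x \<oplus>\<^bsub>V\<^esub> y) = c \<odot>\<^bsub>V\<^esub> x \<oplus>\<^bsub>V\<^esub> c \<odot>\<^bsub>V\<^esub> y"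
proof -
  interpret V: Module.module scalar_space V by fact
  show "c \<odot>\<^bsub>V\<^esub> x \<in> carrier V" using assms(2) by simp
  show "1 \<odot>\<^bsub>V\<^esub> x = x" using V.smult_one[OF assms(2)] by simp
  show "c \<odot>\<^bsub>V\<^esub> (d \<odot>\<^bsub>V\<^esub> x) = (c * d) \<odot>\<^bsub>V\<^esub> x"
    using V.smult_assoc1[of c d x] assms(2) by simp
  show "(c + d) \<odot>\<^bsub>V\<^esub> x = c \<odot>\<^bsub>V\<^esub> x \<oplus>\<^bsub>V\<^esub> d \<odot>\<^bsub>V\<^esub> x"
    using V.smult_l_distr[of c d x] assms(2) by simp
  show "c \<odot>\<^bsub>V\<^esub> (x \<oplus>\<^bsub>V\<^esub> y) = c \<odot>\<^bsub>V\<^esub> x \<oplus>\<^bsub>V\<^esub> c \<odot>\<^bsub>V\<^esub> y" if "y \<in> carrier V"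
    using V.smult_r_distr[of c x y] assms(2) that by simp
qed

text \<open>The sum of \<open>G\<close> and the line through \<open>(v, w)\<close> is the one-step
  extension that contradicts maximality when \<open>v\<close> lies outside the domain of
  \<open>G\<close>.\<close>

lemma linear_relation_adjoin:
  assumes V: "Module.module scalar_space V" and W: "Module.module scalar_space W"
    and G: "linear_relation V W G" and v: "v \<in> carrier V" and w: "w \<in> carrier W"
  shows "linear_relation V W
    {(u \<oplus>\<^bsub>V\<^esub> s \<odot>\<^bsub>V\<^esub> v, t \<oplus>\<^bsub>W\<^esub> s \<odot>\<^bsub>W\<^esub> w) | u t s. (u, t) \<in> G}" (is "linear_relation V W ?G'")
    and "G \<subseteq> {(u \<oplus>\<^bsub>V\<^esub> s \<odot>\<^bsub>V\<^esub> v, t \<oplus>\<^bsub>W\<^esub> s \<odot>\<^bsub>W\<^esub> w) | u t s. (u, t) \<in> G}"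
    and "(v, w) \<in> {(u \<oplus>\<^bsub>V\<^esub> s \<odot>\<^bsub>V\<^esub> v, t \<oplus>\<^bsub>W\<^esub> s \<odot>\<^bsub>W\<^esub> w) | u t s. (u, t) \<in> G}"
proof -
  interpret V: Module.module scalar_space V by fact
  interpret W: Module.module scalar_space W by fact
  have Gc: "u \<in> carrier V" "t \<in> carrier W" if "(u, t) \<in> G" for u t
    using G that by (auto simp: linear_relation_def)
  have G0: "(\<zero>\<^bsub>V\<^esub>, \<zero>\<^bsub>W\<^esub>) \<in> G"
    and Ga: "(u, t) \<in> G \<Longrightarrow> (u', t') \<in> G \<Longrightarrow> (u \<oplus>\<^bsub>V\<^esub> u', t \<oplus>\<^bsub>W\<^esub> t') \<in> G"
    and Gs: "(u, t) \<in> G \<Longrightarrow> (c \<odot>\<^bsub>V\<^esub> u, c \<odot>\<^bsub>W\<^esub> t) \<in> G" for u t u' t' c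
    using G by (auto simp: linear_relation_def)
  have I: "(u \<oplus>\<^bsub>V\<^esub> s \<odot>\<^bsub>V\<^esub> v, t \<oplus>\<^bsub>W\<^esub> s \<odot>\<^bsub>W\<^esub> w) \<in> ?G'" if "(u, t) \<in> G" for u t s
    using that by blast
  show "G \<subseteq> ?G'"
  proof (rule subrelI)
    fix u t assume ut: "(u, t) \<in> G"
    show "(u, t) \<in> ?G'"
      using I[OF ut, of 0] Gc[OF ut] v w by (simp add: module_smult_0[OF V] module_smult_0[OF W])
  qed
  then have "(\<zero>\<^bsub>V\<^esub>, \<zero>\<^bsub>W\<^esub>) \<in> ?G'"
    using G0 by blast
  show "(v, w) \<in> ?G'"
    using I[OF G0, of 1] v w by (simp add: module_smult(2)[OF V] module_smult(2)[OF W])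
  show "linear_relation V W ?G'"
    unfolding linear_relation_def
  proof (intro conjI allI impI)
    show "?G' \<subseteq> carrier V \<times> carrier W"
    proof clarify
      fix u t s assume "(u, t) \<in> G"
      then show "u \<oplus>\<^bsub>V\<^esub> s \<odot>\<^bsub>V\<^esub> v \<in> carrier V \<and> t \<oplus>\<^bsub>W\<^esub> s \<odot>\<^bsub>W\<^esub> w \<in> carrier W"
        using Gc v w module_smult(1)[OF V v] module_smult(1)[OF W w] by auto
    qed
    show "(\<zero>\<^bsub>V\<^esub>, \<zero>\<^bsub>W\<^esub>) \<in> ?G'" by fact
  next
    fix x y x' y' assume "(x, y) \<in> ?G'" "(x', y') \<in> ?G'"
    then obtain u t s u' t' s' where *: "(u, t) \<in> G" "(u', t') \<in> G"
      "x = u \<oplus>\<^bsub>V\<^esub> s \<odot>\<^bsub>V\<^esub> v" "y = t \<oplus>\<^bsub>W\<^esub> s \<odot>\<^bsub>W\<^esub> w"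
      "x' = u' \<oplus>\<^bsub>V\<^esub> s' \<odot>\<^bsub>V\<^esub> v" "y' = t' \<oplus>\<^bsub>W\<^esub> s' \<odot>\<^bsub>W\<^esub> w"
      by blast
    have "(x \<oplus>\<^bsub>V\<^esub> x', y \<oplus>\<^bsub>W\<^esub> y') =
      ((u \<oplus>\<^bsub>V\<^esub> u') \<oplus>\<^bsub>V\<^esub> (s + s') \<odot>\<^bsub>V\<^esub> v, (t \<oplus>\<^bsub>W\<^esub> t') \<oplus>\<^bsub>W\<^esub> (s + s') \<odot>\<^bsub>W\<^esub> w)"
      using Gc[OF *(1)] Gc[OF *(2)] v w
      by (simp add: * module_smult[OF V] module_smult[OF W] module_add_swap[OF V] module_add_swap[OF W])
    then show "(x \<oplus>\<^bsub>V\<^esub> x', y \<oplus>\<^bsub>W\<^esub> y') \<in> ?G'"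
      using I[OF Ga[OF *(1,2)]] by simp
  next
    fix c x y assume "(x, y) \<in> ?G'"
    then obtain u t s where *: "(u, t) \<in> G" "x = u \<oplus>\<^bsub>V\<^esub> s \<odot>\<^bsub>V\<^esub> v" "y = t \<oplus>\<^bsub>W\<^esub> s \<odot>\<^bsub>W\<^esub> w"
      by blast
    have "(c \<odot>\<^bsub>V\<^esub> x, c \<odot>\<^bsub>W\<^esub> y) = (c \<odot>\<^bsub>V\<^esub> u \<oplus>\<^bsub>V\<^esub> (c * s) \<odot>\<^bsub>V\<^esub> v, c \<odot>\<^bsub>W\<^esub> t \<oplus>\<^bsub>W\<^esub> (c * s) \<odot>\<^bsub>W\<^esub> w)"
      using Gc[OF *(1)] v w by (simp add: * module_smult[OF V] module_smult[OF W])
    then show "(c \<odot>\<^bsub>V\<^esub> x, c \<odot>\<^bsub>W\<^esub> y) \<in> ?G'"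
      using I[OF Gs[OF *(1)]] by simp
  qed
qed

text \<open>The Zorn argument shared by the Hahn-Banach theorem and by
  \<open>linear_lifting\<close>. The invariant \<open>P\<close> is a condition on single pairs, so
  it survives unions of chains; single-valuedness is extracted from \<open>P\<close>
  afterwards.\<close>

lemma linear_relation_extension:
  assumes V: "Module.module scalar_space V" and W: "Module.module scalar_space W"
    and G0: "linear_relation V W G0" and P: "\<And>z. z \<in> G0 \<Longrightarrow> P z"
    and step: "\<And>G v. linear_relation V W G \<Longrightarrow> G0 \<subseteq> G \<Longrightarrow> (\<forall>z\<in>G. P z) \<Longrightarrow> v \<in> carrier V \<Longrightarrow> v \<notin> fst ` G \<Longrightarrow>
       \<exists>w\<in>carrier W. \<forall>u t s. (u, t) \<in> G \<longrightarrow> P (u \<oplus>\<^bsub>V\<^esub> s \<odot>\<^bsub>V\<^esub> v, t \<oplus>\<^bsub>W\<^esub> s \<odot>\<^bsub>W\<^esub> w)"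
  obtains G where "linear_relation V W G" "G0 \<subseteq> G" "\<And>z. z \<in> G \<Longrightarrow> P z" "fst ` G = carrier V"
proof -
  define A where "A = {G. linear_relation V W G \<and> G0 \<subseteq> G \<and> (\<forall>z\<in>G. P z)}"
  have "\<exists>M\<in>A. \<forall>X\<in>A. M \<subseteq> X \<longrightarrow> X = M"
  proof (rule subset_Zorn_nonempty)
    show "A \<noteq> {}"
      using G0 P by (auto simp: A_def)
    fix C assume C: "C \<noteq> {}" "subset.chain A C"
    then obtain H where H: "H \<in> C" by blast
    have sub: "C \<subseteq> A" and tot: "\<And>X Y. X \<in> C \<Longrightarrow> Y \<in> C \<Longrightarrow> X \<subseteq> Y \<or> Y \<subseteq> X"
      using C by (auto simp: subset.chain_def)
    have lin: "linear_relation V W X" "G0 \<subseteq> X" "\<And>z. z \<in> X \<Longrightarrow> P z" if "X \<in> C" for X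
      using sub that by (auto simp: A_def)
    have "linear_relation V W (\<Union>C)"
      unfolding linear_relation_def
    proof (intro conjI allI impI)
      show "\<Union>C \<subseteq> carrier V \<times> carrier W"
        using lin(1) by (fastforce simp: linear_relation_def)
      show "(\<zero>\<^bsub>V\<^esub>, \<zero>\<^bsub>W\<^esub>) \<in> \<Union>C"
        using lin(1)[OF H] H by (auto simp: linear_relation_def)
    next
      fix u t v w assume "(u, t) \<in> \<Union>C" "(v, w) \<in> \<Union>C"
      then obtain X Y where XY: "X \<in> C" "Y \<in> C" "(u, t) \<in> X" "(v, w) \<in> Y" by blast
      then obtain Z where "Z \<in> C" "(u, t) \<in> Z" "(v, w) \<in> Z"
        using tot[OF XY(1,2)] by blast
      then show "(u \<oplus>\<^bsub>V\<^esub> v, t \<oplus>\<^bsub>W\<^esub> w) \<in> \<Union>C"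
        using lin(1)[of Z] unfolding linear_relation_def by blast
    next
      fix c u t assume "(u, t) \<in> \<Union>C"
      then show "(c \<odot>\<^bsub>V\<^esub> u, c \<odot>\<^bsub>W\<^esub> t) \<in> \<Union>C"
        using lin(1) unfolding linear_relation_def by blast
    qed
    then show "\<Union>C \<in> A"
      using lin(2)[OF H] H lin(3) by (auto simp: A_def)
  qed
  then obtain G where GA: "G \<in> A" and max: "\<And>X. X \<in> A \<Longrightarrow> G \<subseteq> X \<Longrightarrow> X = G"
    by blast
  have G: "linear_relation V W G" "G0 \<subseteq> G" "\<forall>z\<in>G. P z"
    using GA by (auto simp: A_def)
  have "v \<in> fst ` G" if v: "v \<in> carrier V" for v
  proof (rule ccontr)
    assume "v \<notin> fst ` G"
    from step[OF G v this] obtain w where w: "w \<in> carrier W"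
      and Pw: "\<And>u t s. (u, t) \<in> G \<Longrightarrow> P (u \<oplus>\<^bsub>V\<^esub> s \<odot>\<^bsub>V\<^esub> v, t \<oplus>\<^bsub>W\<^esub> s \<odot>\<^bsub>W\<^esub> w)"
      by blast
    define G' where "G' = {(u \<oplus>\<^bsub>V\<^esub> s \<odot>\<^bsub>V\<^esub> v, t \<oplus>\<^bsub>W\<^esub> s \<odot>\<^bsub>W\<^esub> w) | u t s. (u, t) \<in> G}"
    note adj = linear_relation_adjoin[OF V W G(1) v w, folded G'_def]
    have "G' \<in> A"
      using adj(1,2) G(2) Pw by (auto simp: A_def G'_def)
    with max adj(2) have "G' = G" by blast
    with adj(3) \<open>v \<notin> fst ` G\<close> show False
      by force
  qed
  moreover have "fst ` G \<subseteq> carrier V"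
    using G(1) by (auto simp: linear_relation_def)
  ultimately show thesis
    using G(3) by (intro that[OF G(1,2)]) auto
qed

text \<open>Two values of the same vector differ by a value of zero, so a condition at zero alone
  makes the entire relation a graph.\<close>

lemma linear_relation_graph:
  assumes V: "Module.module scalar_space V" and W: "Module.module scalar_space W"
    and G: "linear_relation V W G" and dom: "fst ` G = carrier V"
    and single: "\<And>w. (\<zero>\<^bsub>V\<^esub>, w) \<in> G \<Longrightarrow> w = \<zero>\<^bsub>W\<^esub>"
  obtains S where "linear_map S V W" "\<And>u t. (u, t) \<in> G \<longleftrightarrow> u \<in> carrier V \<and> t = S u"
proof -
  interpret V: Module.module scalar_space V by fact
  interpret W: Module.module scalar_space W by fact
  have Gc: "u \<in> carrier V" "t \<in> carrier W" if "(u, t) \<in> G" for u t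
    using G that by (auto simp: linear_relation_def)
  have Ga: "(u, t) \<in> G \<Longrightarrow> (u', t') \<in> G \<Longrightarrow> (u \<oplus>\<^bsub>V\<^esub> u', t \<oplus>\<^bsub>W\<^esub> t') \<in> G"
    and Gs: "(u, t) \<in> G \<Longrightarrow> (c \<odot>\<^bsub>V\<^esub> u, c \<odot>\<^bsub>W\<^esub> t) \<in> G" for u t u' t' c
    using G by (auto simp: linear_relation_def)
  have uniq: "t = t'" if tt: "(u, t) \<in> G" "(u, t') \<in> G" for u t t'
  proof -
    have m1: "u \<oplus>\<^bsub>V\<^esub> (- 1) \<odot>\<^bsub>V\<^esub> u = \<zero>\<^bsub>V\<^esub>"
      using module_smult(4)[OF V, of u 1 "- 1"] Gc[OF tt(1)] by (simp add: module_smult[OF V] module_smult_0[OF V])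
    have m2: "x \<oplus>\<^bsub>W\<^esub> (- 1) \<odot>\<^bsub>W\<^esub> x = \<zero>\<^bsub>W\<^esub>" if "x \<in> carrier W" for x
      using module_smult(4)[OF W, of x 1 "- 1"] that by (simp add: module_smult[OF W] module_smult_0[OF W])
    have "t \<oplus>\<^bsub>W\<^esub> (- 1) \<odot>\<^bsub>W\<^esub> t' = \<zero>\<^bsub>W\<^esub>"
      using single Ga[OF tt(1) Gs[OF tt(2), of "- 1"]] m1 by simp
    also have "\<dots> = t' \<oplus>\<^bsub>W\<^esub> (- 1) \<odot>\<^bsub>W\<^esub> t'"
      using m2 Gc[OF tt(2)] by simp
    finally show ?thesis
      using W.M.add.right_cancel[of "(- 1) \<odot>\<^bsub>W\<^esub> t'" t t'] Gc[OF tt(1)] Gc[OF tt(2)] module_smult[OF W] by auto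
  qed
  define S where "S u = (SOME t. (u, t) \<in> G)" for u
  have SG: "(u, S u) \<in> G" if "u \<in> carrier V" for u
    using that dom unfolding S_def by (metis (no_types, lifting) imageE prod.collapse someI)
  have "linear_map S V W"
    unfolding linear_map_def
  proof (intro conjI ballI allI funcsetI)
    show "S u \<in> carrier W" if "u \<in> carrier V" for u
      using Gc(2)[OF SG[OF that]] .
    show "S (x \<oplus>\<^bsub>V\<^esub> y) = S x \<oplus>\<^bsub>W\<^esub> S y" if "x \<in> carrier V" "y \<in> carrier V" for x y
      using uniq[OF SG Ga[OF SG SG]] that by simp
    show "S (c \<odot>\<^bsub>V\<^esub> x) = c \<odot>\<^bsub>W\<^esub> S x" if "x \<in> carrier V" for c x
      using uniq[OF SG Gs[OF SG]] that module_smult[OF V] by simp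
  qed
  moreover have "(u, t) \<in> G \<longleftrightarrow> u \<in> carrier V \<and> t = S u" for u t
    using SG uniq Gc by blast
  ultimately show thesis
    using that by blast
qed

text \<open>Makes a choice linear: \<open>R\<close> lists the admissible values and
  \<open>G0\<close> prescribes some of them. When the domain grows by \<open>v\<close>, every
  \<open>w\<close> with \<open>(v, w)\<close> in \<open>R\<close> will do, because admissibility is
  a linear condition and \<open>v\<close> is independent of the old domain.\<close>

lemma linear_lifting:
  assumes V: "Module.module scalar_space V" and W: "Module.module scalar_space W"
    and R: "linear_relation V W R" and total: "\<And>v. v \<in> carrier V \<Longrightarrow> \<exists>w. (v, w) \<in> R"
    and G0: "linear_relation V W G0" "G0 \<subseteq> R" and single: "\<And>w. (\<zero>\<^bsub>V\<^esub>, w) \<in> G0 \<Longrightarrow> w = \<zero>\<^bsub>W\<^esub>"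
  obtains S where "linear_map S V W" "\<And>v. v \<in> carrier V \<Longrightarrow> (v, S v) \<in> R" "\<And>v w. (v, w) \<in> G0 \<Longrightarrow> S v = w"
proof -
  interpret V: Module.module scalar_space V by fact
  interpret W: Module.module scalar_space W by fact
  define P where "P z \<longleftrightarrow> z \<in> R \<and> (fst z = \<zero>\<^bsub>V\<^esub> \<longrightarrow> snd z = \<zero>\<^bsub>W\<^esub>)" for z
  obtain G where G: "linear_relation V W G" "G0 \<subseteq> G" "\<And>z. z \<in> G \<Longrightarrow> P z" "fst ` G = carrier V"
  proof (rule linear_relation_extension[OF V W G0(1), of P])
    show "P z" if "z \<in> G0" for z
      using that single G0(2) by (cases z) (auto simp: P_def)
    fix G v assume G: "linear_relation V W G" "\<forall>z\<in>G. P z" and v: "v \<in> carrier V" "v \<notin> fst ` G"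
    obtain w where w: "(v, w) \<in> R" using total v(1) by blast
    have "P (u \<oplus>\<^bsub>V\<^esub> s \<odot>\<^bsub>V\<^esub> v, t \<oplus>\<^bsub>W\<^esub> s \<odot>\<^bsub>W\<^esub> w)" if ut: "(u, t) \<in> G" for u t s
    proof -
      have u: "u \<in> carrier V" "t \<in> carrier W" "w \<in> carrier W" using G(1) ut R w by (auto simp: linear_relation_def)
      have "(u, t) \<in> R" using G(2) ut by (auto simp: P_def)
      then have "(u \<oplus>\<^bsub>V\<^esub> s \<odot>\<^bsub>V\<^esub> v, t \<oplus>\<^bsub>W\<^esub> s \<odot>\<^bsub>W\<^esub> w) \<in> R"
        using R w unfolding linear_relation_def by blast
      moreover have "t \<oplus>\<^bsub>W\<^esub> s \<odot>\<^bsub>W\<^esub> w = \<zero>\<^bsub>W\<^esub>" if 0: "u \<oplus>\<^bsub>V\<^esub> s \<odot>\<^bsub>V\<^esub> v = \<zero>\<^bsub>V\<^esub>"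
      proof (cases "s = 0")
        case True
        then have "u = \<zero>\<^bsub>V\<^esub>" using 0 u v by (simp add: module_smult_0[OF V])
        then show ?thesis using True G(2) ut u w by (auto simp: P_def module_smult_0[OF W])
      next
        case False
        \<comment> \<open>For nonzero \<open>s\<close> the vanishing sum expresses \<open>v\<close>
          as a multiple of \<open>u\<close>, which would put \<open>v\<close> into the domain of
          \<open>G\<close>.\<close>
        have "(- inverse s) \<odot>\<^bsub>V\<^esub> (u \<oplus>\<^bsub>V\<^esub> s \<odot>\<^bsub>V\<^esub> v) = (- inverse s) \<odot>\<^bsub>V\<^esub> u \<oplus>\<^bsub>V\<^esub> (- 1) \<odot>\<^bsub>V\<^esub> v"
          using u v False by (simp add: module_smult[OF V])
        then have z: "(- inverse s) \<odot>\<^bsub>V\<^esub> u \<oplus>\<^bsub>V\<^esub> (- 1) \<odot>\<^bsub>V\<^esub> v = \<zero>\<^bsub>V\<^esub>"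
          by (simp add: 0 module_smult_zero[OF V])
        have "v \<oplus>\<^bsub>V\<^esub> (- 1) \<odot>\<^bsub>V\<^esub> v = \<zero>\<^bsub>V\<^esub>"
          using module_smult(4)[OF V, of v 1 "- 1"] v by (simp add: module_smult[OF V] module_smult_0[OF V])
        with z have "(- inverse s) \<odot>\<^bsub>V\<^esub> u = v"
          using V.M.add.right_cancel[of "(- 1) \<odot>\<^bsub>V\<^esub> v" "(- inverse s) \<odot>\<^bsub>V\<^esub> u" v] u v module_smult[OF V] by auto
        moreover have "((- inverse s) \<odot>\<^bsub>V\<^esub> u, (- inverse s) \<odot>\<^bsub>W\<^esub> t) \<in> G"
          using G(1) ut unfolding linear_relation_def by blast
        ultimately show ?thesis
          using v(2) by force
      qed
      ultimately show ?thesis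
        by (simp add: P_def)
    qed
    then show "\<exists>w\<in>carrier W. \<forall>u t s. (u, t) \<in> G \<longrightarrow> P (u \<oplus>\<^bsub>V\<^esub> s \<odot>\<^bsub>V\<^esub> v, t \<oplus>\<^bsub>W\<^esub> s \<odot>\<^bsub>W\<^esub> w)"
      using w R by (intro bexI[of _ w]) (auto simp: linear_relation_def)
  qed blast
  obtain S where S: "linear_map S V W" "\<And>u t. (u, t) \<in> G \<longleftrightarrow> u \<in> carrier V \<and> t = S u"
    by (rule linear_relation_graph[OF V W G(1,4)]) (use G(3) in \<open>auto simp: P_def\<close>)
  show thesis
  proof (rule that[OF S(1)])
    show "(v, S v) \<in> R" if "v \<in> carrier V" for v
      using S(2)[of v "S v"] G(3)[of "(v, S v)"] that by (auto simp: P_def)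
    show "S v = w" if "(v, w) \<in> G0" for v w
      using that G(2) S(2)[of v w] by auto
  qed
qed

section \<open>The Hahn--Banach theorem\<close>

lemma module_scalar_space: "Module.module scalar_space (scalar_space :: ('k::real_or_complex, 'k) nspace)"
proof -
  interpret M: Module.module scalar_space "function_module :: ('k, unit \<Rightarrow> 'k) module"
    by (rule module_function_module)
  show ?thesis
    by (rule moduleI) (auto simp: M.R.is_cring M.R.abelian_group_axioms algebra_simps)
qed

text \<open>The Hahn-Banach theorem for graphs. Domination is the only invariant, and it yields
  single-valuedness: for a value \<open>w\<close> at zero, both \<open>w\<close> and
  \<open>- w\<close> are at most the value of \<open>p\<close> at zero, which is 0.\<close>

lemma real_linear_extension:
  fixes V :: "(real, 'a, 'm) module_scheme"
  assumes V: "Module.module scalar_space V"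
    and p_add: "\<And>u v. u \<in> carrier V \<Longrightarrow> v \<in> carrier V \<Longrightarrow> p (u \<oplus>\<^bsub>V\<^esub> v) \<le> p u + p v"
    and p_smult: "\<And>c u. u \<in> carrier V \<Longrightarrow> p (c \<odot>\<^bsub>V\<^esub> u) = \<bar>c\<bar> * p u"
    and G0: "linear_relation V scalar_space G0" and dom: "\<And>u t. (u, t) \<in> G0 \<Longrightarrow> t \<le> p u"
  obtains q where "linear_map q V (scalar_space :: (real, real) nspace)" "\<And>u. u \<in> carrier V \<Longrightarrow> q u \<le> p u"
    "\<And>u t. (u, t) \<in> G0 \<Longrightarrow> q u = t"
proof -
  interpret V: Module.module scalar_space V by fact
  note K = module_scalar_space[where 'k = real]
  define P where "P z \<longleftrightarrow> snd z \<le> p (fst z)" for z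
  obtain G where G: "linear_relation V scalar_space G" "G0 \<subseteq> G" "\<And>z. z \<in> G \<Longrightarrow> P z" "fst ` G = carrier V"
  proof (rule linear_relation_extension[OF V K G0, of P])
    show "P z" if "z \<in> G0" for z
      using that dom by (cases z) (auto simp: P_def)
    fix G v assume G: "linear_relation V (scalar_space :: (real, real) nspace) G" "\<forall>z\<in>G. P z"
      and v: "v \<in> carrier V"
    have Gc: "u \<in> carrier V" and Gp: "t \<le> p u" if "(u, t) \<in> G" for u t
      using G that by (auto simp: linear_relation_def P_def)
    have G0: "(\<zero>\<^bsub>V\<^esub>, 0) \<in> G"
      and Ga: "(u, t) \<in> G \<Longrightarrow> (u', t') \<in> G \<Longrightarrow> (u \<oplus>\<^bsub>V\<^esub> u', t + t') \<in> G"
      and Gs: "(u, t) \<in> G \<Longrightarrow> (c \<odot>\<^bsub>V\<^esub> u, c * t) \<in> G" for u t u' t' c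
      using G by (auto simp: linear_relation_def)
    let ?m = "(- 1) \<odot>\<^bsub>V\<^esub> v"
    have m: "?m \<in> carrier V" and vm: "v \<oplus>\<^bsub>V\<^esub> ?m = \<zero>\<^bsub>V\<^esub>"
      using module_smult(4)[OF V, of v 1 "- 1"] v by (auto simp: module_smult[OF V] module_smult_0[OF V])
    \<comment> \<open>The vectors \<open>u + v\<close> and \<open>u' - v\<close> add up to
      \<open>u + u'\<close>, so subadditivity leaves room for a value at \<open>v\<close> between
      all lower and all upper bounds; \<open>c\<close> below is the supremum of the lower ones. By
      homogeneity the coefficients 1 and -1 decide all others.\<close>
    have key: "t' - p (u' \<oplus>\<^bsub>V\<^esub> ?m) \<le> p (u \<oplus>\<^bsub>V\<^esub> v) - t" if "(u, t) \<in> G" "(u', t') \<in> G" for u t u' t'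
    proof -
      have "(u \<oplus>\<^bsub>V\<^esub> v) \<oplus>\<^bsub>V\<^esub> (u' \<oplus>\<^bsub>V\<^esub> ?m) = u \<oplus>\<^bsub>V\<^esub> u'"
        using Gc[OF that(1)] Gc[OF that(2)] v m vm by (simp add: module_add_swap[OF V])
      then have "p (u \<oplus>\<^bsub>V\<^esub> u') \<le> p (u \<oplus>\<^bsub>V\<^esub> v) + p (u' \<oplus>\<^bsub>V\<^esub> ?m)"
        using p_add[of "u \<oplus>\<^bsub>V\<^esub> v" "u' \<oplus>\<^bsub>V\<^esub> ?m"] Gc[OF that(1)] Gc[OF that(2)] v m by simp
      with Gp[OF Ga[OF that]] show ?thesis by simp
    qed
    define L where "L = (\<lambda>(u', t'). t' - p (u' \<oplus>\<^bsub>V\<^esub> ?m)) ` G"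
    define c where "c = Sup L"
    have ne: "L \<noteq> {}" using G0 by (auto simp: L_def)
    have up: "c \<le> p (u \<oplus>\<^bsub>V\<^esub> v) - t" if "(u, t) \<in> G" for u t
      unfolding c_def by (rule cSup_least[OF ne]) (use key[OF that] in \<open>auto simp: L_def\<close>)
    have "bdd_above L"
      by (rule bdd_aboveI[of _ "p (\<zero>\<^bsub>V\<^esub> \<oplus>\<^bsub>V\<^esub> v) - 0"]) (use key[OF G0] in \<open>auto simp: L_def\<close>)
    then have lo: "t - p (u \<oplus>\<^bsub>V\<^esub> ?m) \<le> c" if "(u, t) \<in> G" for u t
      unfolding c_def by (rule cSup_upper[rotated]) (use that in \<open>force simp: L_def\<close>)
    have "t + s * c \<le> p (u \<oplus>\<^bsub>V\<^esub> s \<odot>\<^bsub>V\<^esub> v)" if ut: "(u, t) \<in> G" for u t s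
    proof -
      consider "s = 0" | "s > 0" | "s < 0" by linarith
      then show ?thesis
      proof cases
        case 1
        then show ?thesis using Gp[OF ut] Gc[OF ut] v by (simp add: module_smult_0[OF V])
      next
        case 2
        have "inverse s \<odot>\<^bsub>V\<^esub> (u \<oplus>\<^bsub>V\<^esub> s \<odot>\<^bsub>V\<^esub> v) = inverse s \<odot>\<^bsub>V\<^esub> u \<oplus>\<^bsub>V\<^esub> v"
          using 2 Gc[OF ut] v by (simp add: module_smult[OF V])
        then have "inverse s * p (u \<oplus>\<^bsub>V\<^esub> s \<odot>\<^bsub>V\<^esub> v) = p (inverse s \<odot>\<^bsub>V\<^esub> u \<oplus>\<^bsub>V\<^esub> v)"
          using p_smult[of "u \<oplus>\<^bsub>V\<^esub> s \<odot>\<^bsub>V\<^esub> v" "inverse s"] 2 Gc[OF ut] v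
          by (simp add: module_smult[OF V])
        then show ?thesis
          using up[OF Gs[OF ut, of "inverse s"]] 2 by (simp add: field_simps)
      next
        case 3
        have "(- inverse s) \<odot>\<^bsub>V\<^esub> (u \<oplus>\<^bsub>V\<^esub> s \<odot>\<^bsub>V\<^esub> v) = (- inverse s) \<odot>\<^bsub>V\<^esub> u \<oplus>\<^bsub>V\<^esub> ?m"
          using 3 Gc[OF ut] v by (simp add: module_smult[OF V])
        then have "(- inverse s) * p (u \<oplus>\<^bsub>V\<^esub> s \<odot>\<^bsub>V\<^esub> v) = p ((- inverse s) \<odot>\<^bsub>V\<^esub> u \<oplus>\<^bsub>V\<^esub> ?m)"
          using p_smult[of "u \<oplus>\<^bsub>V\<^esub> s \<odot>\<^bsub>V\<^esub> v" "- inverse s"] 3 Gc[OF ut] v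
          by (simp add: module_smult[OF V])
        then show ?thesis
          using lo[OF Gs[OF ut, of "- inverse s"]] 3 by (simp add: field_simps)
      qed
    qed
    then show "\<exists>w\<in>carrier scalar_space. \<forall>u t s. (u, t) \<in> G \<longrightarrow>
        P (u \<oplus>\<^bsub>V\<^esub> s \<odot>\<^bsub>V\<^esub> v, t \<oplus>\<^bsub>scalar_space\<^esub> s \<odot>\<^bsub>scalar_space\<^esub> w)"
      by (auto simp: P_def)
  qed (use that in blast)
  have single: "w = \<zero>\<^bsub>scalar_space\<^esub>" if "(\<zero>\<^bsub>V\<^esub>, w) \<in> G" for w :: real
  proof -
    have "p \<zero>\<^bsub>V\<^esub> = 0"
      using p_smult[of "\<zero>\<^bsub>V\<^esub>" 0] by (simp add: module_smult_0[OF V])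
    moreover have "((- 1) \<odot>\<^bsub>V\<^esub> \<zero>\<^bsub>V\<^esub>, (- 1) \<odot>\<^bsub>scalar_space\<^esub> w) \<in> G"
      using G(1) that unfolding linear_relation_def by blast
    ultimately show ?thesis
      using G(3)[OF that] G(3)[of "(\<zero>\<^bsub>V\<^esub>, - w)"] by (simp add: P_def module_smult_zero[OF V])
  qed
  obtain q where q: "linear_map q V (scalar_space :: (real, real) nspace)"
    "\<And>u t. (u, t) \<in> G \<longleftrightarrow> u \<in> carrier V \<and> t = q u"
    by (rule linear_relation_graph[OF V K G(1,4) single]) auto
  show thesis
  proof (rule that[OF q(1)])
    show "q u \<le> p u" if "u \<in> carrier V" for u
      using q(2)[of u "q u"] G(3)[of "(u, q u)"] that by (simp add: P_def)
    show "q u = t" if "(u, t) \<in> G0" for u t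
      using that G(2) q(2)[of u t] by auto
  qed
qed

lemma linear_mapD:
  assumes "linear_map T E F"
  shows "x \<in> carrier E \<Longrightarrow> T x \<in> carrier F"
    and "x \<in> carrier E \<Longrightarrow> y \<in> carrier E \<Longrightarrow> T (x \<oplus>\<^bsub>E\<^esub> y) = T x \<oplus>\<^bsub>F\<^esub> T y"
    and "x \<in> carrier E \<Longrightarrow> T (c \<odot>\<^bsub>E\<^esub> x) = c \<odot>\<^bsub>F\<^esub> T x"
  using assms by (auto simp: linear_map_def)

text \<open>Over the complex numbers a functional is determined by its real part through f u = q u -
  q (j u) j; over the reals f is q. The last two conclusions are what separation will ask for: the
  real part bounds the modulus from below, and f vanishes at a vector if q vanishes on all its
  scalar multiples.\<close>

lemma complexify_functional:
  fixes V :: "('k::real_or_complex, 'a, 'm) module_scheme"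
  assumes V: "Module.module scalar_space V"
    and p_smult: "\<And>c u. u \<in> carrier V \<Longrightarrow> p (c \<odot>\<^bsub>V\<^esub> u) = norm c * p u"
    and q_add: "\<And>u v. u \<in> carrier V \<Longrightarrow> v \<in> carrier V \<Longrightarrow> q (u \<oplus>\<^bsub>V\<^esub> v) = q u + q v"
    and q_smult: "\<And>s u. u \<in> carrier V \<Longrightarrow> q (of_real s \<odot>\<^bsub>V\<^esub> u) = s * q u"
    and q_le: "\<And>u. u \<in> carrier V \<Longrightarrow> q u \<le> p u"
  obtains f where "linear_map f V (scalar_space :: ('k, 'k) nspace)"
    "\<And>u. u \<in> carrier V \<Longrightarrow> norm (f u) \<le> p u"
    "\<And>u. u \<in> carrier V \<Longrightarrow> \<bar>q u\<bar> \<le> norm (f u)"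
    "\<And>u. u \<in> carrier V \<Longrightarrow> (\<And>c. q (c \<odot>\<^bsub>V\<^esub> u) = 0) \<Longrightarrow> f u = 0"
proof -
  interpret V: Module.module scalar_space V by fact
  note sm = module_smult[OF V]
  have q_abs: "\<bar>q u\<bar> \<le> p u" if "u \<in> carrier V" for u
    using q_le[OF that] q_le[OF sm(1)[OF that], of "- 1"] q_smult[OF that, of "- 1"] p_smult[OF that, of "- 1"]
    by simp
  consider (real) "\<forall>c::'k. \<exists>a::real. c = a *\<^sub>R 1"
    | (complex) j :: 'k where "j * j = - 1"
      "\<And>c. \<exists>a b. c = a *\<^sub>R 1 + b *\<^sub>R j \<and> norm c = sqrt (a\<^sup>2 + b\<^sup>2)"
    using real_or_complex by metis
  then show thesis
  proof cases
    case real
    then have real: "\<exists>a. c = of_real a" for c :: 'k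
      by (metis scaleR_conv_of_real mult.right_neutral)
    show thesis
    proof (rule that[of "\<lambda>u. of_real (q u)"])
      show "linear_map (\<lambda>u. of_real (q u)) V (scalar_space :: ('k, 'k) nspace)"
        unfolding linear_map_def
      proof (intro conjI ballI allI)
        fix c :: 'k and u assume u: "u \<in> carrier V"
        obtain a where "c = of_real a" using real by blast
        then show "of_real (q (c \<odot>\<^bsub>V\<^esub> u)) = c \<odot>\<^bsub>scalar_space\<^esub> (of_real (q u) :: 'k)"
          using q_smult[OF u] by simp
      qed (auto simp: q_add)
      show "of_real (q u) = (0::'k)" if "u \<in> carrier V" "\<And>c. q (c \<odot>\<^bsub>V\<^esub> u) = 0" for u
        using that(2)[of 1] that(1) by (simp add: sm)
    qed (use q_abs in auto)
  next
    case (complex j)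
    have rep: "\<exists>a b. c = of_real a + of_real b * j \<and> norm c = sqrt (a\<^sup>2 + b\<^sup>2)" for c
      using complex(2)[of c] by (simp add: scaleR_conv_of_real)
    \<comment> \<open>The class grants the norm formula only for some representation a + b j of each
      scalar. Independence of 1 and \<open>j\<close> over the reals makes the representation unique,
      so the formula holds for all \<open>a\<close> and \<open>b\<close>.\<close>
    have j_real: "j \<noteq> of_real r" for r
    proof
      assume "j = of_real r"
      then have "of_real (r * r) = (of_real (- 1) :: 'k)" using complex(1) by simp
      then have "r * r = - 1" by (simp only: of_real_eq_iff)
      then show False by (metis zero_le_square neg_0_le_iff_le not_one_le_zero)
    qed
    have im0: "b = 0" if "of_real b * j = of_real a" for a b
    proof (rule ccontr)
      assume "b \<noteq> 0"
      then have "j = of_real (a / b)" using that by (simp add: field_simps)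
      with j_real show False by blast
    qed
    have norm: "norm (of_real a + of_real b * j) = sqrt (a\<^sup>2 + b\<^sup>2)" for a b
    proof -
      obtain a' b' where ab: "of_real a + of_real b * j = of_real a' + of_real b' * j"
        and n: "norm (of_real a + of_real b * j) = sqrt (a'\<^sup>2 + b'\<^sup>2)"
        using rep by blast
      have "of_real (b - b') * j = of_real (a' - a)"
        using ab by (simp add: algebra_simps)
      then have "b = b'" using im0 by fastforce
      with ab n show ?thesis by simp
    qed
    define f where "f u = of_real (q u) + of_real (- q (j \<odot>\<^bsub>V\<^esub> u)) * j" for u
    have f_add: "f (u \<oplus>\<^bsub>V\<^esub> v) = f u + f v" if "u \<in> carrier V" "v \<in> carrier V" for u v
      using that by (simp add: f_def q_add sm algebra_simps)
    have f_smult: "f (c \<odot>\<^bsub>V\<^esub> u) = c * f u" if u: "u \<in> carrier V" for c u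
    proof -
      obtain a b where c: "c = of_real a + of_real b * j" using rep by blast
      have q1: "q (c \<odot>\<^bsub>V\<^esub> u) = a * q u + b * q (j \<odot>\<^bsub>V\<^esub> u)"
        using u q_smult[OF sm(1)[OF u], of b j] q_smult[OF u, of a] by (simp add: c sm q_add)
      have jc: "j * c = of_real a * j + of_real (- b)"
        using complex(1) by (simp add: c distrib_left mult.left_commute[of j "of_real b" j])
      have q2: "q (j \<odot>\<^bsub>V\<^esub> (c \<odot>\<^bsub>V\<^esub> u)) = a * q (j \<odot>\<^bsub>V\<^esub> u) - b * q u"
        using u q_smult[OF sm(1)[OF u], of a j] q_smult[OF u, of "- b"] by (simp add: sm jc q_add del: of_real_minus add_uminus_conv_diff)
      have "c * f u = of_real a * of_real (q u) + of_real b * of_real (- q (j \<odot>\<^bsub>V\<^esub> u)) * (j * j)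
          + (of_real b * of_real (q u) + of_real a * of_real (- q (j \<odot>\<^bsub>V\<^esub> u))) * j"
        by (simp only: c f_def algebra_simps)
      also have "\<dots> = f (c \<odot>\<^bsub>V\<^esub> u)"
        by (simp add: f_def q1 q2 complex(1) algebra_simps)
      finally show ?thesis by simp
    qed
    show thesis
    proof (rule that[of f])
      show "linear_map f V scalar_space"
        by (auto simp: linear_map_def f_add f_smult)
      show "norm (f u) \<le> p u" if u: "u \<in> carrier V" for u
      proof (cases "f u = 0")
        case True
        then show ?thesis using q_abs[OF u] by simp
      next
        case False
        \<comment> \<open>The unimodular \<open>c\<close> turns \<open>f u\<close> into a
          nonnegative real number, where \<open>f\<close> agrees with \<open>q\<close> and
          \<open>q_le\<close> applies.\<close>
        define c where "c = of_real (norm (f u)) / f u"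
        have nc: "norm c = 1" using False by (simp add: c_def norm_divide)
        have "f (c \<odot>\<^bsub>V\<^esub> u) = of_real (norm (f u))"
          using False by (simp add: f_smult[OF u] c_def)
        then have "of_real (- q (j \<odot>\<^bsub>V\<^esub> (c \<odot>\<^bsub>V\<^esub> u))) * j = of_real (norm (f u) - q (c \<odot>\<^bsub>V\<^esub> u))"
          unfolding f_def by (simp add: algebra_simps)
        then have "- q (j \<odot>\<^bsub>V\<^esub> (c \<odot>\<^bsub>V\<^esub> u)) = 0" by (rule im0)
        with \<open>f (c \<odot>\<^bsub>V\<^esub> u) = of_real (norm (f u))\<close> have "q (c \<odot>\<^bsub>V\<^esub> u) = norm (f u)"
          unfolding f_def[of "c \<odot>\<^bsub>V\<^esub> u"] by simp
        then show ?thesis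
          using q_le[OF sm(1)[OF u], of c] p_smult[OF u, of c] nc by simp
      qed
      show "\<bar>q u\<bar> \<le> norm (f u)" if "u \<in> carrier V" for u
        by (simp only: f_def norm) (rule real_le_rsqrt, simp)
      show "f u = 0" if "u \<in> carrier V" "\<And>c. q (c \<odot>\<^bsub>V\<^esub> u) = 0" for u
        using that(2)[of j] that(2)[of 1] that(1) by (simp add: sm f_def)
    qed
  qed
qed

text \<open>Closure under negation is multiplication by -1;
  \<open>submodule_iff_linear_subspace\<close> gives the link to the submodules in
  \<open>linear_span\<close>.\<close>

definition linear_subspace :: "('k::real_or_complex, 'a, 'm) module_scheme \<Rightarrow> 'a set \<Rightarrow> bool" where
  "linear_subspace V D \<longleftrightarrow> D \<subseteq> carrier V \<and> \<zero>\<^bsub>V\<^esub> \<in> D \<and> (\<forall>u\<in>D. \<forall>v\<in>D. u \<oplus>\<^bsub>V\<^esub> v \<in> D) \<and>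
     (\<forall>c. \<forall>u\<in>D. c \<odot>\<^bsub>V\<^esub> u \<in> D)"

text \<open>On the real multiples of \<open>a\<close> plus \<open>D\<close>, the functional t a + d
  |-> t is dominated by \<open>p\<close>, since p (t a + d) = |t| p (a + d/t) >= |t| for nonzero t.
  It is extended over the real scalars and then complexified. As \<open>D\<close> is invariant under
  all scalars, the complexified functional still vanishes on it.\<close>

theorem separating_functional:
  fixes V :: "('k::real_or_complex, 'a, 'm) module_scheme"
  assumes V: "Module.module scalar_space V"
    and p_add: "\<And>u v. u \<in> carrier V \<Longrightarrow> v \<in> carrier V \<Longrightarrow> p (u \<oplus>\<^bsub>V\<^esub> v) \<le> p u + p v"
    and p_smult: "\<And>c u. u \<in> carrier V \<Longrightarrow> p (c \<odot>\<^bsub>V\<^esub> u) = norm c * p u"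
    and D: "linear_subspace V D" and a: "a \<in> carrier V"
    and sep: "\<And>d. d \<in> D \<Longrightarrow> 1 \<le> p (a \<oplus>\<^bsub>V\<^esub> d)"
  obtains f where "linear_map f V (scalar_space :: ('k, 'k) nspace)"
    "\<And>u. u \<in> carrier V \<Longrightarrow> norm (f u) \<le> p u" "\<And>d. d \<in> D \<Longrightarrow> f d = 0" "1 \<le> norm (f a)"
proof -
  interpret V: Module.module scalar_space V by fact
  note sm = module_smult[OF V] and sm0 = module_smult_0[OF V]
  \<comment> \<open>The space \<open>V\<close> with its scalars restricted to the reals.\<close>
  define VR :: "(real, 'a) module" where
    "VR = \<lparr>carrier = carrier V, mult = undefined, one = undefined, zero = \<zero>\<^bsub>V\<^esub>,
       add = (\<lambda>x y. x \<oplus>\<^bsub>V\<^esub> y), smult = (\<lambda>s x. of_real s \<odot>\<^bsub>V\<^esub> x)\<rparr>"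
  have "abelian_group VR"
  proof (rule abelian_groupI)
    fix x assume "x \<in> carrier VR"
    then show "\<exists>y\<in>carrier VR. y \<oplus>\<^bsub>VR\<^esub> x = \<zero>\<^bsub>VR\<^esub>"
      by (intro bexI[of _ "\<ominus>\<^bsub>V\<^esub> x"]) (auto simp: VR_def V.M.l_neg)
  qed (auto simp: VR_def V.M.a_ac)
  moreover have "cring (scalar_space :: (real, real) nspace)"
    using Module.module.axioms(1)[OF module_scalar_space] .
  ultimately have VR: "Module.module scalar_space VR"
    by (intro moduleI) (auto simp: VR_def sm)
  have Dc: "d \<in> carrier V" and Da: "d \<in> D \<Longrightarrow> d' \<in> D \<Longrightarrow> d \<oplus>\<^bsub>V\<^esub> d' \<in> D"
    and Ds: "d \<in> D \<Longrightarrow> c \<odot>\<^bsub>V\<^esub> d \<in> D" if "d \<in> D" for c d d'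
    using D that by (auto simp: linear_subspace_def)
  have D0: "\<zero>\<^bsub>V\<^esub> \<in> D" using D by (auto simp: linear_subspace_def)
  \<comment> \<open>Domination by \<open>p\<close> is what has to be checked for this relation; that
    \<open>t\<close> is determined by the vector follows from it.\<close>
  define G0 where "G0 = {(of_real t \<odot>\<^bsub>V\<^esub> a \<oplus>\<^bsub>V\<^esub> d, t) | t d. d \<in> D}"
  have "linear_relation VR (scalar_space :: (real, real) nspace) G0"
    unfolding linear_relation_def
  proof (intro conjI allI impI)
    show "G0 \<subseteq> carrier VR \<times> carrier scalar_space"
      using a Dc by (auto simp: G0_def VR_def sm)
    show "(\<zero>\<^bsub>VR\<^esub>, \<zero>\<^bsub>scalar_space\<^esub>) \<in> G0"
      using a D0 by (auto simp: G0_def VR_def sm0 intro!: exI[of _ "\<zero>\<^bsub>V\<^esub>"])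
  next
    fix u t v w assume "(u, t) \<in> G0" "(v, w) \<in> G0"
    then obtain d d' where *: "d \<in> D" "d' \<in> D" "u = of_real t \<odot>\<^bsub>V\<^esub> a \<oplus>\<^bsub>V\<^esub> d" "v = of_real w \<odot>\<^bsub>V\<^esub> a \<oplus>\<^bsub>V\<^esub> d'"
      by (auto simp: G0_def)
    have "u \<oplus>\<^bsub>V\<^esub> v = of_real (t + w) \<odot>\<^bsub>V\<^esub> a \<oplus>\<^bsub>V\<^esub> (d \<oplus>\<^bsub>V\<^esub> d')"
      using * a Dc by (simp add: sm module_add_swap[OF V])
    then show "(u \<oplus>\<^bsub>VR\<^esub> v, t \<oplus>\<^bsub>scalar_space\<^esub> w) \<in> G0"
      using Da[OF *(1) *(1) *(2)] by (auto simp: G0_def VR_def)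
  next
    fix c u t assume "(u, t) \<in> G0"
    then obtain d where *: "d \<in> D" "u = of_real t \<odot>\<^bsub>V\<^esub> a \<oplus>\<^bsub>V\<^esub> d"
      by (auto simp: G0_def)
    have "of_real c \<odot>\<^bsub>V\<^esub> u = of_real (c * t) \<odot>\<^bsub>V\<^esub> a \<oplus>\<^bsub>V\<^esub> of_real c \<odot>\<^bsub>V\<^esub> d"
      using * a Dc by (simp add: sm)
    then show "(c \<odot>\<^bsub>VR\<^esub> u, c \<odot>\<^bsub>scalar_space\<^esub> t) \<in> G0"
      using Ds[OF *(1) *(1)] by (auto simp: G0_def VR_def)
  qed
  moreover have "t \<le> p u" if "(u, t) \<in> G0" for u t
  proof -
    obtain d where d: "d \<in> D" "u = of_real t \<odot>\<^bsub>V\<^esub> a \<oplus>\<^bsub>V\<^esub> d" using \<open>(u, t) \<in> G0\<close> by (auto simp: G0_def)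
    show ?thesis
    proof (cases "t = 0")
      case True
      \<comment> \<open>With t = 0 the claim is nonnegativity of the seminorm, from 0 = p (d - d) <=
        2 p d.\<close>
      have "p (d \<oplus>\<^bsub>V\<^esub> (- 1) \<odot>\<^bsub>V\<^esub> d) = 0"
        using p_smult[of d "1 + (- 1)"] p_smult[of d 0] sm(4)[of d 1 "- 1"] Dc[OF d(1)] by (simp add: sm)
      then show ?thesis
        using True d a Dc[OF d(1)] p_add[of d "(- 1) \<odot>\<^bsub>V\<^esub> d"] p_smult[of d "- 1"] by (simp add: sm sm0)
    next
      case False
      have "u = of_real t \<odot>\<^bsub>V\<^esub> (a \<oplus>\<^bsub>V\<^esub> of_real (inverse t) \<odot>\<^bsub>V\<^esub> d)"
        using d a Dc[OF d(1)] False by (simp add: sm)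
      then have "p u = \<bar>t\<bar> * p (a \<oplus>\<^bsub>V\<^esub> of_real (inverse t) \<odot>\<^bsub>V\<^esub> d)"
        using p_smult[of "a \<oplus>\<^bsub>V\<^esub> of_real (inverse t) \<odot>\<^bsub>V\<^esub> d" "of_real t"] a sm(1)[OF Dc[OF d(1)]] by simp
      also have "\<dots> \<ge> \<bar>t\<bar> * 1"
        by (intro mult_left_mono sep Ds[OF d(1) d(1)]) simp
      finally show ?thesis by simp
    qed
  qed
  ultimately obtain q where q: "linear_map q VR (scalar_space :: (real, real) nspace)"
    "\<And>u. u \<in> carrier VR \<Longrightarrow> q u \<le> p u" "\<And>u t. (u, t) \<in> G0 \<Longrightarrow> q u = t"
    by (rule real_linear_extension[OF VR, rotated 2]) (auto simp: VR_def p_add p_smult)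
  obtain f where f: "linear_map f V (scalar_space :: ('k, 'k) nspace)"
    "\<And>u. u \<in> carrier V \<Longrightarrow> norm (f u) \<le> p u"
    "\<And>u. u \<in> carrier V \<Longrightarrow> \<bar>q u\<bar> \<le> norm (f u)"
    "\<And>u. u \<in> carrier V \<Longrightarrow> (\<And>c. q (c \<odot>\<^bsub>V\<^esub> u) = 0) \<Longrightarrow> f u = 0"
    using complexify_functional[OF V p_smult, of q] q(2) linear_mapD[OF q(1)] by (auto simp: VR_def)
  show thesis
  proof (rule that[OF f(1,2)])
    show "f d = 0" if d: "d \<in> D" for d
    proof (rule f(4)[OF Dc[OF d]])
      fix c
      have cd: "c \<odot>\<^bsub>V\<^esub> d \<in> D" using Ds[OF d d] .
      then have "(of_real 0 \<odot>\<^bsub>V\<^esub> a \<oplus>\<^bsub>V\<^esub> c \<odot>\<^bsub>V\<^esub> d, 0) \<in> G0" unfolding G0_def by blast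
      then show "q (c \<odot>\<^bsub>V\<^esub> d) = 0"
        using q(3) a Dc[OF cd] by (simp add: sm0)
    qed
    have "(of_real 1 \<odot>\<^bsub>V\<^esub> a \<oplus>\<^bsub>V\<^esub> \<zero>\<^bsub>V\<^esub>, 1) \<in> G0" unfolding G0_def using D0 by blast
    then have "q a = 1" using q(3) a by (simp add: sm)
    with f(3)[OF a] show "1 \<le> norm (f a)" by simp
  qed
qed

section \<open>Finite-dimensional subspaces\<close>

text \<open>The real coordinates of a scalar are bounded by its norm, so the ball is covered by the
  continuous image of an interval or a square. Completeness and finite nets of scalars are read off
  from this compact cover.\<close>

lemma compact_scalars:
  obtains S :: "'k::real_or_complex set" where "compact S" "\<And>c. norm c \<le> R \<Longrightarrow> c \<in> S"
proof -
  consider (real) "\<forall>c::'k. \<exists>a::real. c = a *\<^sub>R 1"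
    | (complex) j :: 'k where "\<And>c. \<exists>a b. c = a *\<^sub>R 1 + b *\<^sub>R j \<and> norm c = sqrt (a\<^sup>2 + b\<^sup>2)"
    using real_or_complex by metis
  then show thesis
  proof cases
    case real
    show thesis
    proof (rule that[of "(\<lambda>a. a *\<^sub>R 1) ` {- R..R}"])
      show "compact ((\<lambda>a. a *\<^sub>R (1::'k)) ` {- R..R})"
        by (intro compact_continuous_image continuous_intros compact_Icc)
      fix c :: 'k assume c: "norm c \<le> R"
      obtain a where "c = a *\<^sub>R 1" using real by blast
      with c show "c \<in> (\<lambda>a. a *\<^sub>R 1) ` {- R..R}" by (auto intro!: image_eqI[of _ _ a])
    qed
  next
    case (complex j)
    show thesis
    proof (rule that[of "(\<lambda>(a, b). a *\<^sub>R 1 + b *\<^sub>R j) ` ({- R..R} \<times> {- R..R})"])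
      show "compact ((\<lambda>(a, b). a *\<^sub>R 1 + b *\<^sub>R j) ` ({- R..R} \<times> {- R..R}))"
        unfolding case_prod_unfold
        by (intro compact_continuous_image continuous_intros compact_Times compact_Icc)
      fix c :: 'k assume c: "norm c \<le> R"
      obtain a b where ab: "c = a *\<^sub>R 1 + b *\<^sub>R j" "norm c = sqrt (a\<^sup>2 + b\<^sup>2)" using complex by blast
      have "\<bar>a\<bar> \<le> sqrt (a\<^sup>2 + b\<^sup>2)" "\<bar>b\<bar> \<le> sqrt (a\<^sup>2 + b\<^sup>2)"
        by (auto intro: real_le_rsqrt)
      then have "\<bar>a\<bar> \<le> R" "\<bar>b\<bar> \<le> R" using ab(2) c by linarith+
      then show "c \<in> (\<lambda>(a, b). a *\<^sub>R 1 + b *\<^sub>R j) ` ({- R..R} \<times> {- R..R})"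
        using ab(1) by (auto intro!: image_eqI[of _ _ "(a, b)"])
    qed
  qed
qed

lemma scalars_complete:
  fixes c :: "nat \<Rightarrow> 'k::real_or_complex"
  assumes "Cauchy c"
  obtains l where "c \<longlonglongrightarrow> l"
proof -
  have "bounded (range c)" using assms by (rule cauchy_imp_bounded)
  then obtain R where R: "\<And>m. norm (c m) \<le> R" by (auto simp: bounded_iff)
  obtain S :: "'k set" where S: "compact S" "\<And>z. norm z \<le> R \<Longrightarrow> z \<in> S" by (rule compact_scalars[of R]) auto
  have "complete S" using S(1) by (rule compact_imp_complete)
  then show thesis using S(2) R assms that unfolding complete_def by blast
qed

lemma scalars_totally_bounded:
  assumes "e > 0"
  obtains N :: "'k::real_or_complex set" where "finite N" "\<And>c. norm c \<le> R \<Longrightarrow> \<exists>z\<in>N. norm (c - z) < e"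
proof -
  obtain S :: "'k set" where S: "compact S" "\<And>z. norm z \<le> R \<Longrightarrow> z \<in> S" by (rule compact_scalars[of R]) auto
  then obtain N where N: "finite N" "S \<subseteq> (\<Union>x\<in>N. ball x e)"
    using assms unfolding compact_eq_totally_bounded by blast
  show thesis
  proof (rule that[OF N(1)])
    fix c :: 'k assume "norm c \<le> R"
    with S(2) N(2) have "c \<in> (\<Union>x\<in>N. ball x e)" by blast
    then show "\<exists>z\<in>N. norm (c - z) < e" by (auto simp: dist_norm norm_minus_commute)
  qed
qed

section \<open>Arithmetic of norms; subspaces and spans\<close>

lemma module_add_minus:
  assumes V: "Module.module scalar_space (V :: ('k::real_or_complex, 'a, 'm) module_scheme)"
    and "y \<in> carrier V"
  shows "y \<oplus>\<^bsub>V\<^esub> (- 1) \<odot>\<^bsub>V\<^esub> y = \<zero>\<^bsub>V\<^esub>" "(- 1) \<odot>\<^bsub>V\<^esub> y \<oplus>\<^bsub>V\<^esub> y = \<zero>\<^bsub>V\<^esub>"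
  using module_smult(4)[OF V, of y 1 "- 1"] module_smult(4)[OF V, of y "- 1" 1] assms
  by (auto simp: module_smult[OF V] module_smult_0[OF V])

lemma module_minus:
  assumes V: "Module.module scalar_space (V :: ('k::real_or_complex, 'a, 'm) module_scheme)"
    and "x \<in> carrier V" "y \<in> carrier V"
  shows "\<ominus>\<^bsub>V\<^esub> y = (- 1) \<odot>\<^bsub>V\<^esub> y" "x \<ominus>\<^bsub>V\<^esub> y = x \<oplus>\<^bsub>V\<^esub> (- 1) \<odot>\<^bsub>V\<^esub> y"
proof -
  interpret V: Module.module scalar_space V by fact
  show "\<ominus>\<^bsub>V\<^esub> y = (- 1) \<odot>\<^bsub>V\<^esub> y"
    by (rule V.M.minus_equality[OF module_add_minus(2)[OF V]]) (use assms module_smult(1)[OF V] in auto)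
  then show "x \<ominus>\<^bsub>V\<^esub> y = x \<oplus>\<^bsub>V\<^esub> (- 1) \<odot>\<^bsub>V\<^esub> y"
    by (simp add: a_minus_def)
qed

context normed_space
begin

lemma is_module: "Module.module scalar_space E" ..

lemmas sm = module_smult[OF is_module] module_smult_0[OF is_module]
  module_smult_zero[OF is_module] and
  minus_eq = module_minus(2)[OF is_module] and
  add_minus = module_add_minus[OF is_module] and
  add_swap = module_add_swap[OF is_module]

lemma vnorm_zero [simp]: "vnorm E \<zero> = 0"
  using vnorm_eq_0_iff[of \<zero>] by simp

lemma vnorm_diff:
  assumes "x \<in> carrier E" "y \<in> carrier E"
  shows "vnorm E x \<le> vnorm E (x \<ominus> y) + vnorm E y"
proof -
  have "x = (x \<ominus> y) \<oplus> y"
    using assms by (simp add: minus_eq sm M.a_assoc add_minus)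
  then show ?thesis
    using vnorm_triangle[of "x \<ominus> y" y] assms by simp
qed

lemma vnorm_minus_commute:
  assumes "x \<in> carrier E" "y \<in> carrier E"
  shows "vnorm E (x \<ominus> y) = vnorm E (y \<ominus> x)"
proof -
  have "x \<ominus> y = (- 1) \<odot> (y \<ominus> x)"
    using assms by (simp add: minus_eq sm M.a_comm)
  then show ?thesis
    using vnorm_smult[of "y \<ominus> x" "- 1"] assms by simp
qed

lemma vnorm_dist_triangle:
  assumes "x \<in> carrier E" "y \<in> carrier E" "z \<in> carrier E"
  shows "vnorm E (x \<ominus> z) \<le> vnorm E (x \<ominus> y) + vnorm E (y \<ominus> z)"
proof -
  have "x \<ominus> z = (x \<ominus> y) \<oplus> (y \<ominus> z)"
  proof -
    have "(x \<ominus> y) \<oplus> (y \<ominus> z) = x \<oplus> (((- 1) \<odot> y \<oplus> y) \<oplus> (- 1) \<odot> z)"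
      using assms sm(1) by (simp add: minus_eq M.a_assoc)
    also have "\<dots> = x \<ominus> z"
      using assms sm(1) by (simp add: minus_eq add_minus)
    finally show ?thesis by simp
  qed
  then show ?thesis
    using vnorm_triangle[of "x \<ominus> y" "y \<ominus> z"] assms by simp
qed

lemma vnorm_minus_eq_0: "x \<in> carrier E \<Longrightarrow> y \<in> carrier E \<Longrightarrow> vnorm E (x \<ominus> y) = 0 \<Longrightarrow> x = y"
  using vnorm_eq_0_iff[of "x \<ominus> y"] M.r_neg1[of y x] M.a_comm[of x "\<ominus> y"] M.r_neg2[of y x]
  by (simp add: a_minus_def)

end

lemma submodule_iff_linear_subspace:
  fixes V :: "('k::real_or_complex, 'a, 'm) module_scheme"
  assumes V: "Module.module scalar_space V"
  shows "submodule H scalar_space V \<longleftrightarrow> linear_subspace V H"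
proof -
  interpret V: Module.module scalar_space V by fact
  show ?thesis
  proof
    assume "submodule H scalar_space V"
    then interpret H: submodule H scalar_space V .
    show "linear_subspace V H"
      using H.one_closed H.m_closed H.smult_closed H.subset by (auto simp: linear_subspace_def)
  next
    assume H: "linear_subspace V H"
    have "\<ominus>\<^bsub>V\<^esub> y \<in> H" if "y \<in> H" for y
      using H that module_minus(1)[OF V _ subsetD[OF _ that], of y] by (auto simp: linear_subspace_def)
    with H show "submodule H scalar_space V"
      by (intro V.submoduleI) (auto simp: linear_subspace_def)
  qed
qed

lemma linear_subspaceD:
  assumes "linear_subspace V D"
  shows "u \<in> D \<Longrightarrow> u \<in> carrier V" "\<zero>\<^bsub>V\<^esub> \<in> D" "u \<in> D \<Longrightarrow> v \<in> D \<Longrightarrow> u \<oplus>\<^bsub>V\<^esub> v \<in> D"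
    "u \<in> D \<Longrightarrow> c \<odot>\<^bsub>V\<^esub> u \<in> D"
  using assms by (auto simp: linear_subspace_def)

lemma linear_span:
  assumes V: "Module.module scalar_space V" and B: "B \<subseteq> carrier V"
  shows "linear_subspace V (linear_span V B)" "B \<subseteq> linear_span V B"
    "linear_subspace V H \<Longrightarrow> B \<subseteq> H \<Longrightarrow> linear_span V B \<subseteq> H"
proof -
  interpret V: Module.module scalar_space V by fact
  have c: "linear_subspace V (carrier V)"
    by (auto simp: linear_subspace_def module_smult[OF V])
  show "B \<subseteq> linear_span V B"
    by (simp add: linear_span_def hull_subset)
  show "linear_span V B \<subseteq> H" if "linear_subspace V H" "B \<subseteq> H"
    using that by (simp add: linear_span_def hull_minimal submodule_iff_linear_subspace[OF V])
  have eq: "linear_span V B = \<Inter>{H. linear_subspace V H \<and> B \<subseteq> H}"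
    by (simp add: linear_span_def hull_def submodule_iff_linear_subspace[OF V])
  show "linear_subspace V (linear_span V B)"
    unfolding eq linear_subspace_def[of V "\<Inter>_"]
    using c B linear_subspaceD(2-)[of V] by auto
qed

lemma normed_space_subspace:
  assumes E: "normed_space E" and H: "linear_subspace E H"
  shows "normed_space (E\<lparr>carrier := H\<rparr>)"
proof -
  interpret E: normed_space E by fact
  note D = linear_subspaceD[OF H]
  have "abelian_group (E\<lparr>carrier := H\<rparr>)"
  proof (rule abelian_groupI)
    fix x assume "x \<in> carrier (E\<lparr>carrier := H\<rparr>)"
    then show "\<exists>y\<in>carrier (E\<lparr>carrier := H\<rparr>). y \<oplus>\<^bsub>E\<lparr>carrier := H\<rparr>\<^esub> x = \<zero>\<^bsub>E\<lparr>carrier := H\<rparr>\<^esub>"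
      by (intro bexI[of _ "(- 1) \<odot>\<^bsub>E\<^esub> x"]) (auto simp: E.add_minus D)
  qed (auto simp: D E.M.a_ac)
  then have "Module.module scalar_space (E\<lparr>carrier := H\<rparr>)"
    by (intro moduleI) (auto simp: E.R.is_cring D E.sm)
  moreover have "normed_space_axioms (E\<lparr>carrier := H\<rparr>)"
    by unfold_locales (auto simp: D E.vnorm_nonneg E.vnorm_eq_0_iff E.vnorm_triangle E.vnorm_smult)
  ultimately show ?thesis
    by (simp add: normed_space_def)
qed

section \<open>Finite dimension, by induction on a spanning set\<close>

definition seminorm_on :: "('k::real_or_complex, 'a, 'm) module_scheme \<Rightarrow> 'a set \<Rightarrow> ('a \<Rightarrow> real) \<Rightarrow> bool" where
  "seminorm_on V H p \<longleftrightarrow> (\<forall>u\<in>H. \<forall>v\<in>H. p (u \<oplus>\<^bsub>V\<^esub> v) \<le> p u + p v) \<and> (\<forall>c. \<forall>u\<in>H. p (c \<odot>\<^bsub>V\<^esub> u) = norm c * p u)"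

text \<open>Three consequences of finite dimension of a subspace: it is closed,
  all its seminorms are bounded, and its bounded subsets are totally bounded.\<close>

definition finite_dimensional_like :: "('k::real_or_complex, 'a) nspace \<Rightarrow> 'a set \<Rightarrow> bool" where
  "finite_dimensional_like E H \<longleftrightarrow>
     (\<forall>a\<in>carrier E. a \<notin> H \<longrightarrow> (\<exists>d>0. \<forall>m\<in>H. d \<le> vnorm E (m \<oplus>\<^bsub>E\<^esub> a))) \<and>
     (\<forall>p. seminorm_on E H p \<longrightarrow> (\<exists>C\<ge>0. \<forall>x\<in>H. p x \<le> C * vnorm E x)) \<and>
     (\<forall>R. \<forall>e>0. \<exists>N\<subseteq>H. finite N \<and> (\<forall>x\<in>H. vnorm E x \<le> R \<longrightarrow> (\<exists>y\<in>N. vnorm E (x \<ominus>\<^bsub>E\<^esub> y) \<le> e)))"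

lemma finite_dimensional_likeD:
  assumes "finite_dimensional_like E H"
  shows "a \<in> carrier E \<Longrightarrow> a \<notin> H \<Longrightarrow> \<exists>d>0. \<forall>m\<in>H. d \<le> vnorm E (m \<oplus>\<^bsub>E\<^esub> a)"
    and "seminorm_on E H p \<Longrightarrow> \<exists>C\<ge>0. \<forall>x\<in>H. p x \<le> C * vnorm E x"
    and "e > 0 \<Longrightarrow> \<exists>N\<subseteq>H. finite N \<and> (\<forall>x\<in>H. vnorm E x \<le> R \<longrightarrow> (\<exists>y\<in>N. vnorm E (x \<ominus>\<^bsub>E\<^esub> y) \<le> e))"
  using assms unfolding finite_dimensional_like_def by simp_all

context normed_space
begin

lemma finite_dimensional_like_zero: "finite_dimensional_like E {\<zero>}"
  unfolding finite_dimensional_like_def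
proof (intro conjI ballI allI impI)
  fix a assume "a \<in> carrier E" "a \<notin> {\<zero>}"
  then show "\<exists>d>0. \<forall>m\<in>{\<zero>}. d \<le> vnorm E (m \<oplus> a)"
    using vnorm_nonneg[of a] vnorm_eq_0_iff[of a] by (intro exI[of _ "vnorm E a"]) auto
next
  fix p assume "seminorm_on E {\<zero>} p"
  then have "p (0 \<odot> \<zero>) = norm (0::'k) * p \<zero>" unfolding seminorm_on_def by blast
  then show "\<exists>C\<ge>0. \<forall>x\<in>{\<zero>}. p x \<le> C * vnorm E x" by (auto simp: sm)
next
  fix R e :: real assume "e > 0"
  then show "\<exists>N\<subseteq>{\<zero>}. finite N \<and> (\<forall>x\<in>{\<zero>}. vnorm E x \<le> R \<longrightarrow> (\<exists>y\<in>N. vnorm E (x \<ominus> y) \<le> e))"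
    by (intro exI[of _ "{\<zero>}"]) (auto simp: M.minus_eq M.r_neg)
qed

lemma linear_subspace_adjoin:
  assumes H: "linear_subspace E H" and b: "b \<in> carrier E"
  shows "linear_subspace E {m \<oplus> c \<odot> b | m c. m \<in> H}"
  unfolding linear_subspace_def
proof (intro conjI ballI allI)
  note D = linear_subspaceD[OF H]
  show "{m \<oplus> c \<odot> b | m c. m \<in> H} \<subseteq> carrier E"
    using D b by (auto simp: sm)
  have "\<zero> = \<zero> \<oplus> 0 \<odot> b" using b by (simp add: sm)
  then show "\<zero> \<in> {m \<oplus> c \<odot> b | m c. m \<in> H}" using D by blast
next
  note D = linear_subspaceD[OF H]
  fix u v assume "u \<in> {m \<oplus> c \<odot> b | m c. m \<in> H}" "v \<in> {m \<oplus> c \<odot> b | m c. m \<in> H}"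
  then obtain m c m' c' where *: "m \<in> H" "m' \<in> H" "u = m \<oplus> c \<odot> b" "v = m' \<oplus> c' \<odot> b" by blast
  then have "u \<oplus> v = (m \<oplus> m') \<oplus> (c + c') \<odot> b"
    using D b by (simp add: sm add_swap)
  with D(3)[OF *(1,2)] show "u \<oplus> v \<in> {m \<oplus> c \<odot> b | m c. m \<in> H}" by blast
next
  note D = linear_subspaceD[OF H]
  fix s u assume "u \<in> {m \<oplus> c \<odot> b | m c. m \<in> H}"
  then obtain m c where *: "m \<in> H" "u = m \<oplus> c \<odot> b" by blast
  then have "s \<odot> u = s \<odot> m \<oplus> (s * c) \<odot> b"
    using D b by (simp add: sm)
  with D(4)[OF *(1)] show "s \<odot> u \<in> {m \<oplus> c \<odot> b | m c. m \<in> H}" by blast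
qed

text \<open>If \<open>b\<close> has distance at least \<open>d\<close> from \<open>H\<close>, then m
  + c b has norm at least |c| d, so the coefficient of \<open>b\<close> is controlled by the vector.
  Bounds for seminorms and finite nets then pass from \<open>H\<close> to the sum. For closedness,
  an approximating sequence has Cauchy coefficients, and their limit l would place a + l b at
  distance zero from \<open>H\<close>.\<close>

lemma finite_dimensional_like_adjoin:
  assumes H: "linear_subspace E H" and fd: "finite_dimensional_like E H"
    and b: "b \<in> carrier E" "b \<notin> H"
  shows "finite_dimensional_like E {m \<oplus> c \<odot> b | m c. m \<in> H}" (is "finite_dimensional_like E ?H'")
proof -
  note D = linear_subspaceD[OF H]
  obtain d where d: "d > 0" "\<And>m. m \<in> H \<Longrightarrow> d \<le> vnorm E (m \<oplus> b)"
    using finite_dimensional_likeD(1)[OF fd b] by blast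
  have coeff: "norm c * d \<le> vnorm E (m \<oplus> c \<odot> b)" if m: "m \<in> H" for m c
  proof (cases "c = 0")
    case True
    then show ?thesis using m D b by (simp add: sm vnorm_nonneg)
  next
    case False
    have "m \<oplus> c \<odot> b = c \<odot> (inverse c \<odot> m \<oplus> b)"
      using False m D b by (simp add: sm)
    then have "vnorm E (m \<oplus> c \<odot> b) = norm c * vnorm E (inverse c \<odot> m \<oplus> b)"
      using vnorm_smult[of "inverse c \<odot> m \<oplus> b" c] D(1)[OF m] b sm(1) by simp
    then show ?thesis
      using d(2)[OF D(4)[OF m]] by (simp add: mult_left_mono)
  qed
  have diff: "(m \<oplus> c \<odot> b) \<ominus> (m' \<oplus> c' \<odot> b) = (m \<ominus> m') \<oplus> (c - c') \<odot> b"
    if "m \<in> carrier E" "m' \<in> carrier E" for m m' c c'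
    using that b sm(4)[of b c "- c'"] by (simp add: minus_eq sm add_swap)
  have H_diff: "m \<ominus> m' \<in> H" if "m \<in> H" "m' \<in> H" for m m'
    using D that by (simp add: minus_eq)
  show ?thesis
    unfolding finite_dimensional_like_def
  proof (intro conjI ballI allI impI)
    fix a assume a: "a \<in> carrier E" "a \<notin> ?H'"
    show "\<exists>d>0. \<forall>m\<in>?H'. d \<le> vnorm E (m \<oplus> a)"
    proof (rule ccontr)
      assume n: "\<not> (\<exists>d>0. \<forall>m\<in>?H'. d \<le> vnorm E (m \<oplus> a))"
      have "\<exists>u\<in>?H'. vnorm E (u \<oplus> a) < 1 / real (Suc k)" for k
      proof (rule ccontr)
        assume "\<not> (\<exists>u\<in>?H'. vnorm E (u \<oplus> a) < 1 / real (Suc k))"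
        then have "\<forall>m\<in>?H'. 1 / real (Suc k) \<le> vnorm E (m \<oplus> a)"
          by (meson not_less)
        moreover have "1 / real (Suc k) > 0" by simp
        ultimately show False using n by blast
      qed
      then have "\<exists>m c. m \<in> H \<and> vnorm E ((m \<oplus> c \<odot> b) \<oplus> a) < 1 / real (Suc k)" for k
        by blast
      then obtain m c where m: "\<And>k. m k \<in> H"
        and mc: "\<And>k. vnorm E ((m k \<oplus> c k \<odot> b) \<oplus> a) < 1 / real (Suc k)"
        by metis
      have mE: "m k \<in> carrier E" for k using m D by blast
      \<comment> \<open>The vector \<open>a\<close> cancels in the difference of two near-solutions,
        so \<open>coeff\<close> applies to that difference.\<close>
      have cc: "norm (c k - c l) * d \<le> 1 / real (Suc k) + 1 / real (Suc l)" for k l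
      proof -
        let ?x = "m k \<oplus> c k \<odot> b" and ?y = "m l \<oplus> c l \<odot> b"
        have c: "?x \<in> carrier E" "?y \<in> carrier E" using mE b by (auto simp: sm)
        have "(?x \<oplus> a) \<ominus> (?y \<oplus> a) = (?x \<ominus> ?y) \<oplus> (a \<ominus> a)"
          using c a(1) by (simp add: minus_eq sm add_swap)
        also have "\<dots> = ?x \<ominus> ?y"
          using c a(1) by (simp add: minus_eq[of a a] add_minus)
        finally have "vnorm E (?x \<ominus> ?y) \<le> vnorm E (?x \<oplus> a) + vnorm E (?y \<oplus> a)"
          using vnorm_dist_triangle[of "?x \<oplus> a" "\<zero>" "?y \<oplus> a"] vnorm_minus_commute[of \<zero> "?y \<oplus> a"] c a(1)
          by (simp add: minus_eq sm)
        moreover have "norm (c k - c l) * d \<le> vnorm E (?x \<ominus> ?y)"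
          using coeff[OF H_diff[OF m m]] by (simp add: diff mE)
        ultimately show ?thesis using mc[of k] mc[of l] by linarith
      qed
      have "Cauchy c"
      proof (rule CauchyI)
        fix e :: real assume "e > 0"
        then have "e * d > 0" using d by simp
        then obtain k0 where "0 < k0" "inverse (real k0) < e * d / 2"
          using ex_inverse_of_nat_less[of "e * d / 2"] by auto
        then have k0: "1 / real (Suc k) < e * d / 2" if "k \<ge> k0" for k
          using that by (smt (verit) inverse_eq_divide frac_le of_nat_0_less_iff of_nat_mono le_SucI)
        have "norm (c k - c l) < e" if "k \<ge> k0" "l \<ge> k0" for k l
          using cc[of k l] k0[OF that(1)] k0[OF that(2)] d(1)
          by (smt (verit) mult_less_cancel_right field_sum_of_halves)
        then show "\<exists>M. \<forall>m\<ge>M. \<forall>n\<ge>M. norm (c m - c n) < e" by blast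
      qed
      then obtain l where l: "c \<longlonglongrightarrow> l" by (rule scalars_complete)
      have "l \<odot> b \<oplus> a \<notin> H"
      proof
        assume h: "l \<odot> b \<oplus> a \<in> H"
        have "a = (l \<odot> b \<oplus> a) \<oplus> (- l) \<odot> b"
          using a b sm(4)[of b l "- l"] by (simp add: sm M.a_ac)
        with h a show False by blast
      qed
      then obtain d' where d': "d' > 0" "\<And>m. m \<in> H \<Longrightarrow> d' \<le> vnorm E (m \<oplus> (l \<odot> b \<oplus> a))"
        using finite_dimensional_likeD(1)[OF fd _ \<open>l \<odot> b \<oplus> a \<notin> H\<close>] a(1) sm(1)[OF b(1)] by auto
      have "d' \<le> 1 / real (Suc k) + norm (l - c k) * vnorm E b" for k
      proof -
        have "m k \<oplus> (l \<odot> b \<oplus> a) = ((m k \<oplus> c k \<odot> b) \<oplus> a) \<oplus> (l - c k) \<odot> b"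
        proof -
          have "l \<odot> b = c k \<odot> b \<oplus> (l - c k) \<odot> b"
            using sm(4)[of b "c k" "l - c k"] b by simp
          then show ?thesis using mE[of k] a b by (simp add: sm M.a_ac)
        qed
        then have "vnorm E (m k \<oplus> (l \<odot> b \<oplus> a)) \<le> vnorm E ((m k \<oplus> c k \<odot> b) \<oplus> a) + norm (l - c k) * vnorm E b"
          using vnorm_triangle[of "(m k \<oplus> c k \<odot> b) \<oplus> a" "(l - c k) \<odot> b"] mE[of k] a b
          by (simp add: sm vnorm_smult)
        with d'(2)[OF m[of k]] mc[of k] show ?thesis by linarith
      qed
      moreover have "(\<lambda>k. 1 / real (Suc k) + norm (l - c k) * vnorm E b) \<longlonglongrightarrow> 0 + norm (l - l) * vnorm E b"
        by (intro tendsto_intros l LIMSEQ_Suc[OF lim_1_over_n])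
      ultimately have "d' \<le> 0"
        by (intro LIMSEQ_le_const[of _ 0 d']) auto
      with d'(1) show False by simp
    qed
  next
    fix p assume p: "seminorm_on E ?H' p"
    have HH': "m \<in> ?H'" if "m \<in> H" for m
    proof -
      have "m = m \<oplus> 0 \<odot> b" using that D b by (simp add: sm)
      with that show ?thesis by blast
    qed
    have bH': "b \<in> ?H'"
    proof -
      have "b = \<zero> \<oplus> 1 \<odot> b" using b by (simp add: sm)
      with D(2) show ?thesis by blast
    qed
    have p_add: "p (u \<oplus> v) \<le> p u + p v" and p_smult: "p (c \<odot> u) = norm c * p u" if "u \<in> ?H'" "v \<in> ?H'" for u v c
      using p that unfolding seminorm_on_def by blast+
    have "seminorm_on E H p"
      unfolding seminorm_on_def by (intro conjI ballI allI p_add p_smult HH')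
    then obtain C where C: "C \<ge> 0" "\<And>x. x \<in> H \<Longrightarrow> p x \<le> C * vnorm E x"
      using finite_dimensional_likeD(2)[OF fd] by blast
    \<comment> \<open>Obtained by inserting |c| <= norm x / d and norm m <= (1 + norm b / d) norm x
      into the estimate p x <= p m + |c| p b.\<close>
    let ?C = "C * (1 + vnorm E b / d) + \<bar>p b\<bar> / d"
    have "p x \<le> ?C * vnorm E x" if x: "x \<in> ?H'" for x
    proof -
      obtain m c where mc: "m \<in> H" "x = m \<oplus> c \<odot> b" using x by blast
      have xE: "x \<in> carrier E" using mc b D by (auto simp: sm)
      have c: "norm c \<le> vnorm E x / d"
        using coeff[OF mc(1), of c] d(1) mc(2) by (simp add: field_simps)
      have "m = x \<oplus> (- c) \<odot> b"
        using mc D b sm(4)[of b c "- c"] by (simp add: sm M.a_assoc)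
      then have "vnorm E m \<le> vnorm E x + norm c * vnorm E b"
        using vnorm_triangle[of x "(- c) \<odot> b"] xE b by (simp add: sm vnorm_smult)
      also have "\<dots> \<le> vnorm E x + vnorm E x / d * vnorm E b"
        using c b(1) by (intro add_mono mult_right_mono vnorm_nonneg) auto
      finally have m: "vnorm E m \<le> vnorm E x + vnorm E x / d * vnorm E b" .
      have "c \<odot> b \<in> ?H'" using linear_subspaceD(4)[OF linear_subspace_adjoin[OF H b(1)] bH'] .
      then have "p x \<le> p m + norm c * p b"
        using p_add[OF HH'[OF mc(1)], of "c \<odot> b"] p_smult[OF bH' bH', of c] mc(2) by simp
      also have "\<dots> \<le> C * vnorm E m + norm c * \<bar>p b\<bar>"
        using C(2)[OF mc(1)] by (intro add_mono mult_left_mono) auto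
      also have "\<dots> \<le> C * (vnorm E x + vnorm E x / d * vnorm E b) + vnorm E x / d * \<bar>p b\<bar>"
        using m c C(1) by (intro add_mono mult_left_mono mult_right_mono) auto
      also have "\<dots> = ?C * vnorm E x"
        by (simp add: algebra_simps)
      finally show ?thesis .
    qed
    moreover have "?C \<ge> 0" using C(1) d(1) b vnorm_nonneg[of b] by simp
    ultimately show "\<exists>C\<ge>0. \<forall>x\<in>?H'. p x \<le> C * vnorm E x" by blast
  next
    fix R e :: real assume e: "e > 0"
    obtain N1 where N1: "N1 \<subseteq> H" "finite N1"
      "\<And>x. x \<in> H \<Longrightarrow> vnorm E x \<le> R + R / d * vnorm E b \<Longrightarrow> \<exists>y\<in>N1. vnorm E (x \<ominus> y) \<le> e / 2"
      using finite_dimensional_likeD(3)[OF fd half_gt_zero[OF e], of "R + R / d * vnorm E b"] by blast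
    \<comment> \<open>The error is split evenly between \<open>m\<close> and the multiple of
      \<open>b\<close>; the summand 1 makes the denominator positive.\<close>
    have pos: "e / (2 * (vnorm E b + 1)) > 0"
      using e vnorm_nonneg[OF b(1)] by simp
    obtain N2 :: "'k set" where N2: "finite N2" "\<And>c. norm c \<le> R / d \<Longrightarrow> \<exists>z\<in>N2. norm (c - z) < e / (2 * (vnorm E b + 1))"
      by (rule scalars_totally_bounded[OF pos, of "R / d"]) auto
    define N where "N = (\<lambda>(m, c). m \<oplus> c \<odot> b) ` (N1 \<times> N2)"
    have "\<exists>y\<in>N. vnorm E (x \<ominus> y) \<le> e" if x: "x \<in> ?H'" "vnorm E x \<le> R" for x
    proof -
      obtain m c where mc: "m \<in> H" "x = m \<oplus> c \<odot> b" using x by blast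
      have xE: "x \<in> carrier E" using mc b D by (auto simp: sm)
      have "norm c * d \<le> R"
        using coeff[OF mc(1), of c] x(2) mc(2) by simp
      then have c: "norm c \<le> R / d" using d(1) by (simp add: field_simps)
      have "m = x \<oplus> (- c) \<odot> b"
        using mc D b sm(4)[of b c "- c"] by (simp add: sm M.a_assoc)
      then have "vnorm E m \<le> vnorm E x + norm c * vnorm E b"
        using vnorm_triangle[of x "(- c) \<odot> b"] xE b by (simp add: sm vnorm_smult)
      also have "\<dots> \<le> R + R / d * vnorm E b"
        using c b x(2) by (intro add_mono mult_right_mono vnorm_nonneg) auto
      finally obtain y where y: "y \<in> N1" "vnorm E (m \<ominus> y) \<le> e / 2" using N1(3)[OF mc(1)] by blast
      obtain z where z: "z \<in> N2" "norm (c - z) < e / (2 * (vnorm E b + 1))" using N2(2)[OF c] by blast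
      have yE: "y \<in> carrier E" "m \<in> carrier E" using y N1 D mc by auto
      have "x \<ominus> (y \<oplus> z \<odot> b) = (m \<ominus> y) \<oplus> (c - z) \<odot> b"
        using diff yE mc by simp
      then have "vnorm E (x \<ominus> (y \<oplus> z \<odot> b)) \<le> vnorm E (m \<ominus> y) + norm (c - z) * vnorm E b"
        using vnorm_triangle[of "m \<ominus> y" "(c - z) \<odot> b"] yE b by (simp add: sm vnorm_smult)
      also have "\<dots> \<le> e / 2 + e / (2 * (vnorm E b + 1)) * (vnorm E b + 1)"
        using y z vnorm_nonneg[OF b(1)] pos by (intro add_mono mult_mono) auto
      also have "\<dots> = e" using vnorm_nonneg[OF b(1)] by (simp add: field_simps)
      finally show ?thesis using y z by (auto simp: N_def)
    qed
    moreover have "N \<subseteq> ?H'" "finite N" using N1 N2 by (auto simp: N_def)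
    ultimately show "\<exists>N\<subseteq>?H'. finite N \<and> (\<forall>x\<in>?H'. vnorm E x \<le> R \<longrightarrow> (\<exists>y\<in>N. vnorm E (x \<ominus> y) \<le> e))"
      by blast
  qed
qed

text \<open>A generator already in the span changes nothing; any other has positive distance from
  the span, which is closed by induction, and can be adjoined.\<close>

lemma finite_dimensional_like_span:
  assumes "finite B" "B \<subseteq> carrier E"
  shows "finite_dimensional_like E (linear_span E B)"
  using assms
proof (induction B)
  case empty
  have "linear_subspace E {\<zero>}" by (auto simp: linear_subspace_def sm)
  then have "linear_span E {} = {\<zero>}"
    using linear_span(3)[OF is_module, of "{}" "{\<zero>}"] linear_subspaceD(2)[OF linear_span(1)[OF is_module, of "{}"]]
    by auto
  then show ?case using finite_dimensional_like_zero by simp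
next
  case (insert b B)
  note S = linear_span[OF is_module, of B] and S' = linear_span[OF is_module, of "insert b B"]
  have fd: "finite_dimensional_like E (linear_span E B)" and B: "B \<subseteq> carrier E" and b: "b \<in> carrier E"
    using insert by auto
  have sub: "linear_span E B \<subseteq> linear_span E (insert b B)"
    using S(3)[OF B S'(1)] S'(2) insert.prems by auto
  show ?case
  proof (cases "b \<in> linear_span E B")
    case True
    then have "linear_span E (insert b B) = linear_span E B"
      using S'(3)[OF _ S(1)] S(2) B insert.prems sub by auto
    with fd show ?thesis by simp
  next
    case False
    note D = linear_subspaceD[OF S(1)[OF B]] and D' = linear_subspaceD[OF S'(1)[OF insert.prems]]
    let ?H = "{m \<oplus> c \<odot> b | m c. m \<in> linear_span E B}"
    have "linear_span E (insert b B) \<subseteq> ?H"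
    proof (rule S'(3)[OF insert.prems linear_subspace_adjoin[OF S(1)[OF B] b]], rule insert_subsetI)
      have "b = \<zero> \<oplus> 1 \<odot> b" using b by (simp add: sm)
      with D(2) show "b \<in> ?H" by blast
      have "m = m \<oplus> 0 \<odot> b" if "m \<in> linear_span E B" for m
        using that D(1) b by (simp add: sm)
      with S(2)[OF B] show "B \<subseteq> ?H" by blast
    qed
    moreover have "?H \<subseteq> linear_span E (insert b B)"
      using sub S'(2)[OF insert.prems] D'(3,4) by blast
    ultimately have "linear_span E (insert b B) = ?H" by (rule antisym)
    with finite_dimensional_like_adjoin[OF S(1)[OF B] fd b False] show ?thesis by simp
  qed
qed

text \<open>For the supremum \<open>s\<close> of \<open>p\<close> on the unit ball, writing y = (y -
  z) + z with z in the net gives s <= 1 + 2 \<delta> + s \<delta>: one \<delta> because z may leave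
  the ball by that much, one from the tolerance \<open>\<eta>\<close>. Solving for \<open>s\<close>
  requires \<open>s\<close> to be finite, which is where boundedness of seminorms enters.
  \<open>N\<close> and \<open>\<eta>\<close> come before \<open>p\<close>, since a retraction is
  chosen to suit them.\<close>

lemma seminorm_le_on_span:
  assumes B: "finite B" "B \<subseteq> carrier E" and \<epsilon>: "\<epsilon> > 0"
  obtains N \<eta> where "finite N" "N \<subseteq> linear_span E B" "\<eta> > 0"
    "\<And>p. seminorm_on E (linear_span E B) p \<Longrightarrow> (\<And>x. x \<in> N \<Longrightarrow> p x \<le> vnorm E x + \<eta>) \<Longrightarrow>
       (\<forall>x\<in>linear_span E B. p x \<le> (1 + \<epsilon>) * vnorm E x)"
proof -
  let ?H = "linear_span E B"
  note D = linear_subspaceD[OF linear_span(1)[OF is_module B(2)]]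
  have fd: "finite_dimensional_like E ?H" using finite_dimensional_like_span[OF B] .
  \<comment> \<open>The solution of 1 + 2 \<delta> = (1 + \<epsilon>) (1 - \<delta>).\<close>
  define \<delta> where "\<delta> = \<epsilon> / (3 + \<epsilon>)"
  have \<delta>: "\<delta> > 0" "\<delta> < 1" "1 + 2 * \<delta> = (1 + \<epsilon>) * (1 - \<delta>)"
    using \<epsilon> by (auto simp: \<delta>_def field_simps)
  obtain N where N: "N \<subseteq> ?H" "finite N" "\<And>x. x \<in> ?H \<Longrightarrow> vnorm E x \<le> 1 \<Longrightarrow> \<exists>y\<in>N. vnorm E (x \<ominus> y) \<le> \<delta>"
    using finite_dimensional_likeD(3)[OF fd \<delta>(1), of 1] by blast
  show thesis
  proof (rule that[OF N(2,1) \<delta>(1)], intro ballI)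
    fix p x assume p: "seminorm_on E ?H p" and pN: "\<And>x. x \<in> N \<Longrightarrow> p x \<le> vnorm E x + \<delta>" and x: "x \<in> ?H"
    have p_add: "p (u \<oplus> v) \<le> p u + p v" and p_smult: "p (c \<odot> u) = norm c * p u" if "u \<in> ?H" "v \<in> ?H" for u v c
      using p that unfolding seminorm_on_def by blast+
    obtain C where C: "C \<ge> 0" "\<And>x. x \<in> ?H \<Longrightarrow> p x \<le> C * vnorm E x"
      using finite_dimensional_likeD(2)[OF fd p] by blast
    define S where "S = p ` {x \<in> ?H. vnorm E x \<le> 1}"
    define s where "s = Sup S"
    have ne: "S \<noteq> {}" using D(2) by (auto simp: S_def intro!: exI[of _ \<zero>])
    have "bdd_above S"
    proof (rule bdd_aboveI)
      fix t assume "t \<in> S"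
      then obtain y where "y \<in> ?H" "vnorm E y \<le> 1" "t = p y" by (auto simp: S_def)
      then show "t \<le> C" using C(2)[of y] mult_left_mono[OF _ C(1), of "vnorm E y" 1] by simp
    qed
    then have up: "p y \<le> s" if "y \<in> ?H" "vnorm E y \<le> 1" for y
      unfolding s_def by (rule cSup_upper[rotated]) (use that in \<open>auto simp: S_def\<close>)
    have scaled: "p y \<le> s * r" if y: "y \<in> ?H" "vnorm E y \<le> r" and r: "r > 0" for y r
    proof -
      have "p (of_real (inverse r) \<odot> y) \<le> s"
        using y r D(1)[OF y(1)] by (intro up D(4)) (auto simp: vnorm_smult norm_inverse norm_divide field_simps)
      then have "inverse r * p y \<le> s"
        using p_smult[OF y(1) y(1), of "of_real (inverse r)"] r by (simp add: norm_inverse del: of_real_inverse)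
      then show ?thesis
        using r by (simp add: field_simps)
    qed
    have "Sup S \<le> 1 + 2 * \<delta> + s * \<delta>"
    proof (rule cSup_least[OF ne])
      fix t assume "t \<in> S"
      then obtain y where y: "y \<in> ?H" "vnorm E y \<le> 1" "t = p y" by (auto simp: S_def)
      obtain z where z: "z \<in> N" "vnorm E (y \<ominus> z) \<le> \<delta>" using N(3)[OF y(1,2)] by blast
      have zH: "z \<in> ?H" using z N by blast
      have yz: "y \<ominus> z \<in> ?H" using y zH D by (simp add: minus_eq)
      have "y = (y \<ominus> z) \<oplus> z"
        using D(1)[OF y(1)] D(1)[OF zH] by (simp add: minus_eq sm M.a_assoc add_minus)
      then have "p y \<le> p (y \<ominus> z) + p z" using p_add[OF yz zH] by simp
      moreover have "p (y \<ominus> z) \<le> s * \<delta>" using scaled[OF yz z(2) \<delta>(1)] .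
      moreover have "vnorm E z \<le> 1 + \<delta>"
        using vnorm_diff[of z y] vnorm_minus_commute[of z y] D(1) zH y z by fastforce
      ultimately show "t \<le> 1 + 2 * \<delta> + s * \<delta>" using pN[OF z(1)] y(3) by linarith
    qed
    then have "s \<le> 1 + 2 * \<delta> + s * \<delta>" by (simp only: s_def)
    then have "s * (1 - \<delta>) \<le> (1 + \<epsilon>) * (1 - \<delta>)" using \<delta>(3) by (simp add: algebra_simps)
    then have s: "s \<le> 1 + \<epsilon>" using \<delta>(2) by simp
    show "p x \<le> (1 + \<epsilon>) * vnorm E x"
    proof (cases "vnorm E x = 0")
      case True
      then show ?thesis using C(2)[OF x] by simp
    next
      case False
      then have pos: "vnorm E x > 0" using vnorm_nonneg[OF D(1)[OF x]] by simp
      show ?thesis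
        using scaled[OF x order.refl pos] mult_right_mono[OF s, of "vnorm E x"] pos by linarith
    qed
  qed
qed

end

section \<open>Locally retractable isometries\<close>

text \<open>\<open>opnorm\<close> is a supremum of reals, so even its nonnegativity rests on
  boundedness: only then is it at least the value at zero.\<close>

lemma opnorm_le:
  assumes E: "normed_space E" and F: "normed_space F" and T: "linear_map T E F"
    and C: "0 \<le> C" "\<And>x. x \<in> carrier E \<Longrightarrow> vnorm F (T x) \<le> C * vnorm E x"
  shows "0 \<le> opnorm E F T" "opnorm E F T \<le> C"
proof -
  interpret E: normed_space E by fact
  interpret F: normed_space F by fact
  let ?S = "(\<lambda>x. vnorm F (T x)) ` {x \<in> carrier E. vnorm E x \<le> 1}"
  have le: "vnorm F (T x) \<le> C" if "x \<in> carrier E" "vnorm E x \<le> 1" for x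
    using C(2)[OF that(1)] mult_left_mono[OF that(2) C(1)] by simp
  have z: "\<zero>\<^bsub>E\<^esub> \<in> {x \<in> carrier E. vnorm E x \<le> 1}" by simp
  have "bdd_above ?S"
    using le by (intro bdd_aboveI[of _ C]) auto
  then have "vnorm F (T \<zero>\<^bsub>E\<^esub>) \<le> opnorm E F T"
    unfolding opnorm_def using z by (rule cSUP_upper[rotated])
  then show "0 \<le> opnorm E F T"
    using F.vnorm_nonneg[OF linear_mapD(1)[OF T E.M.zero_closed]] by linarith
  show "opnorm E F T \<le> C"
    unfolding opnorm_def using z le by (intro cSUP_least) auto
qed

section \<open>Functoriality of the symmetric tensor product\<close>

text \<open>Forms are pulled back first along \<open>S\<close> and then along \<open>T\<close>.
  Linearity of \<open>S\<close> ensures that the first pullback is again an n-linear form, so that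
  the inner map is evaluated there and does not return its default value 0.\<close>

lemma sym_tensor_map_comp:
  fixes E :: "('k::real_or_complex, 'a) nspace" and F :: "('k, 'b) nspace" and G :: "('k, 'c) nspace"
  assumes S: "linear_map S F G" and F: "normed_space F" and T: "T \<in> carrier E \<rightarrow> carrier F"
  shows "sym_tensor_map n S F G (sym_tensor_map n T E F w) = sym_tensor_map n (\<lambda>x. S (T x)) E G w"
proof (rule ext)
  fix \<psi> :: "(nat \<Rightarrow> 'c) \<Rightarrow> 'k"
  have "(\<lambda>x\<in>tuples n E. (\<lambda>y\<in>tuples n F. \<psi> (\<lambda>i\<in>{..<n}. S (y i))) (\<lambda>i\<in>{..<n}. T (x i))) =
      (\<lambda>x\<in>tuples n E. \<psi> (\<lambda>i\<in>{..<n}. S (T (x i))))"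
  proof (rule restrict_ext)
    fix x assume "x \<in> tuples n E"
    then have "(\<lambda>i\<in>{..<n}. T (x i)) \<in> tuples n F"
      using T by (auto simp: tuples_def)
    moreover have "(\<lambda>i\<in>{..<n}. S ((\<lambda>i\<in>{..<n}. T (x i)) i)) = (\<lambda>i\<in>{..<n}. S (T (x i)))"
      by (auto simp: fun_eq_iff)
    ultimately show "(\<lambda>y\<in>tuples n F. \<psi> (\<lambda>i\<in>{..<n}. S (y i))) (\<lambda>i\<in>{..<n}. T (x i)) =
        \<psi> (\<lambda>i\<in>{..<n}. S (T (x i)))" by simp
  qed
  then show "sym_tensor_map n S F G (sym_tensor_map n T E F w) \<psi> = sym_tensor_map n (\<lambda>x. S (T x)) E G w \<psi>"
    using multilinear_forms_compose[OF S F, of \<psi> n] by (simp add: sym_tensor_map_def)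
qed

lemma sym_tensor_map_cong:
  fixes E :: "('k::real_or_complex, 'a) nspace" and F :: "('k, 'b) nspace"
  assumes "\<And>x. x \<in> carrier E \<Longrightarrow> T x = T' x"
  shows "sym_tensor_map n T E F = sym_tensor_map n T' E F"
proof -
  have "(\<lambda>x\<in>tuples n E. \<psi> (\<lambda>i\<in>{..<n}. T (x i))) = (\<lambda>x\<in>tuples n E. \<psi> (\<lambda>i\<in>{..<n}. T' (x i)))"
    for \<psi> :: "(nat \<Rightarrow> 'b) \<Rightarrow> 'k"
  proof (rule restrict_ext)
    fix x assume "x \<in> tuples n E"
    then have "(\<lambda>i\<in>{..<n}. T (x i)) = (\<lambda>i\<in>{..<n}. T' (x i))"
      using assms by (intro restrict_ext) (auto simp: tuples_def)
    then show "\<psi> (\<lambda>i\<in>{..<n}. T (x i)) = \<psi> (\<lambda>i\<in>{..<n}. T' (x i))" by simp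
  qed
  then have "sym_tensor_map n T E F w = sym_tensor_map n T' E F w" for w
    unfolding sym_tensor_map_def by presburger
  then show ?thesis by blast
qed

text \<open>Outside the multilinear forms \<open>sym_tensor_map\<close> returns 0, so
  \<open>w\<close> has to vanish there as well. Tensor powers do, and the property is inherited by
  their span.\<close>

lemma sym_tensor_map_id:
  assumes w: "w \<in> sym_tensors n E" and T: "\<And>x. x \<in> carrier E \<Longrightarrow> T x = x"
  shows "sym_tensor_map n T E E w = w"
proof -
  have "tensor_power n E ` carrier E \<subseteq> {w. \<forall>\<psi>. \<psi> \<notin> multilinear_forms n E \<longrightarrow> w \<psi> = 0}"
    by (auto simp: tensor_power_def)
  moreover have "submodule {w. \<forall>\<psi>. \<psi> \<notin> multilinear_forms n E \<longrightarrow> w \<psi> = 0} scalar_space function_module"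
    by (rule submodule_function_moduleI) auto
  ultimately have "sym_tensors n E \<subseteq> {w. \<forall>\<psi>. \<psi> \<notin> multilinear_forms n E \<longrightarrow> w \<psi> = 0}"
    unfolding sym_tensors_def linear_span_def by (rule hull_minimal)
  with w have 0: "w \<psi> = 0" if "\<psi> \<notin> multilinear_forms n E" for \<psi> using that by blast
  have eq: "(\<lambda>x\<in>tuples n E. \<psi> (\<lambda>i\<in>{..<n}. x i)) = \<psi>" if "\<psi> \<in> multilinear_forms n E" for \<psi>
  proof (rule extensionalityI[of _ "tuples n E"])
    show "\<psi> \<in> extensional (tuples n E)" using that by (simp add: multilinear_forms_def)
    fix x assume x: "x \<in> tuples n E"
    then have "(\<lambda>i\<in>{..<n}. x i) = x" by (auto simp: tuples_def PiE_def extensional_def fun_eq_iff)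
    with x show "(\<lambda>x\<in>tuples n E. \<psi> (\<lambda>i\<in>{..<n}. x i)) x = \<psi> x" by simp
  qed simp
  have "sym_tensor_map n (\<lambda>x. x) E E w = w"
    by (rule ext) (simp add: sym_tensor_map_def eq 0)
  then show ?thesis
    using sym_tensor_map_cong[of E T "\<lambda>x. x" n E, OF T] by simp
qed

lemma sym_tensor_space_simps [simp]:
  "carrier (sym_tensor_space n N E) = sym_tensors n E" "vnorm (sym_tensor_space n N E) = N"
  by (simp_all add: sym_tensor_space_def module.extend_def)

lemma sym_tensor_map_closed:
  assumes "linear_map T E F" "normed_space E" "w \<in> sym_tensors n E"
  shows "sym_tensor_map n T E F w \<in> sym_tensors n F"
  using linear_mapD(1)[OF sym_tensor_map_linear[OF assms(1,2), of n undefined undefined], of w] assms(3) by simp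

lemma linear_map_inclusion:
  assumes "H \<subseteq> H'"
  shows "linear_map (\<lambda>x. x) (E\<lparr>carrier := H\<rparr>) (E\<lparr>carrier := H'\<rparr>)"
  using assms by (auto simp: linear_map_def)

text \<open>Guarantees that the infimum in \<open>finitely_generated\<close> is taken over a
  nonempty set. Tensors with such a witness form a submodule, because two witnesses can be moved
  into the span of the union of their generating sets.\<close>

lemma sym_tensors_finite_dimensional:
  assumes F: "normed_space F" and z: "z \<in> sym_tensors n F"
  shows "\<exists>B v. finite B \<and> B \<subseteq> carrier F \<and> v \<in> sym_tensors n (F\<lparr>carrier := linear_span F B\<rparr>) \<and>
    sym_tensor_map n (\<lambda>x. x) (F\<lparr>carrier := linear_span F B\<rparr>) F v = z"
proof -
  interpret F: normed_space F by fact
  let ?M = "\<lambda>B. F\<lparr>carrier := linear_span F B\<rparr>"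
  note S = linear_span[OF F.is_module]
  have sub: "linear_span F B \<subseteq> carrier F" if "B \<subseteq> carrier F" for B
    using S(1)[OF that] by (simp add: linear_subspace_def)
  have M: "normed_space (?M B)" if "B \<subseteq> carrier F" for B
    using normed_space_subspace[OF F S(1)[OF that]] .
  have incl: "linear_map (\<lambda>x. x) (?M B) F" if "B \<subseteq> carrier F" for B
    using linear_map_inclusion[OF sub[OF that], of F] by simp
  define Z where "Z = {z. \<exists>B v. finite B \<and> B \<subseteq> carrier F \<and> v \<in> sym_tensors n (?M B) \<and>
    sym_tensor_map n (\<lambda>x. x) (?M B) F v = z}"
  have enlarge: "\<exists>v'\<in>sym_tensors n (?M (B \<union> B')). sym_tensor_map n (\<lambda>x. x) (?M (B \<union> B')) F v' =
      sym_tensor_map n (\<lambda>x. x) (?M B) F v"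
    if "B \<subseteq> carrier F" "B' \<subseteq> carrier F" "v \<in> sym_tensors n (?M B)" for B B' v
  proof -
    have "linear_span F B \<subseteq> linear_span F (B \<union> B')"
      using S(3)[OF that(1) S(1)] S(2)[of "B \<union> B'"] that by auto
    then have l: "linear_map (\<lambda>x. x) (?M B) (?M (B \<union> B'))" by (rule linear_map_inclusion)
    have c: "B \<union> B' \<subseteq> carrier F" using that by auto
    show ?thesis
    proof (rule bexI)
      show "sym_tensor_map n (\<lambda>x. x) (?M B) (?M (B \<union> B')) v \<in> sym_tensors n (?M (B \<union> B'))"
        using sym_tensor_map_closed[OF l M[OF that(1)] that(3)] .
      show "sym_tensor_map n (\<lambda>x. x) (?M (B \<union> B')) F (sym_tensor_map n (\<lambda>x. x) (?M B) (?M (B \<union> B')) v) =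
          sym_tensor_map n (\<lambda>x. x) (?M B) F v"
        using linear_mapD(1)[OF l] by (intro sym_tensor_map_comp[OF incl[OF c] M[OF c]]) auto
    qed
  qed
  note sub_t = submodule_function_moduleD[OF submodule_sym_tensors]
  have "submodule Z scalar_space function_module"
  proof (rule submodule_function_moduleI)
    show "(\<lambda>_. 0) \<in> Z"
      unfolding Z_def using sub_t(1)[of n "?M {}"]
      by (auto intro!: exI[of _ "{}"] exI[of _ "\<lambda>_. 0"] simp: sym_tensor_map_def)
  next
    fix v w assume "v \<in> Z" "w \<in> Z"
    then obtain B1 v1 B2 v2 where 1: "finite B1" "B1 \<subseteq> carrier F" "v1 \<in> sym_tensors n (?M B1)"
        "sym_tensor_map n (\<lambda>x. x) (?M B1) F v1 = v"
      and 2: "finite B2" "B2 \<subseteq> carrier F" "v2 \<in> sym_tensors n (?M B2)"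
        "sym_tensor_map n (\<lambda>x. x) (?M B2) F v2 = w"
      unfolding Z_def by blast
    let ?B = "B1 \<union> B2"
    obtain v1' where v1': "v1' \<in> sym_tensors n (?M ?B)" "sym_tensor_map n (\<lambda>x. x) (?M ?B) F v1' = v"
      using enlarge[OF 1(2) 2(2) 1(3)] 1(4) by metis
    obtain v2' where v2': "v2' \<in> sym_tensors n (?M ?B)" "sym_tensor_map n (\<lambda>x. x) (?M ?B) F v2' = w"
      using enlarge[OF 2(2) 1(2) 2(3)] 2(4) by (metis Un_commute)
    have "sym_tensor_map n (\<lambda>x. x) (?M ?B) F (\<lambda>p. v1' p + v2' p) = (\<lambda>p. v p + w p)"
      unfolding v1'(2)[symmetric] v2'(2)[symmetric] by (auto simp: sym_tensor_map_def)
    then show "(\<lambda>p. v p + w p) \<in> Z"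
      using 1 2 sub_t(2)[OF v1'(1) v2'(1)] unfolding Z_def
      by (intro CollectI exI[of _ ?B] exI[of _ "\<lambda>p. v1' p + v2' p"]) simp
  next
    fix c w assume "w \<in> Z"
    then obtain B v where B: "finite B" "B \<subseteq> carrier F" "v \<in> sym_tensors n (?M B)"
        "sym_tensor_map n (\<lambda>x. x) (?M B) F v = w"
      unfolding Z_def by blast
    have "sym_tensor_map n (\<lambda>x. x) (?M B) F (\<lambda>p. c * v p) = (\<lambda>p. c * w p)"
      unfolding B(4)[symmetric] by (auto simp: sym_tensor_map_def)
    then show "(\<lambda>p. c * w p) \<in> Z"
      using B sub_t(3)[OF B(3)] unfolding Z_def
      by (intro CollectI exI[of _ B] exI[of _ "\<lambda>p. c * v p"]) simp
  qed
  moreover have "tensor_power n F ` carrier F \<subseteq> Z"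
  proof clarify
    fix x assume x: "x \<in> carrier F"
    then have c: "{x} \<subseteq> carrier F" by simp
    have xM: "x \<in> carrier (?M {x})" using S(2)[OF c] by simp
    have "tensor_power n (?M {x}) x \<in> sym_tensors n (?M {x})"
      using xM by (auto simp: sym_tensors_def linear_span_def hull_def)
    then show "tensor_power n F x \<in> Z"
      using c sym_tensor_map_power[OF incl[OF c] M[OF c] xM] unfolding Z_def
      by (intro CollectI exI[of _ "{x}"] exI[of _ "tensor_power n (?M {x}) x"]) auto
  qed
  ultimately have "sym_tensors n F \<subseteq> Z"
    unfolding sym_tensors_def linear_span_def by (intro hull_minimal)
  with z show ?thesis unfolding Z_def by blast
qed

lemma isometry_bounded: "isometry T E F \<Longrightarrow> bounded_linear_map T E F"
  unfolding isometry_def bounded_linear_map_def by (auto intro: exI[of _ 1])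

text \<open>The form of local reflexivity that both embeddings satisfy. The retractions are defined on
  all of \<open>F\<close>, without being bounded; therefore no injectivity of the maps
  \<open>\<otimes>\<^sup>n\<^sup>,\<^sup>sM \<rightarrow> \<otimes>\<^sup>n\<^sup>,\<^sup>sF\<close> is needed below.\<close>

definition locally_retractable ::
    "('a \<Rightarrow> 'b) \<Rightarrow> ('k::real_or_complex, 'a) nspace \<Rightarrow> ('k, 'b) nspace \<Rightarrow> bool" where
  "locally_retractable T E F \<longleftrightarrow> (\<forall>N \<eta>. finite N \<and> N \<subseteq> carrier F \<and> \<eta> > 0 \<longrightarrow>
     (\<exists>S. linear_map S F E \<and> (\<forall>x\<in>carrier E. S (T x) = x) \<and> (\<forall>x\<in>N. vnorm E (S x) \<le> vnorm F x + \<eta>)))"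

text \<open>One inequality is the metric mapping property of \<open>T\<close> itself. The other
  evaluates the norm over \<open>F\<close> as an infimum, which \<open>finitely_generated\<close>
  provides for Banach spaces; hence the completeness of \<open>F\<close>.\<close>

theorem s_tensor_norm_locally_retractable:
  fixes \<alpha> :: "('k::real_or_complex, 'u) nspace \<Rightarrow> ('k, 'u) tensor \<Rightarrow> real"
  assumes E: "normed_space E" and F: "banach_space F" and T: "isometry T E F"
    and retr: "locally_retractable T E F"
    and \<alpha>: "s_tensor_norm n \<alpha>" and fg: "finitely_generated n \<alpha>" and w: "w \<in> sym_tensors n E"
  shows "\<alpha> F (sym_tensor_map n T E F w) = \<alpha> E w"
proof (rule antisym)
  interpret E: normed_space E by fact
  interpret F: banach_space F by fact
  have nF: "normed_space F" ..
  have T': "linear_map T E F" using T by (simp add: isometry_def)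
  have mmp: "\<alpha> F (sym_tensor_map n T E F w) \<le> opnorm E F T ^ n * \<alpha> E w"
    if "normed_space E" "normed_space F" "bounded_linear_map T E F" "w \<in> sym_tensors n E" for E F T w
    using \<alpha> that unfolding s_tensor_norm_def by blast
  have nonneg: "0 \<le> \<alpha> M v" if M: "normed_space M" and v: "v \<in> sym_tensors n M" for M v
  proof -
    interpret N: normed_space "sym_tensor_space n (\<alpha> M) M"
      using \<alpha> M unfolding s_tensor_norm_def by blast
    show ?thesis using N.vnorm_nonneg[of v] v by simp
  qed
  have "opnorm E F T ^ n \<le> 1"
    using opnorm_le[OF E nF T', of 1] T by (intro power_le_one) (auto simp: isometry_def)
  then have "opnorm E F T ^ n * \<alpha> E w \<le> 1 * \<alpha> E w"
    using nonneg[OF E w] by (rule mult_right_mono)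
  with mmp[OF E nF isometry_bounded[OF T] w] show "\<alpha> F (sym_tensor_map n T E F w) \<le> \<alpha> E w"
    by simp
  let ?z = "sym_tensor_map n T E F w"
  let ?A = "{\<alpha> M v | M v. M \<in> FIN F \<and> v \<in> sym_tensors n M \<and> sym_tensor_map n (\<lambda>x. x) M F v = ?z}"
  have z: "?z \<in> sym_tensors n F"
    using sym_tensor_map_closed[OF T' E w] .
  have bound: "\<alpha> E w \<le> \<alpha> M v" if M: "M \<in> FIN F" and v: "v \<in> sym_tensors n M"
    and eq: "sym_tensor_map n (\<lambda>x. x) M F v = ?z" for M v
  proof -
    obtain B where B: "finite B" "B \<subseteq> carrier F" "M = F\<lparr>carrier := linear_span F B\<rparr>"
      using M by (auto simp: FIN_def)
    have sub: "linear_subspace F (linear_span F B)" using linear_span(1)[OF F.is_module B(2)] .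
    have subc: "linear_span F B \<subseteq> carrier F" using sub by (simp add: linear_subspace_def)
    have nM: "normed_space M" unfolding B(3) by (rule normed_space_subspace[OF nF sub])
    have approx: "\<alpha> E w \<le> (1 + \<epsilon>) ^ n * \<alpha> M v" if \<epsilon>: "\<epsilon> > 0" for \<epsilon>
    proof -
      obtain N \<eta> where N: "finite N" "N \<subseteq> linear_span F B" "\<eta> > 0"
        "\<And>p. seminorm_on F (linear_span F B) p \<Longrightarrow> (\<And>x. x \<in> N \<Longrightarrow> p x \<le> vnorm F x + \<eta>) \<Longrightarrow>
          (\<forall>x\<in>linear_span F B. p x \<le> (1 + \<epsilon>) * vnorm F x)"
        using F.seminorm_le_on_span[OF B(1,2) \<epsilon>] by metis
      obtain S where S: "linear_map S F E" "\<And>x. x \<in> carrier E \<Longrightarrow> S (T x) = x"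
        "\<And>x. x \<in> N \<Longrightarrow> vnorm E (S x) \<le> vnorm F x + \<eta>"
        using retr[unfolded locally_retractable_def, rule_format, of N \<eta>] N(1-3) subc by blast
      have "seminorm_on F (linear_span F B) (\<lambda>x. vnorm E (S x))"
        using subc linear_mapD[OF S(1)] by (auto simp: seminorm_on_def E.vnorm_smult E.vnorm_triangle subset_iff)
      from N(4)[OF this S(3)] have S_le: "vnorm E (S x) \<le> (1 + \<epsilon>) * vnorm F x" if "x \<in> linear_span F B" for x
        using that by blast
      have SM: "linear_map S M E"
        using linear_mapD[OF S(1) subsetD[OF subc]] linear_mapD(2)[OF S(1)] subc
        by (auto simp: B(3) linear_map_def subset_iff)
      have bd: "bounded_linear_map S M E"
        using SM S_le by (auto simp: bounded_linear_map_def B(3))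
      have op: "0 \<le> opnorm M E S" "opnorm M E S \<le> 1 + \<epsilon>"
        using opnorm_le[OF nM E SM, of "1 + \<epsilon>"] S_le \<epsilon> by (auto simp: B(3))
      have "sym_tensor_map n S M E v = sym_tensor_map n S F E (sym_tensor_map n (\<lambda>x. x) M F v)"
        using subc by (subst sym_tensor_map_comp[OF S(1) nF]) (auto simp: B(3))
      also have "\<dots> = sym_tensor_map n (\<lambda>x. S (T x)) E E w"
        unfolding eq using linear_mapD(1)[OF T'] by (intro sym_tensor_map_comp[OF S(1) nF]) auto
      also have "\<dots> = w"
        using sym_tensor_map_id[OF w S(2)] .
      finally have "\<alpha> E w \<le> opnorm M E S ^ n * \<alpha> M v"
        using mmp[OF nM E bd v] by simp
      also have "\<dots> \<le> (1 + \<epsilon>) ^ n * \<alpha> M v"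
        using op nonneg[OF nM v] by (intro mult_right_mono power_mono)
      finally show ?thesis .
    qed
    have "((\<lambda>\<epsilon>. (1 + \<epsilon>) ^ n * \<alpha> M v) \<longlongrightarrow> (1 + 0) ^ n * \<alpha> M v) (at_right 0)"
      by (intro tendsto_intros)
    moreover have "eventually (\<lambda>\<epsilon>. \<alpha> E w \<le> (1 + \<epsilon>) ^ n * \<alpha> M v) (at_right 0)"
      using eventually_at_right_less[of 0] by eventually_elim (rule approx)
    ultimately show ?thesis
      using tendsto_lowerbound[of "\<lambda>\<epsilon>. (1 + \<epsilon>) ^ n * \<alpha> M v" "(1 + 0) ^ n * \<alpha> M v" "at_right 0" "\<alpha> E w"] by simp
  qed
  obtain B v where B: "finite B" "B \<subseteq> carrier F" "v \<in> sym_tensors n (F\<lparr>carrier := linear_span F B\<rparr>)"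
    "sym_tensor_map n (\<lambda>x. x) (F\<lparr>carrier := linear_span F B\<rparr>) F v = ?z"
    using sym_tensors_finite_dimensional[OF nF z] by blast
  then have "F\<lparr>carrier := linear_span F B\<rparr> \<in> FIN F" by (auto simp: FIN_def)
  with B have "?A \<noteq> {}" by blast
  then have "\<alpha> E w \<le> Inf ?A"
    by (rule cInf_greatest) (use bound in auto)
  also have "\<dots> = \<alpha> F ?z"
    using fg F z unfolding finitely_generated_def by simp
  finally show "\<alpha> E w \<le> \<alpha> F ?z" .
qed

section \<open>Transport along isometric isomorphisms\<close>

lemma isometric_isomorphism_inverse:
  assumes X: "normed_space X" and F: "normed_space F" and J: "isometric_isomorphism J X F"
  obtains r where "linear_map r F X" "\<And>x. x \<in> carrier X \<Longrightarrow> r (J x) = x"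
    "\<And>v. v \<in> carrier F \<Longrightarrow> J (r v) = v" "\<And>v. v \<in> carrier F \<Longrightarrow> vnorm X (r v) = vnorm F v"
proof -
  interpret X: normed_space X by fact
  interpret F: normed_space F by fact
  have Jl: "linear_map J X F" and Jn: "\<And>x. x \<in> carrier X \<Longrightarrow> vnorm F (J x) = vnorm X x"
    and Js: "J ` carrier X = carrier F"
    using J by (auto simp: isometric_isomorphism_def isometry_def)
  have inj: "inj_on J (carrier X)"
  proof (rule inj_onI)
    fix x y assume xy: "x \<in> carrier X" "y \<in> carrier X" "J x = J y"
    have "J (x \<ominus>\<^bsub>X\<^esub> y) = J x \<oplus>\<^bsub>F\<^esub> (- 1) \<odot>\<^bsub>F\<^esub> J y"
      using xy linear_mapD[OF Jl] X.sm(1) by (simp add: X.minus_eq)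
    also have "\<dots> = \<zero>\<^bsub>F\<^esub>" using xy linear_mapD(1)[OF Jl] by (simp add: F.add_minus)
    finally show "x = y"
      using Jn[of "x \<ominus>\<^bsub>X\<^esub> y"] xy by (intro X.vnorm_minus_eq_0) auto
  qed
  define r where "r = inv_into (carrier X) J"
  have r1: "r (J x) = x" if "x \<in> carrier X" for x
    using inj that by (simp add: r_def)
  have r2: "r v \<in> carrier X" "J (r v) = v" if "v \<in> carrier F" for v
    using that Js by (auto simp: r_def inv_into_into f_inv_into_f)
  have "linear_map r F X"
    unfolding linear_map_def
  proof (intro conjI ballI allI funcsetI)
    show "r v \<in> carrier X" if "v \<in> carrier F" for v using r2 that by blast
    show "r (u \<oplus>\<^bsub>F\<^esub> v) = r u \<oplus>\<^bsub>X\<^esub> r v" if "u \<in> carrier F" "v \<in> carrier F" for u v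
      using r1[of "r u \<oplus>\<^bsub>X\<^esub> r v"] linear_mapD(2)[OF Jl] r2 that by simp
    show "r (c \<odot>\<^bsub>F\<^esub> v) = c \<odot>\<^bsub>X\<^esub> r v" if "v \<in> carrier F" for c v
      using r1[of "c \<odot>\<^bsub>X\<^esub> r v"] linear_mapD(3)[OF Jl] r2 that X.sm(1) by simp
  qed
  then show thesis
    by (rule that) (use r1 r2 Jn in \<open>auto, metis\<close>)
qed

lemma banach_space_isometric_isomorphism:
  assumes X: "banach_space X" and F: "normed_space F" and J: "isometric_isomorphism J X F"
  shows "banach_space F"
proof -
  interpret X: banach_space X by fact
  interpret F: normed_space F by fact
  have nX: "normed_space X" ..
  obtain r where r: "linear_map r F X" "\<And>x. x \<in> carrier X \<Longrightarrow> r (J x) = x"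
    "\<And>v. v \<in> carrier F \<Longrightarrow> J (r v) = v" "\<And>v. v \<in> carrier F \<Longrightarrow> vnorm X (r v) = vnorm F v"
    by (rule isometric_isomorphism_inverse[OF nX F J]) auto
  have dist: "vnorm X (r u \<ominus>\<^bsub>X\<^esub> r v) = vnorm F (u \<ominus>\<^bsub>F\<^esub> v)" if "u \<in> carrier F" "v \<in> carrier F" for u v
  proof -
    have "r u \<ominus>\<^bsub>X\<^esub> r v = r (u \<ominus>\<^bsub>F\<^esub> v)"
      using that linear_mapD[OF r(1)] F.sm(1) by (simp add: X.minus_eq F.minus_eq)
    then show ?thesis using r(4) that by simp
  qed
  show ?thesis
  proof
    fix Y :: "nat \<Rightarrow> _" assume Y: "\<forall>m. Y m \<in> carrier F" "\<forall>e>0. \<exists>N. \<forall>m\<ge>N. \<forall>k\<ge>N. vnorm F (Y m \<ominus>\<^bsub>F\<^esub> Y k) < e"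
    then have "\<exists>x\<in>carrier X. (\<lambda>m. vnorm X (r (Y m) \<ominus>\<^bsub>X\<^esub> x)) \<longlonglongrightarrow> 0"
      using linear_mapD(1)[OF r(1)] by (intro X.complete) (auto simp: dist)
    then obtain x where x: "x \<in> carrier X" "(\<lambda>m. vnorm X (r (Y m) \<ominus>\<^bsub>X\<^esub> x)) \<longlonglongrightarrow> 0" by blast
    have Jx: "J x \<in> carrier F" using J x(1) by (auto simp: isometric_isomorphism_def)
    have "vnorm X (r (Y m) \<ominus>\<^bsub>X\<^esub> x) = vnorm F (Y m \<ominus>\<^bsub>F\<^esub> J x)" for m
      using dist[of "Y m" "J x"] Y(1) Jx r(2)[OF x(1)] by simp
    with x(2) Jx show "\<exists>x\<in>carrier F. (\<lambda>m. vnorm F (Y m \<ominus>\<^bsub>F\<^esub> x)) \<longlonglongrightarrow> 0" by auto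
  qed
qed

lemma isometry_sym_tensor_map_via:
  fixes \<alpha> :: "('k::real_or_complex, 'u) nspace \<Rightarrow> ('k, 'u) tensor \<Rightarrow> real"
  assumes E: "normed_space E" and X: "banach_space X" and h: "isometry h E X"
    and retr: "locally_retractable h E X"
    and \<alpha>: "s_tensor_norm n \<alpha>" "finitely_generated n \<alpha>"
    and F: "normed_space F" and J: "isometric_isomorphism J X F"
  shows "isometry (sym_tensor_map n h E X) (sym_tensor_space n (\<alpha> E) E)
    (sym_tensor_space n (norm_via n \<alpha> X J F) X)"
proof -
  have nX: "normed_space X" using X by (simp add: banach_space_def)
  have h': "linear_map h E X" using h by (simp add: isometry_def)
  have J': "linear_map J X F" using J by (simp add: isometric_isomorphism_def isometry_def)
  obtain r where r: "linear_map r F X" "\<And>x. x \<in> carrier X \<Longrightarrow> r (J x) = x"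
    "\<And>v. v \<in> carrier F \<Longrightarrow> J (r v) = v" "\<And>v. v \<in> carrier F \<Longrightarrow> vnorm X (r v) = vnorm F v"
    by (rule isometric_isomorphism_inverse[OF nX F J]) auto
  have "isometry (\<lambda>x. J (h x)) E F"
    using h J by (auto simp: isometric_isomorphism_def isometry_def linear_map_def Pi_iff)
  moreover have "locally_retractable (\<lambda>x. J (h x)) E F"
    unfolding locally_retractable_def
  proof (intro allI impI)
    fix N and \<eta> :: real assume N: "finite N \<and> N \<subseteq> carrier F \<and> \<eta> > 0"
    then have "finite (r ` N) \<and> r ` N \<subseteq> carrier X \<and> \<eta> > 0"
      using linear_mapD(1)[OF r(1)] by auto
    then obtain S where S: "linear_map S X E" "\<And>x. x \<in> carrier E \<Longrightarrow> S (h x) = x"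
      "\<And>x. x \<in> r ` N \<Longrightarrow> vnorm E (S x) \<le> vnorm X x + \<eta>"
      using retr unfolding locally_retractable_def by metis
    have "linear_map (\<lambda>v. S (r v)) F E"
      using S(1) r(1) by (auto simp: linear_map_def Pi_iff)
    moreover have "\<forall>x\<in>carrier E. S (r (J (h x))) = x"
      using S(2) r(2) linear_mapD(1)[OF h'] by simp
    moreover have "\<forall>v\<in>N. vnorm E (S (r v)) \<le> vnorm F v + \<eta>"
      using S(3) r(4) N by fastforce
    ultimately show "\<exists>S. linear_map S F E \<and> (\<forall>x\<in>carrier E. S (J (h x)) = x) \<and>
        (\<forall>x\<in>N. vnorm E (S x) \<le> vnorm F x + \<eta>)" by blast
  qed
  ultimately have "\<alpha> F (sym_tensor_map n (\<lambda>x. J (h x)) E F w) = \<alpha> E w" if "w \<in> sym_tensors n E" for w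
    using s_tensor_norm_locally_retractable[OF E banach_space_isometric_isomorphism[OF X F J] _ _ \<alpha> that] by blast
  moreover have "sym_tensor_map n J X F (sym_tensor_map n h E X w) = sym_tensor_map n (\<lambda>x. J (h x)) E F w" for w
    using linear_mapD(1)[OF h'] by (intro sym_tensor_map_comp[OF J' nX]) auto
  ultimately show ?thesis
    using sym_tensor_map_linear[OF h' E] by (simp add: isometry_def norm_via_def)
qed

section \<open>Ultrapowers\<close>

text \<open>The algebraic product of copies of \<open>E\<close>, including unbounded families and
  carrying no norm. The index type is that of the ultrafilter in one application and the type of the
  points of \<open>E''\<close> in the other, where the elements are maps into
  \<open>E\<close>.\<close>

definition power_module :: "('k::real_or_complex, 'a) nspace \<Rightarrow> ('k, 'i \<Rightarrow> 'a) module" where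
  "power_module E = \<lparr>carrier = {u. \<forall>i. u i \<in> carrier E}, mult = undefined, one = undefined,
     zero = (\<lambda>i. \<zero>\<^bsub>E\<^esub>), add = (\<lambda>u v i. u i \<oplus>\<^bsub>E\<^esub> v i), smult = (\<lambda>c u i. c \<odot>\<^bsub>E\<^esub> u i)\<rparr>"

lemma power_module_simps [simp]:
  "u \<in> carrier (power_module E) \<longleftrightarrow> (\<forall>i. u i \<in> carrier E)"
  "\<zero>\<^bsub>power_module E\<^esub> = (\<lambda>i. \<zero>\<^bsub>E\<^esub>)" "u \<oplus>\<^bsub>power_module E\<^esub> v = (\<lambda>i. u i \<oplus>\<^bsub>E\<^esub> v i)"
  "c \<odot>\<^bsub>power_module E\<^esub> u = (\<lambda>i. c \<odot>\<^bsub>E\<^esub> u i)"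
  by (simp_all add: power_module_def)

lemma module_power_module:
  assumes "normed_space E"
  shows "Module.module scalar_space (power_module E)"
proof -
  interpret E: normed_space E by fact
  have "abelian_group (power_module E)"
  proof (rule abelian_groupI)
    fix u assume "u \<in> carrier (power_module E)"
    then show "\<exists>v\<in>carrier (power_module E). v \<oplus>\<^bsub>power_module E\<^esub> u = \<zero>\<^bsub>power_module E\<^esub>"
      by (intro bexI[of _ "\<lambda>i. (- 1) \<odot>\<^bsub>E\<^esub> u i"]) (auto simp: E.add_minus E.sm)
  qed (auto simp: E.M.a_ac)
  then show ?thesis
    by (intro moduleI) (auto simp: E.R.is_cring E.sm)
qed

section \<open>Limits along ultrafilters\<close>

text \<open>The image filter has a cluster point in a compact interval, and an ultrafilter converges
  to its cluster points: a neighbourhood not eventually entered would be eventually avoided.\<close>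

lemma ultrafilter_bounded_convergent:
  fixes g :: "'i \<Rightarrow> real"
  assumes U: "is_ultrafilter U" and C: "\<And>i. \<bar>g i\<bar> \<le> C"
  obtains l where "(g \<longlongrightarrow> l) U"
proof -
  have "filtermap g U \<noteq> bot"
    using U by (simp add: is_ultrafilter_def filtermap_bot_iff)
  moreover have "eventually (\<lambda>x. x \<in> {- C..C}) (filtermap g U)"
    using C by (auto simp: eventually_filtermap abs_le_iff minus_le_iff intro!: always_eventually)
  ultimately obtain l where l: "inf (nhds l) (filtermap g U) \<noteq> bot"
    using compact_Icc[of "- C" C] unfolding compact_filter by blast
  have "(g \<longlongrightarrow> l) U"
  proof (rule topological_tendstoI)
    fix S assume S: "open S" "l \<in> S"
    show "eventually (\<lambda>i. g i \<in> S) U"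
    proof (rule ccontr)
      assume "\<not> ?thesis"
      then have "eventually (\<lambda>i. g i \<notin> S) U"
        using U unfolding is_ultrafilter_def by blast
      then have "eventually (\<lambda>x. x \<notin> S) (filtermap g U)" by (simp add: eventually_filtermap)
      moreover have "eventually (\<lambda>x. x \<in> S) (nhds l)"
        using S by (auto simp: eventually_nhds)
      ultimately have "eventually (\<lambda>x. False) (inf (nhds l) (filtermap g U))"
        unfolding eventually_inf by blast
      with l show False by (simp add: trivial_limit_def)
    qed
  qed
  then show thesis by (rule that)
qed

lemma tendsto_0_squeeze:
  fixes f g :: "'i \<Rightarrow> real"
  assumes "(g \<longlongrightarrow> 0) F" "\<And>i. 0 \<le> f i" "\<And>i. f i \<le> g i"
  shows "(f \<longlongrightarrow> 0) F"
  by (rule tendsto_sandwich[OF _ _ tendsto_const assms(1)]) (simp_all add: assms)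

section \<open>The ultrapower as a normed space\<close>

locale normed_ultrapower = normed_space E for E :: "('k::real_or_complex, 'a) nspace" (structure) +
  fixes U :: "'i filter"
  assumes ultrafilter: "is_ultrafilter U"
begin

abbreviation "B \<equiv> bounded_families E"
abbreviation "X \<equiv> ultrapower U E"
abbreviation "cl \<equiv> ultra_class U E"

lemma U_nontrivial: "U \<noteq> bot"
  using ultrafilter by (simp add: is_ultrafilter_def)

lemma B_carrier: "z \<in> B \<Longrightarrow> z i \<in> carrier E"
  by (simp add: bounded_families_def)

lemma B_bound:
  assumes "z \<in> B"
  obtains C where "\<And>i. vnorm E (z i) \<le> C"
  using assms by (auto simp: bounded_families_def)

lemma B_I: "(\<And>i. z i \<in> carrier E) \<Longrightarrow> (\<And>i. vnorm E (z i) \<le> C) \<Longrightarrow> z \<in> B"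
  by (auto simp: bounded_families_def)

lemma B_const: "x \<in> carrier E \<Longrightarrow> (\<lambda>i. x) \<in> B"
  by (rule B_I) auto

lemma B_add:
  assumes "z \<in> B" "y \<in> B"
  shows "(\<lambda>i. z i \<oplus> y i) \<in> B"
proof -
  obtain C C' where C: "\<And>i. vnorm E (z i) \<le> C" "\<And>i. vnorm E (y i) \<le> C'"
    using B_bound[OF assms(1)] B_bound[OF assms(2)] by metis
  show ?thesis
  proof (rule B_I[of _ "C + C'"])
    show "vnorm E (z i \<oplus> y i) \<le> C + C'" for i
      using vnorm_triangle[of "z i" "y i"] C(1)[of i] C(2)[of i] assms by (simp add: B_carrier)
  qed (use assms in \<open>simp add: B_carrier\<close>)
qed

lemma B_smult:
  assumes "z \<in> B"
  shows "(\<lambda>i. c \<odot> z i) \<in> B"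
proof -
  obtain C where C: "\<And>i. vnorm E (z i) \<le> C"
    using B_bound[OF assms] by metis
  show ?thesis
    by (rule B_I[of _ "norm c * C"]) (use assms C in \<open>auto simp: B_carrier sm vnorm_smult mult_left_mono\<close>)
qed

lemma B_minus: "z \<in> B \<Longrightarrow> y \<in> B \<Longrightarrow> (\<lambda>i. z i \<ominus> y i) \<in> B"
  using B_add[OF _ B_smult[of y "- 1"], of z] by (simp add: minus_eq B_carrier)

lemma equiv_ultra_rel: "equiv B (ultra_rel U E)"
proof (rule equivI)
  show "refl_on B (ultra_rel U E)"
    by (auto simp: refl_on_def ultra_rel_def B_carrier minus_eq add_minus)
  show "sym (ultra_rel U E)"
    by (rule symI) (auto simp: ultra_rel_def B_carrier vnorm_minus_commute)
  show "trans (ultra_rel U E)"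
  proof (rule transI)
    fix x y z assume xyz: "(x, y) \<in> ultra_rel U E" "(y, z) \<in> ultra_rel U E"
    then have lim: "((\<lambda>i. vnorm E (x i \<ominus> y i) + vnorm E (y i \<ominus> z i)) \<longlongrightarrow> 0) U"
      by (intro tendsto_add_zero) (auto simp: ultra_rel_def)
    have c: "x i \<in> carrier E" "y i \<in> carrier E" "z i \<in> carrier E" for i
      using xyz by (auto simp: ultra_rel_def B_carrier)
    have "((\<lambda>i. vnorm E (x i \<ominus> z i)) \<longlongrightarrow> 0) U"
      by (rule tendsto_0_squeeze[OF lim]) (simp_all add: c vnorm_nonneg vnorm_dist_triangle)
    then show "(x, z) \<in> ultra_rel U E" using xyz by (simp add: ultra_rel_def)
  qed
qed (auto simp: ultra_rel_def)

lemma cl_eq_iff: "z \<in> B \<Longrightarrow> y \<in> B \<Longrightarrow> cl z = cl y \<longleftrightarrow> ((\<lambda>i. vnorm E (z i \<ominus> y i)) \<longlongrightarrow> 0) U"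
  using eq_equiv_class_iff[OF equiv_ultra_rel, of z y] by (simp add: ultra_rel_def)

lemma cl_memD: "y \<in> cl z \<Longrightarrow> y \<in> B \<and> cl y = cl z"
  using equiv_class_eq[OF equiv_ultra_rel, of z y] by (auto simp: ultra_rel_def)

lemma cl_self: "z \<in> B \<Longrightarrow> z \<in> cl z"
  by (rule equiv_class_self[OF equiv_ultra_rel])

lemma carrier_ultrapower: "carrier X = cl ` B"
  by (auto simp: ultrapower_def quotient_def)

text \<open>The norm of a class is defined as the only element of the set of limits over its
  representatives. Limits exist because the norms are bounded, and they agree because the norms of
  two representatives differ by a null family.\<close>

lemma norm_family_tendsto:
  assumes z: "z \<in> B"
  shows "((\<lambda>i. vnorm E (z i)) \<longlongrightarrow> vnorm X (cl z)) U"
proof -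
  obtain C where "\<And>i. vnorm E (z i) \<le> C" by (rule B_bound[OF z]) blast
  then have "\<bar>vnorm E (z i)\<bar> \<le> C" for i using vnorm_nonneg[OF B_carrier[OF z]] by simp
  then obtain l where l: "((\<lambda>i. vnorm E (z i)) \<longlongrightarrow> l) U"
    by (rule ultrafilter_bounded_convergent[OF ultrafilter, of "\<lambda>i. vnorm E (z i)" C]) auto
  have "Lim U (\<lambda>i. vnorm E (y i)) = l" if "y \<in> cl z" for y
  proof (rule tendsto_Lim[OF U_nontrivial])
    have y: "y \<in> B" and d: "((\<lambda>i. vnorm E (y i \<ominus> z i)) \<longlongrightarrow> 0) U"
      using cl_memD[OF that] cl_eq_iff[of y z] z by auto
    have "\<bar>vnorm E (y i) - vnorm E (z i)\<bar> \<le> vnorm E (y i \<ominus> z i)" for i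
      using vnorm_diff[of "y i" "z i"] vnorm_diff[of "z i" "y i"] vnorm_minus_commute[of "y i" "z i"] B_carrier y z
      by fastforce
    then have "((\<lambda>i. vnorm E (y i) - vnorm E (z i)) \<longlongrightarrow> 0) U"
      by (intro Lim_null_comparison[OF _ d] always_eventually) auto
    from tendsto_add[OF this l] show "((\<lambda>i. vnorm E (y i)) \<longlongrightarrow> l) U" by simp
  qed
  then have "(\<lambda>z. Lim U (\<lambda>i. vnorm E (z i))) ` cl z = {l}"
    using cl_self[OF z] by force
  then have "vnorm X (cl z) = l" by (simp add: ultrapower_def)
  with l show ?thesis by simp
qed

lemma vnorm_cl_le:
  assumes "z \<in> B" "eventually (\<lambda>i. vnorm E (z i) \<le> C) U"
  shows "vnorm X (cl z) \<le> C"
  using tendsto_upperbound[OF norm_family_tendsto[OF assms(1)] assms(2) U_nontrivial] .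

lemma add_cl:
  assumes "z \<in> B" "y \<in> B"
  shows "cl z \<oplus>\<^bsub>X\<^esub> cl y = cl (\<lambda>i. z i \<oplus> y i)"
proof -
  have "cl (\<lambda>i. z' i \<oplus> y' i) = cl (\<lambda>i. z i \<oplus> y i)" if "z' \<in> cl z" "y' \<in> cl y" for z' y'
  proof -
    have B: "z' \<in> B" "y' \<in> B" using cl_memD that by auto
    have lim: "((\<lambda>i. vnorm E (z' i \<ominus> z i) + vnorm E (y' i \<ominus> y i)) \<longlongrightarrow> 0) U"
      using cl_memD[OF that(1)] cl_memD[OF that(2)] cl_eq_iff assms by (intro tendsto_add_zero) auto
    have "(z' i \<oplus> y' i) \<ominus> (z i \<oplus> y i) = (z' i \<ominus> z i) \<oplus> (y' i \<ominus> y i)" for i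
      using B[THEN B_carrier] assms[THEN B_carrier] by (simp add: minus_eq sm add_swap)
    then have "vnorm E ((z' i \<oplus> y' i) \<ominus> (z i \<oplus> y i)) \<le> vnorm E (z' i \<ominus> z i) + vnorm E (y' i \<ominus> y i)" for i
      using vnorm_triangle[of "z' i \<ominus> z i" "y' i \<ominus> y i"] B[THEN B_carrier] assms[THEN B_carrier] by simp
    then have "((\<lambda>i. vnorm E ((z' i \<oplus> y' i) \<ominus> (z i \<oplus> y i))) \<longlongrightarrow> 0) U"
      by (rule tendsto_0_squeeze[OF lim, rotated]) (simp add: B_carrier B assms vnorm_nonneg)
    then show ?thesis using cl_eq_iff[OF B_add[OF B] B_add[OF assms]] by simp
  qed
  then have "(\<Union>z'\<in>cl z. \<Union>y'\<in>cl y. cl (\<lambda>i. z' i \<oplus> y' i)) = (\<Union>z'\<in>cl z. \<Union>y'\<in>cl y. cl (\<lambda>i. z i \<oplus> y i))"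
    by (intro SUP_cong refl)
  also have "\<dots> = cl (\<lambda>i. z i \<oplus> y i)"
    using cl_self assms by auto
  finally show ?thesis by (simp add: ultrapower_def)
qed

lemma smult_cl:
  assumes "z \<in> B"
  shows "c \<odot>\<^bsub>X\<^esub> cl z = cl (\<lambda>i. c \<odot> z i)"
proof -
  have "cl (\<lambda>i. c \<odot> z' i) = cl (\<lambda>i. c \<odot> z i)" if "z' \<in> cl z" for z'
  proof -
    have B: "z' \<in> B" using cl_memD that by auto
    have lim: "((\<lambda>i. norm c * vnorm E (z' i \<ominus> z i)) \<longlongrightarrow> 0) U"
      using cl_memD[OF that(1)] cl_eq_iff assms by (intro tendsto_mult_right_zero) auto
    have "(c \<odot> z' i) \<ominus> (c \<odot> z i) = c \<odot> (z' i \<ominus> z i)" for i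
      using B_carrier[OF B] assms[THEN B_carrier] by (simp add: minus_eq sm)
    then have "vnorm E ((c \<odot> z' i) \<ominus> (c \<odot> z i)) = norm c * vnorm E (z' i \<ominus> z i)" for i
      using B_carrier[OF B] assms[THEN B_carrier] by (simp add: vnorm_smult)
    then show ?thesis using lim cl_eq_iff[OF B_smult[OF B] B_smult[OF assms]] by simp
  qed
  then have "(\<Union>z'\<in>cl z. cl (\<lambda>i. c \<odot> z' i)) = (\<Union>z'\<in>cl z. cl (\<lambda>i. c \<odot> z i))"
    by (intro SUP_cong refl)
  also have "\<dots> = cl (\<lambda>i. c \<odot> z i)"
    using cl_self assms by auto
  finally show ?thesis by (simp add: ultrapower_def)
qed

lemma zero_ultrapower: "\<zero>\<^bsub>X\<^esub> = cl (\<lambda>i. \<zero>)"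
  by (simp add: ultrapower_def)

lemma normed_space_ultrapower: "normed_space X"
proof -
  note simps = add_cl smult_cl zero_ultrapower B_add B_smult B_const B_carrier sm
  have "abelian_group X"
  proof (rule abelian_groupI)
    fix Z assume "Z \<in> carrier X"
    then obtain z where z: "z \<in> B" "Z = cl z" by (auto simp: carrier_ultrapower)
    show "\<exists>Y\<in>carrier X. Y \<oplus>\<^bsub>X\<^esub> Z = \<zero>\<^bsub>X\<^esub>"
      using z by (intro bexI[of _ "cl (\<lambda>i. (- 1) \<odot> z i)"]) (auto simp: simps carrier_ultrapower add_minus)
  qed (auto simp: carrier_ultrapower simps M.a_ac)
  then have "Module.module scalar_space X"
    by (intro moduleI) (auto simp: R.is_cring carrier_ultrapower simps)
  moreover have "normed_space_axioms X"
  proof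
    fix Z assume "Z \<in> carrier X"
    then obtain z where z: "z \<in> B" "Z = cl z" by (auto simp: carrier_ultrapower)
    show "0 \<le> vnorm X Z"
      using tendsto_lowerbound[OF norm_family_tendsto[OF z(1)] _ U_nontrivial, of 0] z
      by (auto simp: vnorm_nonneg B_carrier)
    have "vnorm X Z = 0 \<longleftrightarrow> ((\<lambda>i. vnorm E (z i)) \<longlongrightarrow> 0) U"
      using norm_family_tendsto[OF z(1)] tendsto_unique[OF U_nontrivial] z(2) by metis
    also have "\<dots> \<longleftrightarrow> cl z = cl (\<lambda>i. \<zero>)"
      using cl_eq_iff[OF z(1) B_const] B_carrier[OF z(1)] by (simp add: minus_eq sm)
    finally show "vnorm X Z = 0 \<longleftrightarrow> Z = \<zero>\<^bsub>X\<^esub>" using z by (simp add: zero_ultrapower)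
    show "vnorm X (c \<odot>\<^bsub>X\<^esub> Z) = norm c * vnorm X Z" for c
    proof -
      have "((\<lambda>i. vnorm E (c \<odot> z i)) \<longlongrightarrow> norm c * vnorm X (cl z)) U"
        using tendsto_mult_left[OF norm_family_tendsto[OF z(1)], of "norm c"]
        by (simp add: vnorm_smult B_carrier[OF z(1)])
      then show ?thesis
        using tendsto_unique[OF U_nontrivial norm_family_tendsto[OF B_smult[OF z(1), of c]]] z
        by (simp add: smult_cl)
    qed
  next
    fix Z Y assume "Z \<in> carrier X" "Y \<in> carrier X"
    then obtain z y where z: "z \<in> B" "Z = cl z" and y: "y \<in> B" "Y = cl y" by (auto simp: carrier_ultrapower)
    have "vnorm X (cl (\<lambda>i. z i \<oplus> y i)) \<le> vnorm X (cl z) + vnorm X (cl y)"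
      by (rule tendsto_le[OF U_nontrivial tendsto_add[OF norm_family_tendsto[OF z(1)] norm_family_tendsto[OF y(1)]]
        norm_family_tendsto[OF B_add[OF z(1) y(1)]]]) (simp add: vnorm_triangle B_carrier z y)
    then show "vnorm X (Z \<oplus>\<^bsub>X\<^esub> Y) \<le> vnorm X Z + vnorm X Y"
      using z y by (simp add: add_cl)
  qed
  ultimately show ?thesis by (simp add: normed_space_def)
qed

lemma minus_cl:
  assumes "z \<in> B" "y \<in> B"
  shows "cl z \<ominus>\<^bsub>X\<^esub> cl y = cl (\<lambda>i. z i \<ominus> y i)"
proof -
  interpret X: normed_space X by (rule normed_space_ultrapower)
  have "cl z \<in> carrier X" "cl y \<in> carrier X" using assms by (auto simp: carrier_ultrapower)
  then show ?thesis using assms by (simp add: X.minus_eq minus_eq smult_cl add_cl B_smult B_carrier)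
qed

lemma isometry_ultrapower_emb: "isometry (ultrapower_emb U E) E X"
  unfolding isometry_def linear_map_def
proof (intro conjI ballI allI funcsetI)
  fix x assume x: "x \<in> carrier E"
  show "ultrapower_emb U E x \<in> carrier X"
    using x by (auto simp: ultrapower_emb_def carrier_ultrapower B_const)
  show "ultrapower_emb U E (c \<odot> x) = c \<odot>\<^bsub>X\<^esub> ultrapower_emb U E x" for c
    using x by (simp add: ultrapower_emb_def smult_cl B_const)
  show "vnorm X (ultrapower_emb U E x) = vnorm E x"
    using tendsto_unique[OF U_nontrivial norm_family_tendsto[OF B_const[OF x]] tendsto_const]
    by (simp add: ultrapower_emb_def)
  show "ultrapower_emb U E (x \<oplus> y) = ultrapower_emb U E x \<oplus>\<^bsub>X\<^esub> ultrapower_emb U E y"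
    if "y \<in> carrier E" for y
    using x that by (simp add: ultrapower_emb_def add_cl B_const)
qed

text \<open>The relation between classes and their representatives is linear and total, so
  \<open>linear_lifting\<close> applies. The prescription of constant families is single-valued
  because the canonical embedding is injective.\<close>

lemma linear_selection:
  obtains s where "linear_map s X (power_module E)" "\<And>Z. Z \<in> carrier X \<Longrightarrow> s Z \<in> B \<and> cl (s Z) = Z"
    "\<And>x. x \<in> carrier E \<Longrightarrow> s (ultrapower_emb U E x) = (\<lambda>i. x)"
proof -
  interpret X: normed_space X by (rule normed_space_ultrapower)
  have h: "linear_map (ultrapower_emb U E) E X" using isometry_ultrapower_emb by (simp add: isometry_def)
  have W: "Module.module scalar_space (power_module E :: ('k, 'i \<Rightarrow> 'a) module)"
    by (rule module_power_module) unfold_locales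
  have R: "linear_relation X (power_module E) {(cl z, z) | z. z \<in> B}"
    unfolding linear_relation_def
    by (auto simp: carrier_ultrapower zero_ultrapower B_carrier B_const add_cl smult_cl B_add B_smult)
  define G0 where "G0 = {(ultrapower_emb U E x, \<lambda>i::'i. x) | x. x \<in> carrier E}"
  have I: "(ultrapower_emb U E x, \<lambda>i. x) \<in> G0" if "x \<in> carrier E" for x
    using that by (auto simp: G0_def)
  have G: "linear_relation X (power_module E) G0"
    unfolding linear_relation_def
  proof (intro conjI allI impI)
    show "G0 \<subseteq> carrier X \<times> carrier (power_module E)"
      using linear_mapD(1)[OF h] by (auto simp: G0_def)
    show "(\<zero>\<^bsub>X\<^esub>, \<zero>\<^bsub>power_module E\<^esub>) \<in> G0"
      using I[of \<zero>] by (simp add: ultrapower_emb_def zero_ultrapower)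
  next
    fix Z z Y y assume "(Z, z) \<in> G0" "(Y, y) \<in> G0"
    then obtain u v where u: "u \<in> carrier E" "Z = ultrapower_emb U E u" "z = (\<lambda>i. u)"
      and v: "v \<in> carrier E" "Y = ultrapower_emb U E v" "y = (\<lambda>i. v)"
      unfolding G0_def by blast
    show "(Z \<oplus>\<^bsub>X\<^esub> Y, z \<oplus>\<^bsub>power_module E\<^esub> y) \<in> G0"
      using I[of "u \<oplus> v"] u v linear_mapD(2)[OF h u(1) v(1)] by simp
  next
    fix c Z z assume "(Z, z) \<in> G0"
    then obtain u where u: "u \<in> carrier E" "Z = ultrapower_emb U E u" "z = (\<lambda>i. u)"
      unfolding G0_def by blast
    show "(c \<odot>\<^bsub>X\<^esub> Z, c \<odot>\<^bsub>power_module E\<^esub> z) \<in> G0"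
      using I[of "c \<odot> u"] u linear_mapD(3)[OF h u(1), of c] by (simp add: sm)
  qed
  obtain s where s: "linear_map s X (power_module E)" "\<And>Z. Z \<in> carrier X \<Longrightarrow> (Z, s Z) \<in> {(cl z, z) | z. z \<in> B}"
    "\<And>Z w. (Z, w) \<in> G0 \<Longrightarrow> s Z = w"
  proof (rule linear_lifting[OF X.is_module W R _ G])
    show "\<exists>w. (v, w) \<in> {(cl z, z) | z. z \<in> B}" if "v \<in> carrier X" for v
      using that by (auto simp: carrier_ultrapower)
    show "G0 \<subseteq> {(cl z, z) | z. z \<in> B}"
      by (auto simp: G0_def ultrapower_emb_def B_const)
    fix w assume "(\<zero>\<^bsub>X\<^esub>, w) \<in> G0"
    then obtain x where x: "x \<in> carrier E" "w = (\<lambda>i. x)" "ultrapower_emb U E x = \<zero>\<^bsub>X\<^esub>" by (auto simp: G0_def)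
    then have "vnorm E x = 0"
      using isometry_ultrapower_emb X.vnorm_zero unfolding isometry_def by metis
    then show "w = \<zero>\<^bsub>power_module E\<^esub>" using vnorm_eq_0_iff x by simp
  qed blast
  show thesis
  proof (rule that[OF s(1)])
    show "s Z \<in> B \<and> cl (s Z) = Z" if "Z \<in> carrier X" for Z
      using s(2)[OF that] by auto
    show "s (ultrapower_emb U E x) = (\<lambda>i. x)" if "x \<in> carrier E" for x
      using s(3)[OF I[OF that]] .
  qed
qed

text \<open>Along \<open>U\<close> the norms of the chosen representative of a point tend to the
  norm of that point. Hence the finitely many strict inequalities hold together on a set of the
  ultrafilter; any index in it gives a retraction.\<close>

lemma locally_retractable_ultrapower: "locally_retractable (ultrapower_emb U E) E X"
  unfolding locally_retractable_def
proof (intro allI impI)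
  fix N and \<eta> :: real assume N: "finite N \<and> N \<subseteq> carrier X \<and> \<eta> > 0"
  obtain s where s: "linear_map s X (power_module E)" "\<And>Z. Z \<in> carrier X \<Longrightarrow> s Z \<in> B \<and> cl (s Z) = Z"
    "\<And>x. x \<in> carrier E \<Longrightarrow> s (ultrapower_emb U E x) = (\<lambda>i. x)"
    by (rule linear_selection) blast
  have "eventually (\<lambda>i. vnorm E (s Z i) < vnorm X Z + \<eta>) U" if "Z \<in> N" for Z
    using order_tendstoD(2)[OF norm_family_tendsto[of "s Z"], of "vnorm X Z + \<eta>"] s(2)[of Z] N that by auto
  then have "eventually (\<lambda>i. \<forall>Z\<in>N. vnorm E (s Z i) < vnorm X Z + \<eta>) U"
    using N by (intro eventually_ball_finite) auto
  then obtain i where i: "\<And>Z. Z \<in> N \<Longrightarrow> vnorm E (s Z i) < vnorm X Z + \<eta>"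
    using eventually_happens'[OF U_nontrivial] by blast
  have "linear_map (\<lambda>Z. s Z i) X E"
    using linear_mapD[OF s(1)] by (auto simp: linear_map_def)
  then show "\<exists>S. linear_map S X E \<and> (\<forall>x\<in>carrier E. S (ultrapower_emb U E x) = x) \<and>
      (\<forall>x\<in>N. vnorm E (S x) \<le> vnorm X x + \<eta>)"
    using s(3) i by (intro exI[of _ "\<lambda>Z. s Z i"]) (auto intro: less_imp_le)
qed

end

section \<open>Completeness of the ultrapower\<close>

lemma fast_Cauchy_subsequence:
  fixes d :: "nat \<Rightarrow> nat \<Rightarrow> real"
  assumes "\<forall>e>0. \<exists>N. \<forall>m\<ge>N. \<forall>k\<ge>N. d m k < e"
  obtains n where "mono n" "\<And>j m k. n j \<le> m \<Longrightarrow> n j \<le> k \<Longrightarrow> d m k < (1/2) ^ j"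
proof -
  have "\<exists>N. \<forall>m\<ge>N. \<forall>k\<ge>N. d m k < (1/2) ^ j" for j :: nat
    using assms by simp
  then obtain N where N: "\<And>j m k. N j \<le> m \<Longrightarrow> N j \<le> k \<Longrightarrow> d m k < (1/2) ^ j"
    by metis
  \<comment> \<open>Partial sums of the thresholds are monotone and still dominate each
    threshold.\<close>
  show thesis
  proof (rule that[of "\<lambda>j. \<Sum>i\<le>j. N i"])
    show "mono (\<lambda>j. \<Sum>i\<le>j. N i)"
      by (intro monoI sum_mono2) auto
    have "N j \<le> (\<Sum>i\<le>j. N i)" for j
      by (rule member_le_sum) auto
    then show "d m k < (1/2) ^ j" if "(\<Sum>i\<le>j. N i) \<le> m" "(\<Sum>i\<le>j. N i) \<le> k" for j m k
      using that N order_trans by blast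
  qed
qed

lemma (in banach_space) fast_Cauchy_limit:
  assumes Z: "\<And>k. Z k \<in> carrier E" and fast: "\<And>k. vnorm E (Z (Suc k) \<ominus> Z k) \<le> (1/2) ^ k"
  obtains x where "x \<in> carrier E" "\<And>k. vnorm E (Z k \<ominus> x) \<le> 2 * (1/2) ^ k"
proof -
  \<comment> \<open>The right-hand side is the exact sum of (1/2)^i over k <= i < k + p; the cruder
    bound 2 (1/2)^k would not pass through the induction.\<close>
  have tail: "vnorm E (Z (k + p) \<ominus> Z k) \<le> 2 * (1/2) ^ k - 2 * (1/2) ^ (k + p)" for k p
  proof (induction p)
    case 0
    then show ?case using Z[of k] by (simp add: minus_eq add_minus)
  next
    case (Suc p)
    have "vnorm E (Z (Suc (k + p)) \<ominus> Z k) \<le> (1/2) ^ (k + p) + vnorm E (Z (k + p) \<ominus> Z k)"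
      using vnorm_dist_triangle[OF Z Z Z, of "Suc (k + p)" k "k + p"] fast[of "k + p"] by linarith
    moreover have "2 * (1/2::real) ^ (k + Suc p) = (1/2) ^ (k + p)" by simp
    moreover have "2 * (1/2::real) ^ (k + p) = (1/2) ^ (k + p) + (1/2) ^ (k + p)" by simp
    ultimately show ?case using Suc by (simp only: add_Suc_right)
  qed
  have tail': "vnorm E (Z m \<ominus> Z k) \<le> 2 * (1/2) ^ k" if km: "k \<le> m" for k m
  proof -
    obtain p where "m = k + p" using km by (auto simp: le_iff_add)
    moreover have "(1/2::real) ^ (k + p) \<ge> 0" by (rule zero_le_power) simp
    then have "2 * (1/2) ^ k - 2 * (1/2) ^ (k + p) \<le> 2 * (1/2::real) ^ k" by (simp only: diff_le_eq le_add_same_cancel1 mult_nonneg_nonneg zero_le_numeral)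
    ultimately show ?thesis using order_trans[OF tail[of k p]] by simp
  qed
  have "\<exists>x\<in>carrier E. (\<lambda>m. vnorm E (Z m \<ominus> x)) \<longlonglongrightarrow> 0"
  proof (rule complete)
    show "\<forall>e>0. \<exists>N. \<forall>m\<ge>N. \<forall>k\<ge>N. vnorm E (Z m \<ominus> Z k) < e"
    proof (intro allI impI)
      fix e :: real assume "e > 0"
      then obtain N where N: "(1/2) ^ N < e / 4"
        using real_arch_pow_inv[of "e / 4" "1/2"] by auto
      have "vnorm E (Z m \<ominus> Z k) < e" if "m \<ge> N" "k \<ge> N" for m k
        using vnorm_dist_triangle[OF Z Z Z, of m k N] tail'[OF that(1)] tail'[OF that(2)]
          vnorm_minus_commute[OF Z Z, of N k] N by linarith
      then show "\<exists>N. \<forall>m\<ge>N. \<forall>k\<ge>N. vnorm E (Z m \<ominus> Z k) < e" by blast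
    qed
  qed (use Z in blast)
  then obtain x where x: "x \<in> carrier E" "(\<lambda>m. vnorm E (Z m \<ominus> x)) \<longlonglongrightarrow> 0" by blast
  show thesis
  proof (rule that[OF x(1)])
    fix k
    have "(\<lambda>m. 2 * (1/2) ^ k + vnorm E (Z m \<ominus> x)) \<longlonglongrightarrow> 2 * (1/2) ^ k + 0"
      by (intro tendsto_intros x(2))
    moreover have "vnorm E (Z k \<ominus> x) \<le> 2 * (1/2) ^ k + vnorm E (Z m \<ominus> x)" if "m \<ge> k" for m
      using vnorm_dist_triangle[OF Z Z x(1), of k m] tail'[OF that] vnorm_minus_commute[OF Z Z, of k m] by linarith
    ultimately show "vnorm E (Z k \<ominus> x) \<le> 2 * (1/2) ^ k"
      using LIMSEQ_le_const[of "\<lambda>m. 2 * (1/2) ^ k + vnorm E (Z m \<ominus> x)" "2 * (1/2) ^ k + 0" "vnorm E (Z k \<ominus> x)"] by auto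
  qed
qed

text \<open>Representatives of a rapidly converging subsequence are chosen one after another so that
  consecutive ones are (1/2)^k-close at every index, not merely on a set of \<open>U\<close>.
  Completeness of \<open>E\<close> then gives limits index by index, and the common rate makes them
  a bounded family whose class is the limit.\<close>

lemma banach_space_ultrapower:
  assumes E: "banach_space E" and U: "is_ultrafilter U"
  shows "banach_space (ultrapower U E)"
proof -
  interpret E: banach_space E by fact
  interpret normed_ultrapower E U using U by unfold_locales
  interpret X: normed_space X by (rule normed_space_ultrapower)
  show ?thesis
  proof
    fix Y :: "nat \<Rightarrow> _"
    assume Y: "\<forall>m. Y m \<in> carrier X" and Cauchy: "\<forall>e>0. \<exists>N. \<forall>m\<ge>N. \<forall>k\<ge>N. vnorm X (Y m \<ominus>\<^bsub>X\<^esub> Y k) < e"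
    obtain n where n: "mono n" "\<And>j m k. n j \<le> m \<Longrightarrow> n j \<le> k \<Longrightarrow> vnorm X (Y m \<ominus>\<^bsub>X\<^esub> Y k) < (1/2) ^ j"
      by (rule fast_Cauchy_subsequence[OF Cauchy]) blast
    have rep: "\<exists>y\<in>B. cl y = Y m" for m using Y by (force simp: carrier_ultrapower)
    have "\<exists>Z. \<forall>k. (Z k \<in> B \<and> cl (Z k) = Y (n k)) \<and> (\<forall>i. vnorm E (Z (Suc k) i \<ominus>\<^bsub>E\<^esub> Z k i) \<le> (1/2) ^ k)"
    proof (rule dependent_nat_choice)
      show "\<exists>z. z \<in> B \<and> cl z = Y (n 0)" using rep by blast
      fix z k assume z: "z \<in> B \<and> cl z = Y (n k)"
      obtain y where y: "y \<in> B" "cl y = Y (n (Suc k))" using rep by blast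
      \<comment> \<open>Where \<open>y\<close> is too far away, the previous value is kept. These
        indices are negligible for \<open>U\<close>, so \<open>z'\<close> still represents
        \<open>Y (n (Suc k))\<close>.\<close>
      define z' where "z' i = (if vnorm E (y i \<ominus>\<^bsub>E\<^esub> z i) \<le> (1/2) ^ k then y i else z i)" for i
      have zE: "y i \<in> carrier E" "z i \<in> carrier E" for i using y z B_carrier by auto
      obtain C C' where C: "\<And>i. vnorm E (y i) \<le> C" "\<And>i. vnorm E (z i) \<le> C'"
        using y z B_bound by metis
      have z': "z' \<in> B"
        by (rule B_I[of _ "max C C'"]) (use zE C in \<open>auto simp: z'_def le_max_iff_disj\<close>)
      have "vnorm X (cl y \<ominus>\<^bsub>X\<^esub> cl z) < (1/2) ^ k"
        using n(2)[of k "n (Suc k)" "n k"] monoD[OF n(1), of k "Suc k"] y z by simp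
      then have "vnorm X (cl (\<lambda>i. y i \<ominus>\<^bsub>E\<^esub> z i)) < (1/2) ^ k"
        using minus_cl[of y z] y(1) z by metis
      then have "eventually (\<lambda>i. vnorm E (y i \<ominus>\<^bsub>E\<^esub> z i) < (1/2) ^ k) U"
        using order_tendstoD(2)[OF norm_family_tendsto[OF B_minus[of y z]]] y z by simp
      then have "eventually (\<lambda>i. vnorm E (z' i \<ominus>\<^bsub>E\<^esub> y i) = 0) U"
        by eventually_elim (simp add: z'_def zE E.minus_eq E.add_minus)
      then have "cl z' = cl y"
        using cl_eq_iff[OF z' y(1)] by (simp add: tendsto_eventually)
      moreover have "vnorm E (z' i \<ominus>\<^bsub>E\<^esub> z i) \<le> (1/2) ^ k" for i
        using zE by (auto simp: z'_def E.minus_eq E.add_minus)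
      ultimately show "\<exists>z'. (z' \<in> B \<and> cl z' = Y (n (Suc k))) \<and> (\<forall>i. vnorm E (z' i \<ominus>\<^bsub>E\<^esub> z i) \<le> (1/2) ^ k)"
        using z' y by auto
    qed
    then obtain Z where ZB: "\<And>k. Z k \<in> B" and Zcl: "\<And>k. cl (Z k) = Y (n k)"
      and Zfast: "\<And>k i. vnorm E (Z (Suc k) i \<ominus>\<^bsub>E\<^esub> Z k i) \<le> (1/2) ^ k"
      by blast
    have "\<exists>x\<in>carrier E. \<forall>k. vnorm E (Z k i \<ominus>\<^bsub>E\<^esub> x) \<le> 2 * (1/2) ^ k" for i
      by (rule E.fast_Cauchy_limit[of "\<lambda>k. Z k i"]) (use B_carrier[OF ZB] Zfast in auto)
    then obtain x where x: "\<And>i. x i \<in> carrier E" "\<And>i k. vnorm E (Z k i \<ominus>\<^bsub>E\<^esub> x i) \<le> 2 * (1/2) ^ k"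
      by metis
    obtain C where C: "\<And>i. vnorm E (Z 0 i) \<le> C" using B_bound[OF ZB[of 0]] by blast
    have xB: "x \<in> B"
    proof (rule B_I[of _ "2 + C"])
      show "vnorm E (x i) \<le> 2 + C" for i
        using E.vnorm_diff[OF x(1)[of i] B_carrier[OF ZB[of 0], of i]]
          E.vnorm_minus_commute[OF x(1)[of i] B_carrier[OF ZB[of 0], of i]] x(2)[of 0 i] C[of i] by simp
    qed (rule x(1))
    have lim: "vnorm X (Y (n k) \<ominus>\<^bsub>X\<^esub> cl x) \<le> 2 * (1/2) ^ k" for k
      using vnorm_cl_le[OF B_minus[OF ZB[of k] xB]] x(2) Zcl[of k, symmetric] by (simp add: minus_cl[OF ZB xB])
    have clx: "cl x \<in> carrier X" using xB by (auto simp: carrier_ultrapower)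
    have "(\<lambda>m. vnorm X (Y m \<ominus>\<^bsub>X\<^esub> cl x)) \<longlonglongrightarrow> 0"
    proof (rule LIMSEQ_I)
      fix e :: real assume "e > 0"
      \<comment> \<open>One (1/2)^k is spent between \<open>Y m\<close> and \<open>Y (n k)\<close>,
        two more between \<open>Y (n k)\<close> and the limit.\<close>
      then obtain k where k: "(1/2) ^ k < e / 3"
        using real_arch_pow_inv[of "e / 3" "1/2"] by auto
      have "vnorm X (Y m \<ominus>\<^bsub>X\<^esub> cl x) < e" if "m \<ge> n k" for m
        using X.vnorm_dist_triangle[of "Y m" "Y (n k)" "cl x"] n(2)[OF that order.refl] lim[of k] Y clx k
        by fastforce
      moreover have "0 \<le> vnorm X (Y m \<ominus>\<^bsub>X\<^esub> cl x)" for m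
        using Y clx by (intro X.vnorm_nonneg) simp
      ultimately show "\<exists>m0. \<forall>m\<ge>m0. norm (vnorm X (Y m \<ominus>\<^bsub>X\<^esub> cl x) - 0) < e"
        by (intro exI[of _ "n k"]) simp
    qed
    with clx show "\<exists>x\<in>carrier X. (\<lambda>m. vnorm X (Y m \<ominus>\<^bsub>X\<^esub> x)) \<longlonglongrightarrow> 0" by blast
  qed
qed

section \<open>Biduals\<close>

lemma normed_space_scalar_space: "normed_space (scalar_space :: ('k::real_or_complex, 'k) nspace)"
  by (simp add: normed_space_def module_scalar_space) (unfold_locales, auto simp: norm_triangle_ineq norm_mult)

lemma dual_space_simps [simp]:
  "\<zero>\<^bsub>dual_space E\<^esub> = (\<lambda>x\<in>carrier E. 0)" "f \<oplus>\<^bsub>dual_space E\<^esub> g = (\<lambda>x\<in>carrier E. f x + g x)"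
  "c \<odot>\<^bsub>dual_space E\<^esub> f = (\<lambda>x\<in>carrier E. c * f x)" "vnorm (dual_space E) = opnorm E scalar_space"
  by (simp_all add: dual_space_def)

lemma dual_spaceD:
  assumes "f \<in> carrier (dual_space E)"
  shows "f \<in> extensional (carrier E)" "linear_map f E scalar_space"
    "x \<in> carrier E \<Longrightarrow> y \<in> carrier E \<Longrightarrow> f (x \<oplus>\<^bsub>E\<^esub> y) = f x + f y"
    "x \<in> carrier E \<Longrightarrow> f (c \<odot>\<^bsub>E\<^esub> x) = c * f x"
  using assms by (auto simp: dual_space_def bounded_linear_map_def linear_map_def)

section \<open>The dual space and its completeness\<close>

context normed_space
begin

abbreviation "E' \<equiv> dual_space E"

lemma dual_spaceI:
  assumes "linear_map f E scalar_space" "0 \<le> C" "\<And>x. x \<in> carrier E \<Longrightarrow> norm (f x) \<le> C * vnorm E x"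
  shows "(\<lambda>x\<in>carrier E. f x) \<in> carrier E'" "vnorm E' (\<lambda>x\<in>carrier E. f x) \<le> C"
proof -
  have l: "linear_map (\<lambda>x\<in>carrier E. f x) E scalar_space"
    using linear_mapD[OF assms(1)] by (auto simp: linear_map_def sm)
  then show "(\<lambda>x\<in>carrier E. f x) \<in> carrier E'"
    using assms(3) by (auto simp: dual_space_def bounded_linear_map_def)
  show "vnorm E' (\<lambda>x\<in>carrier E. f x) \<le> C"
    using opnorm_le(2)[OF _ normed_space_scalar_space l assms(2)] assms(3) by (simp add: normed_space_axioms)
qed

lemma dual_bound:
  assumes f: "f \<in> carrier E'"
  shows "0 \<le> vnorm E' f" "x \<in> carrier E \<Longrightarrow> norm (f x) \<le> vnorm E' f * vnorm E x"
proof -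
  note l = dual_spaceD(2)[OF f]
  obtain C where "\<And>x. x \<in> carrier E \<Longrightarrow> norm (f x) \<le> C * vnorm E x"
    using f by (auto simp: dual_space_def bounded_linear_map_def)
  \<comment> \<open>\<open>bounded_linear_map\<close> tolerates a negative constant, which can occur
    on the zero space; hence the absolute value.\<close>
  then have C: "norm (f x) \<le> \<bar>C\<bar> * vnorm E x" if "x \<in> carrier E" for x
    using that vnorm_nonneg[OF that] by (meson abs_ge_self mult_right_mono order_trans)
  show "0 \<le> vnorm E' f"
    using opnorm_le(1)[OF _ normed_space_scalar_space l, of "\<bar>C\<bar>"] C by (simp add: normed_space_axioms)
  have le: "norm (f y) \<le> vnorm E' f" if y: "y \<in> carrier E" "vnorm E y \<le> 1" for y
  proof -
    have "norm (f z) \<le> \<bar>C\<bar>" if "z \<in> carrier E" "vnorm E z \<le> 1" for z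
      using C[OF that(1)] mult_left_mono[OF that(2), of "\<bar>C\<bar>"] by simp
    then have "bdd_above ((\<lambda>x. norm (f x)) ` {x \<in> carrier E. vnorm E x \<le> 1})"
      by (intro bdd_aboveI[of _ "\<bar>C\<bar>"]) auto
    then show ?thesis
      using y by (auto simp: opnorm_def intro: cSUP_upper)
  qed
  show "norm (f x) \<le> vnorm E' f * vnorm E x" if x: "x \<in> carrier E"
  proof (cases "vnorm E x = 0")
    case True
    then show ?thesis using C[OF x] by simp
  next
    case False
    then have pos: "vnorm E x > 0" using vnorm_nonneg[OF x] by simp
    let ?c = "of_real (inverse (vnorm E x))"
    have "norm (f (?c \<odot> x)) \<le> vnorm E' f"
      using x pos by (intro le) (auto simp: sm vnorm_smult norm_inverse norm_divide)
    moreover have "norm (f (?c \<odot> x)) = inverse (vnorm E x) * norm (f x)"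
      using dual_spaceD(4)[OF f x, of ?c] pos by (simp add: norm_mult norm_inverse del: of_real_inverse)
    ultimately have "inverse (vnorm E x) * norm (f x) \<le> vnorm E' f" by (simp only:)
    then show ?thesis using pos by (simp add: field_simps)
  qed
qed

lemma dual_eqI: "f \<in> carrier E' \<Longrightarrow> g \<in> carrier E' \<Longrightarrow> (\<And>x. x \<in> carrier E \<Longrightarrow> f x = g x) \<Longrightarrow> f = g"
  using extensionalityI[of f "carrier E" g] dual_spaceD(1) by blast

lemma dual_zero: "(\<lambda>x\<in>carrier E. 0) \<in> carrier E'"
  by (rule dual_spaceI(1)[of _ 0]) (auto simp: linear_map_def)

lemma dual_add:
  assumes "f \<in> carrier E'" "g \<in> carrier E'"
  shows "(\<lambda>x\<in>carrier E. f x + g x) \<in> carrier E'"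
    "vnorm E' (\<lambda>x\<in>carrier E. f x + g x) \<le> vnorm E' f + vnorm E' g"
proof -
  have l: "linear_map (\<lambda>x. f x + g x) E scalar_space"
    using dual_spaceD[OF assms(1)] dual_spaceD[OF assms(2)] by (auto simp: linear_map_def algebra_simps)
  have b: "norm (f x + g x) \<le> (vnorm E' f + vnorm E' g) * vnorm E x" if "x \<in> carrier E" for x
    using dual_bound(2)[OF assms(1) that] dual_bound(2)[OF assms(2) that] norm_triangle_ineq[of "f x" "g x"]
    by (simp add: distrib_right)
  show "(\<lambda>x\<in>carrier E. f x + g x) \<in> carrier E'"
    "vnorm E' (\<lambda>x\<in>carrier E. f x + g x) \<le> vnorm E' f + vnorm E' g"
    using dual_spaceI[OF l _ b] dual_bound(1) assms by auto
qed

lemma dual_smult: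
  assumes f: "f \<in> carrier E'"
  shows "(\<lambda>x\<in>carrier E. c * f x) \<in> carrier E'" "vnorm E' (\<lambda>x\<in>carrier E. c * f x) = norm c * vnorm E' f"
proof -
  have le: "(\<lambda>x\<in>carrier E. c * f x) \<in> carrier E' \<and> vnorm E' (\<lambda>x\<in>carrier E. c * f x) \<le> norm c * vnorm E' f"
    if f: "f \<in> carrier E'" for c f
  proof -
    have l: "linear_map (\<lambda>x. c * f x) E scalar_space"
      using dual_spaceD[OF f] by (auto simp: linear_map_def algebra_simps)
    have "norm (c * f x) \<le> (norm c * vnorm E' f) * vnorm E x" if "x \<in> carrier E" for x
      using dual_bound(2)[OF f that] by (simp add: norm_mult mult.assoc mult_left_mono)
    from dual_spaceI[OF l _ this] show ?thesis using dual_bound(1)[OF f] by simp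
  qed
  show 1: "(\<lambda>x\<in>carrier E. c * f x) \<in> carrier E'" using le[OF f] by blast
  show "vnorm E' (\<lambda>x\<in>carrier E. c * f x) = norm c * vnorm E' f"
  proof (cases "c = 0")
    case True
    then show ?thesis using le[OF f, of c] dual_bound(1)[OF 1] by simp
  next
    case False
    \<comment> \<open>The reverse inequality is the one already proved, applied to
      \<open>inverse c\<close> and \<open>?g\<close>.\<close>
    let ?g = "\<lambda>x\<in>carrier E. c * f x"
    have "(\<lambda>x\<in>carrier E. inverse c * ?g x) = f"
      using False 1 le[OF 1, of "inverse c"] f by (intro dual_eqI) auto
    then have "vnorm E' f \<le> inverse (norm c) * vnorm E' ?g"
      using le[OF 1, of "inverse c"] by (simp add: norm_inverse)
    then have "norm c * vnorm E' f \<le> vnorm E' ?g" using False by (simp add: field_simps)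
    then show ?thesis using le[OF f, of c] by (intro antisym) auto
  qed
qed

lemma normed_space_dual: "normed_space E'"
proof -
  have ac: "f \<oplus>\<^bsub>E'\<^esub> g \<in> carrier E'" "c \<odot>\<^bsub>E'\<^esub> f \<in> carrier E'" "\<zero>\<^bsub>E'\<^esub> \<in> carrier E'"
    if "f \<in> carrier E'" "g \<in> carrier E'" for f g c
    using that by (auto simp: dual_add dual_smult dual_zero)
  have z: "\<zero>\<^bsub>E'\<^esub> \<in> carrier E'" by (simp add: dual_zero)
  have "abelian_group E'"
  proof (rule abelian_groupI)
    fix f assume "f \<in> carrier E'"
    then show "\<exists>g\<in>carrier E'. g \<oplus>\<^bsub>E'\<^esub> f = \<zero>\<^bsub>E'\<^esub>"
      by (intro bexI[of _ "(- 1) \<odot>\<^bsub>E'\<^esub> f"] ac) (auto intro!: restrict_ext)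
  next
    fix f g k assume "f \<in> carrier E'" "g \<in> carrier E'" "k \<in> carrier E'"
    then show "(f \<oplus>\<^bsub>E'\<^esub> g) \<oplus>\<^bsub>E'\<^esub> k = f \<oplus>\<^bsub>E'\<^esub> (g \<oplus>\<^bsub>E'\<^esub> k)"
      by (intro dual_eqI ac) (auto simp: add.assoc)
  next
    fix f g assume "f \<in> carrier E'" "g \<in> carrier E'"
    then show "f \<oplus>\<^bsub>E'\<^esub> g = g \<oplus>\<^bsub>E'\<^esub> f"
      by (intro dual_eqI ac) (auto simp: add.commute)
  next
    fix f assume "f \<in> carrier E'"
    then show "\<zero>\<^bsub>E'\<^esub> \<oplus>\<^bsub>E'\<^esub> f = f"
      by (intro dual_eqI ac z) auto
  qed (use ac z in auto)
  then have "Module.module scalar_space E'"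
  proof (intro moduleI)
    show "cring (scalar_space :: ('k, 'k) nspace)" by (rule R.is_cring)
    show "c \<odot>\<^bsub>E'\<^esub> f \<in> carrier E'" if "f \<in> carrier E'" for c f using ac that by blast
    show "(c \<oplus>\<^bsub>scalar_space\<^esub> d) \<odot>\<^bsub>E'\<^esub> f = c \<odot>\<^bsub>E'\<^esub> f \<oplus>\<^bsub>E'\<^esub> d \<odot>\<^bsub>E'\<^esub> f" if "f \<in> carrier E'" for c d f
      using that by (intro dual_eqI ac) (auto simp: algebra_simps)
    show "c \<odot>\<^bsub>E'\<^esub> (f \<oplus>\<^bsub>E'\<^esub> g) = c \<odot>\<^bsub>E'\<^esub> f \<oplus>\<^bsub>E'\<^esub> c \<odot>\<^bsub>E'\<^esub> g" if "f \<in> carrier E'" "g \<in> carrier E'" for c f g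
      using that by (intro dual_eqI ac) (auto simp: algebra_simps)
    show "(c \<otimes>\<^bsub>scalar_space\<^esub> d) \<odot>\<^bsub>E'\<^esub> f = c \<odot>\<^bsub>E'\<^esub> (d \<odot>\<^bsub>E'\<^esub> f)" if "f \<in> carrier E'" for c d f
      using that by (intro dual_eqI ac) (auto simp: algebra_simps)
    show "\<one>\<^bsub>scalar_space\<^esub> \<odot>\<^bsub>E'\<^esub> f = f" if "f \<in> carrier E'" for f
      using that by (intro dual_eqI ac) auto
  qed auto
  moreover have "normed_space_axioms E'"
  proof
    fix f assume f: "f \<in> carrier E'"
    show "0 \<le> vnorm E' f" by (rule dual_bound(1)[OF f])
    show "vnorm E' (c \<odot>\<^bsub>E'\<^esub> f) = norm c * vnorm E' f" for c
      using dual_smult(2)[OF f, of c] by simp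
    show "vnorm E' f = 0 \<longleftrightarrow> f = \<zero>\<^bsub>E'\<^esub>"
    proof
      assume "vnorm E' f = 0"
      then show "f = \<zero>\<^bsub>E'\<^esub>"
        using dual_bound(2)[OF f] by (intro dual_eqI[OF f z]) fastforce
    next
      assume "f = \<zero>\<^bsub>E'\<^esub>"
      then have "f = (\<lambda>x\<in>carrier E. 0 * f x)" by (simp cong: restrict_cong)
      then show "vnorm E' f = 0" using dual_smult(2)[OF f, of 0] by simp
    qed
  next
    fix f g assume "f \<in> carrier E'" "g \<in> carrier E'"
    then show "vnorm E' (f \<oplus>\<^bsub>E'\<^esub> g) \<le> vnorm E' f + vnorm E' g"
      using dual_add(2) by simp
  qed
  ultimately show ?thesis by (simp add: normed_space_def)
qed

lemma banach_space_dual: "banach_space E'"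
proof -
  interpret D: normed_space E' by (rule normed_space_dual)
  have minus: "(f \<ominus>\<^bsub>E'\<^esub> g) x = f x - g x" if "f \<in> carrier E'" "g \<in> carrier E'" "x \<in> carrier E" for f g x
    using that by (simp add: D.minus_eq)
  show ?thesis
  proof
    fix Y :: "nat \<Rightarrow> _"
    assume Y: "\<forall>m. Y m \<in> carrier E'" and Cauchy: "\<forall>e>0. \<exists>N. \<forall>m\<ge>N. \<forall>k\<ge>N. vnorm E' (Y m \<ominus>\<^bsub>E'\<^esub> Y k) < e"
    have diff: "norm (Y m x - Y k x) \<le> vnorm E' (Y m \<ominus>\<^bsub>E'\<^esub> Y k) * vnorm E x" if "x \<in> carrier E" for m k x
      using dual_bound(2)[of "Y m \<ominus>\<^bsub>E'\<^esub> Y k" x] Y that by (simp add: minus del: dual_space_simps)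
    have "\<exists>l. (\<lambda>m. Y m x) \<longlonglongrightarrow> l" if x: "x \<in> carrier E" for x
    proof -
      have "Cauchy (\<lambda>m. Y m x)"
      proof (rule CauchyI)
        fix e :: real assume e: "e > 0"
        have pos: "vnorm E x + 1 > 0" using vnorm_nonneg[OF x] by simp
        obtain N where N: "\<And>m k. m \<ge> N \<Longrightarrow> k \<ge> N \<Longrightarrow> vnorm E' (Y m \<ominus>\<^bsub>E'\<^esub> Y k) < e / (vnorm E x + 1)"
          using Cauchy[rule_format, OF divide_pos_pos[OF e pos]] by blast
        have "norm (Y m x - Y k x) < e" if "m \<ge> N" "k \<ge> N" for m k
        proof -
          have nn: "0 \<le> vnorm E' (Y m \<ominus>\<^bsub>E'\<^esub> Y k)" using Y by (intro D.vnorm_nonneg) simp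
          have "norm (Y m x - Y k x) \<le> vnorm E' (Y m \<ominus>\<^bsub>E'\<^esub> Y k) * (vnorm E x + 1)"
            using diff[OF x, of m k] mult_left_mono[OF _ nn, of "vnorm E x" "vnorm E x + 1"] by linarith
          also have "\<dots> < e" using N[OF that] pos by (simp add: field_simps)
          finally show ?thesis .
        qed
        then show "\<exists>M. \<forall>m\<ge>M. \<forall>n\<ge>M. norm (Y m x - Y n x) < e" by blast
      qed
      then show ?thesis by (rule scalars_complete) blast
    qed
    then obtain l where l: "\<And>x. x \<in> carrier E \<Longrightarrow> (\<lambda>m. Y m x) \<longlonglongrightarrow> l x" by metis
    have lin: "linear_map l E scalar_space"
      unfolding linear_map_def
    proof (intro conjI ballI allI)
      fix x y assume xy: "x \<in> carrier E" "y \<in> carrier E"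
      have "(\<lambda>m. Y m (x \<oplus> y)) \<longlonglongrightarrow> l x + l y"
        using tendsto_add[OF l[OF xy(1)] l[OF xy(2)]] Y xy by (simp add: dual_spaceD)
      then show "l (x \<oplus> y) = l x \<oplus>\<^bsub>scalar_space\<^esub> l y"
        using LIMSEQ_unique l[of "x \<oplus> y"] xy by auto
    next
      fix c x assume x: "x \<in> carrier E"
      have "(\<lambda>m. Y m (c \<odot> x)) \<longlonglongrightarrow> c * l x"
        using tendsto_mult_left[OF l[OF x], of c] Y x by (simp add: dual_spaceD)
      then show "l (c \<odot> x) = c \<odot>\<^bsub>scalar_space\<^esub> l x"
        using LIMSEQ_unique l[of "c \<odot> x"] x by (auto simp: sm)
    qed auto
    \<comment> \<open>The Cauchy estimate is passed to the limit in k. A bound of 1 shows that the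
      pointwise limit is a bounded functional, small bounds show convergence in norm.\<close>
    have close: "norm (Y m x - l x) \<le> e * vnorm E x"
      if "\<And>k. k \<ge> m \<Longrightarrow> vnorm E' (Y m \<ominus>\<^bsub>E'\<^esub> Y k) \<le> e" "x \<in> carrier E" for m e x
    proof (rule LIMSEQ_le_const2)
      show "(\<lambda>k. norm (Y m x - Y k x)) \<longlonglongrightarrow> norm (Y m x - l x)"
        by (intro tendsto_intros l that)
      have "norm (Y m x - Y k x) \<le> e * vnorm E x" if "k \<ge> m" for k
        using diff[OF \<open>x \<in> carrier E\<close>, of m k] mult_right_mono[OF \<open>\<And>k. k \<ge> m \<Longrightarrow> vnorm E' (Y m \<ominus>\<^bsub>E'\<^esub> Y k) \<le> e\<close>[OF that]
            vnorm_nonneg[OF \<open>x \<in> carrier E\<close>]] by linarith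
      then show "\<exists>N. \<forall>k\<ge>N. norm (Y m x - Y k x) \<le> e * vnorm E x" by blast
    qed
    obtain N1 where N1: "\<And>m k. m \<ge> N1 \<Longrightarrow> k \<ge> N1 \<Longrightarrow> vnorm E' (Y m \<ominus>\<^bsub>E'\<^esub> Y k) < 1"
      using Cauchy[rule_format, OF zero_less_one] by blast
    have "norm (l x) \<le> (vnorm E' (Y N1) + 1) * vnorm E x" if x: "x \<in> carrier E" for x
    proof -
      have "norm (Y N1 x - l x) \<le> 1 * vnorm E x"
        by (rule close[OF _ x]) (use N1 in \<open>auto intro: less_imp_le simp del: dual_space_simps\<close>)
      moreover have "norm (l x) \<le> norm (Y N1 x) + norm (Y N1 x - l x)"
        using norm_triangle_sub[of "l x" "Y N1 x"] by (simp add: norm_minus_commute)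
      ultimately show ?thesis using dual_bound(2)[of "Y N1" x] Y x by (simp add: distrib_right)
    qed
    then have L: "(\<lambda>x\<in>carrier E. l x) \<in> carrier E'"
      using dual_bound(1)[of "Y N1"] Y by (intro dual_spaceI(1)[OF lin, of "vnorm E' (Y N1) + 1"]) auto
    let ?l = "\<lambda>x\<in>carrier E. l x"
    have "(\<lambda>m. vnorm E' (Y m \<ominus>\<^bsub>E'\<^esub> ?l)) \<longlonglongrightarrow> 0"
    proof (rule LIMSEQ_I)
      fix e :: real assume e: "e > 0"
      obtain N where N: "\<And>m k. m \<ge> N \<Longrightarrow> k \<ge> N \<Longrightarrow> vnorm E' (Y m \<ominus>\<^bsub>E'\<^esub> Y k) < e / 2"
        using Cauchy[rule_format, OF half_gt_zero[OF e]] by blast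
      have "vnorm E' (Y m \<ominus>\<^bsub>E'\<^esub> ?l) \<le> e / 2" if m: "m \<ge> N" for m
      proof -
        let ?d = "Y m \<ominus>\<^bsub>E'\<^esub> ?l"
        have d: "?d \<in> carrier E'" using Y L by simp
        have "norm (?d x) \<le> e / 2 * vnorm E x" if x: "x \<in> carrier E" for x
        proof -
          have "norm (Y m x - l x) \<le> e / 2 * vnorm E x"
            by (rule close[OF _ x]) (use N m in \<open>auto intro: less_imp_le simp del: dual_space_simps\<close>)
          then show ?thesis using minus[of "Y m" ?l x] Y L x by simp
        qed
        from dual_spaceI(2)[OF dual_spaceD(2)[OF d] _ this] e
        have "vnorm E' (\<lambda>x\<in>carrier E. ?d x) \<le> e / 2" by simp
        moreover have "(\<lambda>x\<in>carrier E. ?d x) = ?d"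
          using dual_spaceD(1)[OF d] by (rule extensional_restrict)
        ultimately show ?thesis by simp
      qed
      moreover have "0 \<le> vnorm E' (Y m \<ominus>\<^bsub>E'\<^esub> ?l)" for m
        using Y L by (intro D.vnorm_nonneg) simp
      ultimately show "\<exists>m0. \<forall>m\<ge>m0. norm (vnorm E' (Y m \<ominus>\<^bsub>E'\<^esub> ?l) - 0) < e"
        using e by (intro exI[of _ N] allI impI) (smt (verit) real_norm_def field_sum_of_halves)
    qed
    with L show "\<exists>x\<in>carrier E'. (\<lambda>m. vnorm E' (Y m \<ominus>\<^bsub>E'\<^esub> x)) \<longlonglongrightarrow> 0" by blast
  qed
qed

section \<open>Norming vectors and the canonical embedding\<close>

text \<open>A near-maximiser of \<open>f\<close> on the unit ball is rotated by a unimodular scalar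
  until its value is real. Values of several functionals can then be added without
  cancellation.\<close>

lemma dual_nearly_norming:
  assumes f: "f \<in> carrier E'" and e: "e > 0"
  obtains y t where "y \<in> carrier E" "vnorm E y \<le> 1" "f y = of_real t" "vnorm E' f - e \<le> t"
proof -
  have "\<exists>y\<in>{x \<in> carrier E. vnorm E x \<le> 1}. vnorm E' f - e < norm (f y)"
  proof (rule ccontr)
    assume "\<not> ?thesis"
    then have "norm (f y) \<le> vnorm E' f - e" if "y \<in> carrier E" "vnorm E y \<le> 1" for y
      using that by (auto simp: not_less)
    then have "vnorm E' f \<le> vnorm E' f - e"
      unfolding dual_space_simps(4) opnorm_def scalar_space_simps
      by (intro cSUP_least) (auto intro!: exI[of _ \<zero>])
    with e show False by simp
  qed
  then obtain y where y: "y \<in> carrier E" "vnorm E y \<le> 1" "vnorm E' f - e < norm (f y)" by blast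
  show thesis
  proof (cases "f y = 0")
    case True
    then show thesis using that[of y 0] y by simp
  next
    case False
    define c where "c = of_real (norm (f y)) / f y"
    have "norm c = 1" "f (c \<odot> y) = of_real (norm (f y))"
      using False dual_spaceD(4)[OF f y(1), of c] by (auto simp: c_def norm_divide)
    then show thesis
      using that[of "c \<odot> y" "norm (f y)"] y by (simp add: sm vnorm_smult)
  qed
qed

lemma bidual_emb_apply: "f \<in> carrier E' \<Longrightarrow> bidual_emb E x f = f x"
  by (simp add: bidual_emb_def)

lemma bidual_emb:
  assumes x: "x \<in> carrier E"
  shows "bidual_emb E x \<in> carrier (bidual E)" "vnorm (bidual E) (bidual_emb E x) = vnorm E x"
proof -
  interpret D: normed_space E' by (rule normed_space_dual)
  have l: "linear_map (\<lambda>f. f x) E' scalar_space"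
    using x by (auto simp: linear_map_def)
  have b: "norm (f x) \<le> vnorm E x * vnorm E' f" if "f \<in> carrier E'" for f
    using dual_bound(2)[OF that x] by (simp add: mult.commute)
  note B = D.dual_spaceI[OF l vnorm_nonneg[OF x] b, folded bidual_emb_def]
  show m: "bidual_emb E x \<in> carrier (bidual E)" by (rule B(1))
  show "vnorm (bidual E) (bidual_emb E x) = vnorm E x"
  proof (rule antisym[OF B(2)])
    show "vnorm E x \<le> vnorm (bidual E) (bidual_emb E x)"
    proof (cases "vnorm E x = 0")
      case True
      then show ?thesis using D.dual_bound(1)[OF m] by simp
    next
      case False
      then have pos: "vnorm E x > 0" using vnorm_nonneg[OF x] by simp
      \<comment> \<open>Separating \<open>x\<close> from zero for the norm rescaled to be 1 at
        \<open>x\<close> produces a functional whose norm is at most the inverse of the norm of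
        \<open>x\<close> and whose modulus at \<open>x\<close> is at least 1.\<close>
      obtain f where f: "linear_map f E scalar_space" "\<And>u. u \<in> carrier E \<Longrightarrow> norm (f u) \<le> vnorm E u / vnorm E x"
        "1 \<le> norm (f x)"
      proof (rule separating_functional[OF is_module, of "\<lambda>u. vnorm E u / vnorm E x" "{\<zero>}" x])
        show "linear_subspace E {\<zero>}" by (auto simp: linear_subspace_def sm)
        show "vnorm E (u \<oplus> v) / vnorm E x \<le> vnorm E u / vnorm E x + vnorm E v / vnorm E x"
          if "u \<in> carrier E" "v \<in> carrier E" for u v
          using vnorm_triangle[OF that] pos by (simp add: divide_right_mono flip: add_divide_distrib)
      qed (use x pos in \<open>auto simp: vnorm_smult\<close>)
      have f': "norm (f u) \<le> inverse (vnorm E x) * vnorm E u" if "u \<in> carrier E" for u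
        using f(2)[OF that] by (simp add: field_simps)
      have nn: "0 \<le> inverse (vnorm E x)" using pos by simp
      note F = dual_spaceI[OF f(1) nn f']
      have "1 \<le> norm (bidual_emb E x (\<lambda>x\<in>carrier E. f x))"
        using f(3) x F(1) by (simp add: bidual_emb_apply)
      also have "\<dots> \<le> vnorm (bidual E) (bidual_emb E x) * vnorm E' (\<lambda>x\<in>carrier E. f x)"
        by (rule D.dual_bound(2)[OF m F(1)])
      also have "\<dots> \<le> vnorm (bidual E) (bidual_emb E x) * inverse (vnorm E x)"
        by (rule mult_left_mono[OF F(2) D.dual_bound(1)[OF m]])
      finally show ?thesis using pos by (simp add: field_simps)
    qed
  qed
qed

lemma isometry_bidual_emb: "isometry (bidual_emb E) E (bidual E)"
proof -
  interpret D: normed_space E' by (rule normed_space_dual)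
  have "bidual_emb E (x \<oplus> y) = bidual_emb E x \<oplus>\<^bsub>bidual E\<^esub> bidual_emb E y"
    if "x \<in> carrier E" "y \<in> carrier E" for x y
    using that unfolding dual_space_simps(2)[where E = E'] bidual_emb_def
    by (intro restrict_ext) (simp add: dual_spaceD)
  moreover have "bidual_emb E (c \<odot> x) = c \<odot>\<^bsub>bidual E\<^esub> bidual_emb E x"
    if "x \<in> carrier E" for c x
    using that unfolding dual_space_simps(3)[where E = E'] bidual_emb_def
    by (intro restrict_ext) (simp add: dual_spaceD)
  ultimately show ?thesis
    using bidual_emb by (auto simp: isometry_def linear_map_def simp del: dual_space_simps)
qed

section \<open>Interpolation on finitely many functionals and local reflexivity\<close>

text \<open>Algebraically, \<open>g\<close> is a linear combination of the functionals in \<open>\<Phi>\<close>.\<close>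

lemma bidual_vanishes_of_kernel_inclusion:
  assumes "finite \<Phi>" "\<Phi> \<subseteq> carrier E'" "m \<in> carrier (bidual E)" "\<And>h. h \<in> \<Phi> \<Longrightarrow> m h = 0"
    and "g \<in> carrier E'" "\<And>y. y \<in> carrier E \<Longrightarrow> (\<And>h. h \<in> \<Phi> \<Longrightarrow> h y = 0) \<Longrightarrow> g y = 0"
  shows "m g = 0"
  using assms
proof (induction \<Phi> arbitrary: g)
  case empty
  interpret D: normed_space E' by (rule normed_space_dual)
  have "g = \<zero>\<^bsub>E'\<^esub>"
    using empty by (intro dual_eqI) (auto simp: dual_zero)
  moreover have "m (0 \<odot>\<^bsub>E'\<^esub> g) = 0 * m g" using dual_spaceD(4)[OF empty.prems(2,4)] .
  ultimately show ?case using D.sm(6)[OF empty.prems(4)] by (metis mult_zero_left)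
next
  case (insert f \<Phi>)
  interpret D: normed_space E' by (rule normed_space_dual)
  have f: "f \<in> carrier E'" and \<Phi>: "\<Phi> \<subseteq> carrier E'" and g: "g \<in> carrier E'" using insert.prems by auto
  note m = insert.prems(2)
  show ?case
  proof (cases "\<exists>z\<in>carrier E. (\<forall>h\<in>\<Phi>. h z = 0) \<and> f z \<noteq> 0")
    case False
    have "g y = 0" if "y \<in> carrier E" "\<And>h. h \<in> \<Phi> \<Longrightarrow> h y = 0" for y
      using insert.prems(5)[of y] False that by blast
    then show ?thesis using insert.IH[OF \<Phi> m _ g] insert.prems(3) by blast
  next
    case True
    then obtain z where z: "z \<in> carrier E" "\<And>h. h \<in> \<Phi> \<Longrightarrow> h z = 0" "f z \<noteq> 0" by blast
    \<comment> \<open>The multiple of \<open>f\<close> is chosen so that \<open>?g\<close> vanishes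
      at \<open>z\<close>. For \<open>y\<close> in the common kernel of \<open>\<Phi>\<close>, the
      vector \<open>?y\<close> below also lies in the kernel of \<open>f\<close>, and
      \<open>?g y\<close> equals \<open>g ?y\<close>, so \<open>?g\<close> falls under the induction
      hypothesis.\<close>
    define c where "c = - (g z / f z)"
    let ?g = "g \<oplus>\<^bsub>E'\<^esub> c \<odot>\<^bsub>E'\<^esub> f"
    have cf: "c \<odot>\<^bsub>E'\<^esub> f \<in> carrier E'" by (rule D.sm(1)[OF f])
    have gc: "?g \<in> carrier E'" by (rule D.M.a_closed[OF g cf])
    have "m ?g = 0"
    proof (rule insert.IH[OF \<Phi> m _ gc])
      fix y assume y: "y \<in> carrier E" "\<And>h. h \<in> \<Phi> \<Longrightarrow> h y = 0"
      let ?y = "y \<oplus> (- (f y / f z)) \<odot> z"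
      have val: "h ?y = h y + (- (f y / f z)) * h z" if "h \<in> carrier E'" for h
        using dual_spaceD(3,4)[OF that] y z by (simp add: sm)
      have yc: "?y \<in> carrier E" using y z by (simp add: sm)
      have "g ?y = 0"
      proof (rule insert.prems(5)[OF yc])
        fix h assume "h \<in> insert f \<Phi>"
        then show "h ?y = 0"
        proof (elim insertE)
          assume "h = f" then show ?thesis using val[OF f] z(3) by simp
        next
          assume h: "h \<in> \<Phi>"
          show ?thesis using val[OF subsetD[OF \<Phi> h]] y(2)[OF h] z(2)[OF h] by simp
        qed
      qed
      then show "?g y = 0" using val[OF g] y(1) z(3) by (simp add: c_def field_simps)
    qed (use insert.prems in auto)
    moreover have "m ?g = m g + c * m f"
      using dual_spaceD(3)[OF m g cf] dual_spaceD(4)[OF m f, of c] by (simp only:)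
    ultimately show ?thesis using insert.prems(3)[of f] by simp
  qed
qed

text \<open>The algebraic part of Helly's theorem, without control of the norm of the point. If
  \<open>f\<close> is nonzero somewhere on the common kernel of \<open>\<Phi>\<close>, the point
  found for \<open>\<Phi>\<close> is corrected inside that kernel. Otherwise \<open>f\<close>
  depends linearly on \<open>\<Phi>\<close>, and \<open>m\<close> minus the image of the point
  vanishes at \<open>f\<close> because it vanishes on \<open>\<Phi>\<close>.\<close>

lemma finite_interpolation:
  assumes "finite \<Phi>" "\<Phi> \<subseteq> carrier E'" "m \<in> carrier (bidual E)"
  shows "\<exists>y\<in>carrier E. \<forall>g\<in>\<Phi>. g y = m g"
  using assms
proof (induction \<Phi>)
  case empty
  then show ?case by auto
next
  case (insert f \<Phi>)
  interpret D: normed_space E' by (rule normed_space_dual)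
  interpret DD: normed_space "bidual E" by (rule D.normed_space_dual)
  have f: "f \<in> carrier E'" and \<Phi>: "\<Phi> \<subseteq> carrier E'" using insert.prems by auto
  note m = insert.prems(2)
  obtain y where y: "y \<in> carrier E" "\<And>g. g \<in> \<Phi> \<Longrightarrow> g y = m g" using insert.IH[OF \<Phi> m] by blast
  show ?case
  proof (cases "\<exists>z\<in>carrier E. (\<forall>h\<in>\<Phi>. h z = 0) \<and> f z \<noteq> 0")
    case True
    then obtain z where z: "z \<in> carrier E" "\<And>h. h \<in> \<Phi> \<Longrightarrow> h z = 0" "f z \<noteq> 0" by blast
    let ?y = "y \<oplus> ((m f - f y) / f z) \<odot> z"
    have val: "h ?y = h y + ((m f - f y) / f z) * h z" if "h \<in> carrier E'" for h
      using dual_spaceD(3,4)[OF that] y z by (simp add: sm)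
    have "g ?y = m g" if "g \<in> insert f \<Phi>" for g
      using that
    proof (elim insertE)
      assume "g = f" then show ?thesis using val[OF f] z(3) by simp
    next
      assume g: "g \<in> \<Phi>"
      show ?thesis using val[OF subsetD[OF \<Phi> g]] y(2)[OF g] z(2)[OF g] by simp
    qed
    moreover have "?y \<in> carrier E" by (intro M.a_closed sm(1) y(1) z(1))
    ultimately show ?thesis by blast
  next
    case False
    let ?m = "m \<oplus>\<^bsub>bidual E\<^esub> (- 1) \<odot>\<^bsub>bidual E\<^esub> bidual_emb E y"
    have mc: "?m \<in> carrier (bidual E)"
      by (intro DD.M.a_closed DD.sm(1) m bidual_emb(1) y(1))
    have val: "?m g = m g - g y" if "g \<in> carrier E'" for g
      using that by (simp add: bidual_emb_apply)
    have "?m f = 0"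
    proof (rule bidual_vanishes_of_kernel_inclusion[OF insert.hyps(1) \<Phi> mc _ f])
      show "?m h = 0" if "h \<in> \<Phi>" for h
        using val[OF subsetD[OF \<Phi> that]] y(2)[OF that] by simp
      show "f u = 0" if "u \<in> carrier E" "\<And>h. h \<in> \<Phi> \<Longrightarrow> h u = 0" for u
        using False that by blast
    qed
    then have "f y = m f" using val[OF f] by simp
    then show ?thesis using y by blast
  qed
qed

text \<open>The algebraic retractions are viewed as the coset a + D in a power of \<open>E\<close>,
  and those obeying the bounds are the ones with \<open>p\<close> at most 1. If there are none, a
  separating functional \<open>f\<close> exists; it is a sum of functionals \<open>g x\<close> in E'
  applied to the coordinates x in \<open>N\<close>. Vanishing on \<open>D\<close> gives f a = sum of
  x (g x), of modulus at most the sum of norm x norm (g x), whereas |f| <= p bounds the same sum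
  with the larger weights norm x + \<eta> by 1. This is incompatible with |f a| >= 1.\<close>

lemma locally_retractable_bidual_emb: "locally_retractable (bidual_emb E) E (bidual E)"
  unfolding locally_retractable_def
proof (intro allI impI, elim conjE)
  fix N and \<eta> :: real
  assume fin: "finite N" and N: "N \<subseteq> carrier (bidual E)" and \<eta>: "\<eta> > 0"
  interpret D: normed_space E' by (rule normed_space_dual)
  interpret X: normed_space "bidual E" by (rule D.normed_space_dual)
  let ?X = "bidual E" and ?\<kappa> = "bidual_emb E"
  let ?V = "power_module E :: ('k, (('a \<Rightarrow> 'k) \<Rightarrow> 'k) \<Rightarrow> 'a) module"
  have \<kappa>: "linear_map ?\<kappa> E ?X" using isometry_bidual_emb by (simp add: isometry_def)
  note \<kappa>D = linear_mapD[OF \<kappa>]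
  have V: "Module.module scalar_space ?V"
    by (rule module_power_module) unfold_locales
  \<comment> \<open>Lifting through the full relation extends the inverse of the embedding to all of
    \<open>E''\<close>, as an algebraic and possibly discontinuous retraction
    \<open>S0\<close>.\<close>
  have full: "linear_relation ?X E (carrier ?X \<times> carrier E)"
    unfolding linear_relation_def by (simp add: X.sm sm del: dual_space_simps)
  obtain S0 where S0: "linear_map S0 ?X E" "\<And>y. y \<in> carrier E \<Longrightarrow> S0 (?\<kappa> y) = y"
  proof (rule linear_lifting[OF X.is_module is_module full])
    show "linear_relation ?X E {(?\<kappa> y, y) | y. y \<in> carrier E}"
      unfolding linear_relation_def
    proof (intro conjI allI impI)
      show "{(?\<kappa> y, y) | y. y \<in> carrier E} \<subseteq> carrier ?X \<times> carrier E" using \<kappa>D(1) by auto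
      have "?\<kappa> \<zero> = \<zero>\<^bsub>?X\<^esub>"
        using \<kappa>D(3)[of \<zero> 0] X.sm(6)[OF \<kappa>D(1)[of \<zero>]] by (simp add: sm del: dual_space_simps)
      then show "(\<zero>\<^bsub>?X\<^esub>, \<zero>) \<in> {(?\<kappa> y, y) | y. y \<in> carrier E}" by force
    next
      fix u t v w assume "(u, t) \<in> {(?\<kappa> y, y) | y. y \<in> carrier E}" "(v, w) \<in> {(?\<kappa> y, y) | y. y \<in> carrier E}"
      then show "(u \<oplus>\<^bsub>?X\<^esub> v, t \<oplus> w) \<in> {(?\<kappa> y, y) | y. y \<in> carrier E}"
        using \<kappa>D(2)[of t w] by (simp del: dual_space_simps)
    next
      fix c u t assume "(u, t) \<in> {(?\<kappa> y, y) | y. y \<in> carrier E}"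
      then show "(c \<odot>\<^bsub>?X\<^esub> u, c \<odot> t) \<in> {(?\<kappa> y, y) | y. y \<in> carrier E}"
        using \<kappa>D(3)[of t c] by (simp add: sm del: dual_space_simps)
    qed
    show "{(?\<kappa> y, y) | y. y \<in> carrier E} \<subseteq> carrier ?X \<times> carrier E" using \<kappa>D(1) by auto
    show "w = \<zero>" if "(\<zero>\<^bsub>?X\<^esub>, w) \<in> {(?\<kappa> y, y) | y. y \<in> carrier E}" for w
    proof -
      have w: "w \<in> carrier E" "?\<kappa> w = \<zero>\<^bsub>?X\<^esub>" using that by auto
      then have "vnorm E w = 0" using bidual_emb(2)[OF w(1)] X.vnorm_zero by simp
      with w show ?thesis using vnorm_eq_0_iff by blast
    qed
  qed (use M.zero_closed in blast)+
  \<comment> \<open>Adding an element of \<open>D\<close> to \<open>S0\<close> leaves it a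
    retraction; these are the available corrections.\<close>
  define D where "D = {u \<in> carrier ?V. linear_map u ?X E \<and> (\<forall>y\<in>carrier E. u (?\<kappa> y) = \<zero>)}"
  have Dsub: "linear_subspace ?V D"
    unfolding linear_subspace_def
  proof (intro conjI ballI allI)
    show "D \<subseteq> carrier ?V" by (auto simp: D_def)
    show "\<zero>\<^bsub>?V\<^esub> \<in> D" by (simp add: D_def linear_map_def sm)
  next
    fix u v assume "u \<in> D" "v \<in> D"
    then show "u \<oplus>\<^bsub>?V\<^esub> v \<in> D"
      by (simp add: D_def linear_map_def sm add_swap del: dual_space_simps)
  next
    fix c u assume "u \<in> D"
    then show "c \<odot>\<^bsub>?V\<^esub> u \<in> D"
      by (simp add: D_def linear_map_def sm mult.commute del: dual_space_simps)
  qed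
  \<comment> \<open>The coordinates of \<open>?V\<close> are indexed by the entire type, so
    \<open>S0\<close> receives the value zero outside the carrier.\<close>
  define a where "a x = (if x \<in> carrier ?X then S0 x else \<zero>)" for x
  have a: "a \<in> carrier ?V" using linear_mapD(1)[OF S0(1)] by (simp add: a_def)
  define r where "r x = vnorm ?X x + \<eta>" for x
  have r: "r x > 0" if "x \<in> N" for x
    using X.vnorm_nonneg[of x] N that \<eta> by (auto simp: r_def simp del: dual_space_simps)
  \<comment> \<open>The least t >= 0 such that each coordinate x in \<open>N\<close> has norm at
    most t times \<open>r x\<close>. The inserted 0 covers empty \<open>N\<close>.\<close>
  define p where "p u = Max (insert 0 ((\<lambda>x. vnorm E (u x) / r x) ` N))" for u
  have p_le_iff: "p u \<le> t \<longleftrightarrow> 0 \<le> t \<and> (\<forall>x\<in>N. vnorm E (u x) \<le> t * r x)" for u t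
    unfolding p_def using fin r by (auto simp: pos_divide_le_eq)
  have p_nonneg: "0 \<le> p u" and p_ge: "x \<in> N \<Longrightarrow> vnorm E (u x) \<le> p u * r x" for u x
    using p_le_iff[of u "p u"] by auto
  have p_add: "p (u \<oplus>\<^bsub>?V\<^esub> v) \<le> p u + p v" if "u \<in> carrier ?V" "v \<in> carrier ?V" for u v
    unfolding p_le_iff
  proof (intro conjI ballI)
    fix x assume x: "x \<in> N"
    have "vnorm E (u x \<oplus> v x) \<le> p u * r x + p v * r x"
      using vnorm_triangle[of "u x" "v x"] p_ge[OF x, of u] p_ge[OF x, of v] that by fastforce
    then show "vnorm E ((u \<oplus>\<^bsub>?V\<^esub> v) x) \<le> (p u + p v) * r x" by (simp add: distrib_right)
  qed (use p_nonneg in simp)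
  have p_smult_le: "p (c \<odot>\<^bsub>?V\<^esub> u) \<le> norm c * p u" if "u \<in> carrier ?V" for c u
    unfolding p_le_iff
  proof (intro conjI ballI)
    fix x assume x: "x \<in> N"
    show "vnorm E ((c \<odot>\<^bsub>?V\<^esub> u) x) \<le> norm c * p u * r x"
      using mult_left_mono[OF p_ge[OF x, of u] norm_ge_zero[of c]] that by (simp add: vnorm_smult mult.assoc)
  qed (use p_nonneg in simp)
  have p_smult: "p (c \<odot>\<^bsub>?V\<^esub> u) = norm c * p u" if u: "u \<in> carrier ?V" for c u
  proof (cases "c = 0")
    case True
    then show ?thesis using p_smult_le[OF u, of c] p_nonneg[of "c \<odot>\<^bsub>?V\<^esub> u"] by simp
  next
    case False
    have "inverse c \<odot>\<^bsub>?V\<^esub> (c \<odot>\<^bsub>?V\<^esub> u) = u" using u False by (simp add: sm)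
    then have "p u \<le> inverse (norm c) * p (c \<odot>\<^bsub>?V\<^esub> u)"
      using p_smult_le[of "c \<odot>\<^bsub>?V\<^esub> u" "inverse c"] u by (simp add: norm_inverse sm)
    then have "norm c * p u \<le> p (c \<odot>\<^bsub>?V\<^esub> u)" using False by (simp add: field_simps)
    with p_smult_le[OF u] show ?thesis by (simp add: antisym)
  qed
  show "\<exists>S. linear_map S ?X E \<and> (\<forall>x\<in>carrier E. S (?\<kappa> x) = x) \<and>
      (\<forall>x\<in>N. vnorm E (S x) \<le> vnorm ?X x + \<eta>)"
  proof (rule ccontr)
    assume none: "\<not> ?thesis"
    \<comment> \<open>A point of the coset with \<open>p\<close> at most 1 would be a retraction of
      the kind excluded by \<open>none\<close>.\<close>
    have sep: "1 \<le> p (a \<oplus>\<^bsub>?V\<^esub> d)" if d: "d \<in> D" for d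
    proof (rule ccontr)
      assume "\<not> 1 \<le> p (a \<oplus>\<^bsub>?V\<^esub> d)"
      then have "p (a \<oplus>\<^bsub>?V\<^esub> d) \<le> 1" by simp
      then have le: "vnorm E ((a \<oplus>\<^bsub>?V\<^esub> d) x) \<le> vnorm ?X x + \<eta>" if "x \<in> N" for x
        using that unfolding p_le_iff r_def by simp
      have dl: "linear_map d ?X E" and dk: "\<And>y. y \<in> carrier E \<Longrightarrow> d (?\<kappa> y) = \<zero>"
        using d by (auto simp: D_def)
      have eq: "(a \<oplus>\<^bsub>?V\<^esub> d) x = S0 x \<oplus> d x" if "x \<in> carrier ?X" for x
        using that by (simp add: a_def del: dual_space_simps)
      have "linear_map (a \<oplus>\<^bsub>?V\<^esub> d) ?X E"
        unfolding linear_map_def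
      proof (intro conjI ballI allI funcsetI)
        fix x assume x: "x \<in> carrier ?X"
        show "(a \<oplus>\<^bsub>?V\<^esub> d) x \<in> carrier E"
          unfolding eq[OF x] by (intro M.a_closed linear_mapD(1)[OF S0(1) x] linear_mapD(1)[OF dl x])
        show "(a \<oplus>\<^bsub>?V\<^esub> d) (c \<odot>\<^bsub>?X\<^esub> x) = c \<odot> (a \<oplus>\<^bsub>?V\<^esub> d) x" for c
          unfolding eq[OF x] eq[OF X.sm(1)[OF x]] linear_mapD(3)[OF S0(1) x] linear_mapD(3)[OF dl x]
          by (rule sm(5)[symmetric]) (intro linear_mapD(1)[OF S0(1) x] linear_mapD(1)[OF dl x])+
        fix y assume y: "y \<in> carrier ?X"
        show "(a \<oplus>\<^bsub>?V\<^esub> d) (x \<oplus>\<^bsub>?X\<^esub> y) = (a \<oplus>\<^bsub>?V\<^esub> d) x \<oplus> (a \<oplus>\<^bsub>?V\<^esub> d) y"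
          unfolding eq[OF x] eq[OF y] eq[OF X.M.a_closed[OF x y]] linear_mapD(2)[OF S0(1) x y] linear_mapD(2)[OF dl x y]
          by (rule add_swap) (intro linear_mapD(1)[OF S0(1)] linear_mapD(1)[OF dl] x y)+
      qed
      moreover have "(a \<oplus>\<^bsub>?V\<^esub> d) (?\<kappa> y) = y" if "y \<in> carrier E" for y
        unfolding eq[OF \<kappa>D(1)[OF that]] using S0(2)[OF that] dk[OF that] that by simp
      ultimately show False using none le by blast
    qed
    obtain f where f: "linear_map f ?V (scalar_space :: ('k, 'k) nspace)"
      "\<And>u. u \<in> carrier ?V \<Longrightarrow> norm (f u) \<le> p u" "\<And>d. d \<in> D \<Longrightarrow> f d = 0" "1 \<le> norm (f a)"
    proof (rule separating_functional[where p = p and D = D and a = a, OF V p_add p_smult Dsub a sep])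
      fix f assume "linear_map f ?V (scalar_space :: ('k, 'k) nspace)"
        "\<And>u. u \<in> carrier ?V \<Longrightarrow> norm (f u) \<le> p u" "\<And>d. d \<in> D \<Longrightarrow> f d = 0" "1 \<le> norm (f a)"
      then show thesis by (rule that)
    qed assumption+
    define g where "g x = (\<lambda>y\<in>carrier E. f (\<lambda>i. if i = x then y else \<zero>))" for x
    have g: "g x \<in> carrier E'" if x: "x \<in> N" for x
      unfolding g_def
    proof (rule dual_spaceI(1))
      let ?\<delta> = "\<lambda>y i. if i = x then y else \<zero>"
      show "linear_map (\<lambda>y. f (?\<delta> y)) E scalar_space"
        unfolding linear_map_def
      proof (intro conjI ballI allI)
        fix y z assume yz: "y \<in> carrier E" "z \<in> carrier E"
        have "?\<delta> (y \<oplus> z) = ?\<delta> y \<oplus>\<^bsub>?V\<^esub> ?\<delta> z" using yz by (auto simp: fun_eq_iff)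
        then show "f (?\<delta> (y \<oplus> z)) = f (?\<delta> y) \<oplus>\<^bsub>scalar_space\<^esub> f (?\<delta> z)"
          using linear_mapD(2)[OF f(1), of "?\<delta> y" "?\<delta> z"] yz by simp
      next
        fix c y assume y: "y \<in> carrier E"
        have "?\<delta> (c \<odot> y) = c \<odot>\<^bsub>?V\<^esub> ?\<delta> y" by (auto simp: fun_eq_iff sm)
        then show "f (?\<delta> (c \<odot> y)) = c \<odot>\<^bsub>scalar_space\<^esub> f (?\<delta> y)"
          using linear_mapD(3)[OF f(1), of "?\<delta> y" c] y by simp
      qed auto
      show "0 \<le> inverse (r x)" using r[OF x] by simp
      fix y assume y: "y \<in> carrier E"
      have eq: "inverse (r x) * vnorm E y * r x = vnorm E y" using r[OF x] by simp
      have "vnorm E (?\<delta> y z) \<le> inverse (r x) * vnorm E y * r z" if "z \<in> N" for z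
      proof (cases "z = x")
        case True
        then show ?thesis by (simp only: eq refl if_True order.refl)
      next
        case False
        then show ?thesis using r[OF x] r[OF that] vnorm_nonneg[OF y] by auto
      qed
      then have "p (?\<delta> y) \<le> inverse (r x) * vnorm E y"
        unfolding p_le_iff using r[OF x] vnorm_nonneg[OF y] by auto
      then show "norm (f (?\<delta> y)) \<le> inverse (r x) * vnorm E y"
        by (rule order_trans[OF f(2), rotated]) (simp add: y)
    qed
    \<comment> \<open>A family vanishing on \<open>N\<close> has \<open>p\<close> equal to 0 and is
      therefore killed by \<open>f\<close>; additivity splits the finitely many coordinates that
      remain.\<close>
    have f_eq: "f u = (\<Sum>x\<in>N. g x (u x))" if u: "u \<in> carrier ?V" for u
    proof -
      have uc: "u i \<in> carrier E" for i using u by simp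
      have "f (\<lambda>i. if i \<in> A then u i else \<zero>) = (\<Sum>x\<in>A. g x (u x))" if "finite A" for A
        using that
      proof (induction A)
        case empty
        show ?case using linear_mapD(3)[OF f(1), of "\<lambda>i. \<zero>" 0] by (simp add: sm)
      next
        case (insert x A)
        have split: "(\<lambda>i. if i \<in> insert x A then u i else \<zero>) =
            (\<lambda>i. if i = x then u x else \<zero>) \<oplus>\<^bsub>?V\<^esub> (\<lambda>i. if i \<in> A then u i else \<zero>)"
        proof (rule ext)
          show "(if i \<in> insert x A then u i else \<zero>) =
              ((\<lambda>i. if i = x then u x else \<zero>) \<oplus>\<^bsub>?V\<^esub> (\<lambda>i. if i \<in> A then u i else \<zero>)) i" for i
            using insert.hyps(2) uc by (cases "i = x") auto
        qed
        have "f (\<lambda>i. if i \<in> insert x A then u i else \<zero>) = f (\<lambda>i. if i = x then u x else \<zero>) + f (\<lambda>i. if i \<in> A then u i else \<zero>)"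
          unfolding split
          using linear_mapD(2)[OF f(1), of "\<lambda>i. if i = x then u x else \<zero>" "\<lambda>i. if i \<in> A then u i else \<zero>"] uc by simp
        moreover have "g x (u x) = f (\<lambda>i. if i = x then u x else \<zero>)"
          by (simp add: g_def uc)
        ultimately show ?case
          using insert.IH sum.insert[OF insert.hyps, of "\<lambda>x. g x (u x)"] by (simp only:)
      qed
      note fN = this[OF fin]
      have "u = (\<lambda>i. if i \<in> N then u i else \<zero>) \<oplus>\<^bsub>?V\<^esub> (\<lambda>i. if i \<in> N then \<zero> else u i)"
        using uc by (intro ext) simp
      then have "f u = f (\<lambda>i. if i \<in> N then u i else \<zero>) + f (\<lambda>i. if i \<in> N then \<zero> else u i)"
        using linear_mapD(2)[OF f(1), of "\<lambda>i. if i \<in> N then u i else \<zero>" "\<lambda>i. if i \<in> N then \<zero> else u i"] uc by simp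
      moreover have "p (\<lambda>i. if i \<in> N then \<zero> else u i) \<le> 0"
        unfolding p_le_iff by simp
      then have "norm (f (\<lambda>i. if i \<in> N then \<zero> else u i)) \<le> 0"
        by (rule order_trans[OF f(2), rotated]) (simp add: uc)
      then have "f (\<lambda>i. if i \<in> N then \<zero> else u i) = 0" by simp
      ultimately show ?thesis using fN by simp
    qed
    \<comment> \<open>\<open>f\<close> vanishes on \<open>L - L \<circ> \<kappa> \<circ> S0 \<in> D\<close>, which turns \<open>f a\<close> into \<open>\<Sum>x\<in>N. x (g x)\<close>.\<close>
    obtain L where L: "linear_map L ?X E" "\<And>m x. m \<in> carrier ?X \<Longrightarrow> x \<in> N \<Longrightarrow> g x (L m) = m (g x)"
    proof -
      \<comment> \<open>This relation is total by \<open>finite_interpolation\<close> for the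
        finitely many \<open>g x\<close>. Lifting from the zero relation makes the choice of the
        interpolating point linear in \<open>m\<close>.\<close>
      let ?R = "{(m, y). m \<in> carrier ?X \<and> y \<in> carrier E \<and> (\<forall>x\<in>N. g x y = m (g x))}"
      have R: "linear_relation ?X E ?R"
        unfolding linear_relation_def
      proof (intro conjI allI impI)
        show "?R \<subseteq> carrier ?X \<times> carrier E" by auto
        have "g x \<zero> = 0" if "x \<in> N" for x
          using dual_spaceD(4)[OF g[OF that], of \<zero> 0] by (simp add: sm)
        then show "(\<zero>\<^bsub>?X\<^esub>, \<zero>) \<in> ?R"
          using X.M.zero_closed g by (simp add: D.dual_zero)
      next
        fix m y m' y' assume "(m, y) \<in> ?R" "(m', y') \<in> ?R"
        then have *: "m \<in> carrier ?X" "m' \<in> carrier ?X" "y \<in> carrier E" "y' \<in> carrier E"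
          "\<And>x. x \<in> N \<Longrightarrow> g x y = m (g x)" "\<And>x. x \<in> N \<Longrightarrow> g x y' = m' (g x)" by auto
        have "g x (y \<oplus> y') = (m \<oplus>\<^bsub>?X\<^esub> m') (g x)" if "x \<in> N" for x
          using dual_spaceD(3)[OF g[OF that] *(3,4)] *(5,6)[OF that] g[OF that] by simp
        then show "(m \<oplus>\<^bsub>?X\<^esub> m', y \<oplus> y') \<in> ?R"
          using X.M.a_closed[OF *(1,2)] M.a_closed[OF *(3,4)] by blast
      next
        fix c m y assume "(m, y) \<in> ?R"
        then have *: "m \<in> carrier ?X" "y \<in> carrier E" "\<And>x. x \<in> N \<Longrightarrow> g x y = m (g x)" by auto
        have "g x (c \<odot> y) = (c \<odot>\<^bsub>?X\<^esub> m) (g x)" if "x \<in> N" for x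
          using dual_spaceD(4)[OF g[OF that] *(2)] *(3)[OF that] g[OF that] by simp
        then show "(c \<odot>\<^bsub>?X\<^esub> m, c \<odot> y) \<in> ?R"
          using X.sm(1)[OF *(1)] sm(1)[OF *(2)] by blast
      qed
      have zero: "linear_relation ?X E {(\<zero>\<^bsub>?X\<^esub>, \<zero>)}"
        unfolding linear_relation_def using X.M.zero_closed X.M.l_zero[OF X.M.zero_closed]
        by (simp add: X.sm sm del: dual_space_simps)
      have R0: "{(\<zero>\<^bsub>?X\<^esub>, \<zero>)} \<subseteq> ?R"
        by (rule insert_subsetI[OF conjunct1[OF conjunct2[OF R[unfolded linear_relation_def]]] empty_subsetI])
      have total: "\<exists>y. (m, y) \<in> ?R" if "m \<in> carrier ?X" for m
      proof -
        have "g ` N \<subseteq> carrier E'" using g by blast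
        from finite_interpolation[OF finite_imageI[OF fin] this that] that show ?thesis by blast
      qed
      show thesis
      proof (rule linear_lifting[OF X.is_module is_module R total zero R0])
        fix L assume L: "linear_map L ?X E" "\<And>m. m \<in> carrier ?X \<Longrightarrow> (m, L m) \<in> ?R"
        show thesis
          by (rule that[OF L(1)]) (use L(2) in blast)
      qed blast+
    qed
    define P where "P x = L x \<oplus> (- 1) \<odot> L (?\<kappa> (S0 x))" for x
    have Lc: "L x \<in> carrier E" "S0 x \<in> carrier E" "?\<kappa> (S0 x) \<in> carrier ?X" "L (?\<kappa> (S0 x)) \<in> carrier E"
      if "x \<in> carrier ?X" for x
      using linear_mapD(1)[OF L(1)] linear_mapD(1)[OF S0(1)] \<kappa>D(1) that by blast+
    have P: "linear_map P ?X E"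
      unfolding linear_map_def
    proof (intro conjI ballI allI funcsetI)
      fix x assume x: "x \<in> carrier ?X"
      show "P x \<in> carrier E" using Lc[OF x] by (simp add: P_def sm)
      show "P (c \<odot>\<^bsub>?X\<^esub> x) = c \<odot> P x" for c
        unfolding P_def linear_mapD(3)[OF S0(1) x] \<kappa>D(3)[OF Lc(2)[OF x]] linear_mapD(3)[OF L(1) x]
          linear_mapD(3)[OF L(1) Lc(3)[OF x]]
        using Lc[OF x] by (simp add: sm)
      fix y assume y: "y \<in> carrier ?X"
      show "P (x \<oplus>\<^bsub>?X\<^esub> y) = P x \<oplus> P y"
        unfolding P_def linear_mapD(2)[OF S0(1) x y] \<kappa>D(2)[OF Lc(2)[OF x] Lc(2)[OF y]] linear_mapD(2)[OF L(1) x y]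
          linear_mapD(2)[OF L(1) Lc(3)[OF x] Lc(3)[OF y]]
        using Lc[OF x] Lc[OF y] by (simp add: sm add_swap)
    qed
    define d where "d x = (if x \<in> carrier ?X then P x else \<zero>)" for x
    have dP: "d x = P x" if "x \<in> carrier ?X" for x using that by (simp add: d_def)
    have dV: "d \<in> carrier ?V" using linear_mapD(1)[OF P] by (simp add: d_def)
    moreover have "linear_map d ?X E"
      unfolding linear_map_def
    proof (intro conjI ballI allI funcsetI)
      fix x assume x: "x \<in> carrier ?X"
      show "d x \<in> carrier E" using linear_mapD(1)[OF P x] dP[OF x] by simp
      show "d (c \<odot>\<^bsub>?X\<^esub> x) = c \<odot> d x" for c
        unfolding dP[OF x] dP[OF X.sm(1)[OF x]] by (rule linear_mapD(3)[OF P x])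
      fix y assume y: "y \<in> carrier ?X"
      show "d (x \<oplus>\<^bsub>?X\<^esub> y) = d x \<oplus> d y"
        unfolding dP[OF x] dP[OF y] dP[OF X.M.a_closed[OF x y]] by (rule linear_mapD(2)[OF P x y])
    qed
    moreover have "d (?\<kappa> y) = \<zero>" if "y \<in> carrier E" for y
      unfolding dP[OF \<kappa>D(1)[OF that]] P_def S0(2)[OF that]
      using add_minus(1)[OF linear_mapD(1)[OF L(1) \<kappa>D(1)[OF that]]] .
    ultimately have "d \<in> D" by (simp add: D_def)
    then have "(\<Sum>x\<in>N. g x (d x)) = 0" using f(3) f_eq[OF dV] by simp
    moreover have "g x (d x) = x (g x) - g x (a x)" if x: "x \<in> N" for x
    proof -
      have xX: "x \<in> carrier ?X" using x N by blast
      have "g x (P x) = g x (L x) + (- 1) * g x (L (?\<kappa> (S0 x)))"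
        unfolding P_def using dual_spaceD(3)[OF g[OF x], of "L x" "(- 1) \<odot> L (?\<kappa> (S0 x))"]
          dual_spaceD(4)[OF g[OF x] Lc(4)[OF xX], of "- 1"] Lc[OF xX] by (simp add: sm)
      also have "\<dots> = x (g x) - ?\<kappa> (S0 x) (g x)"
        using L(2)[OF xX x] L(2)[OF Lc(3)[OF xX] x] by simp
      finally show ?thesis
        using dP[OF xX] xX bidual_emb_apply[OF g[OF x]] by (simp add: a_def)
    qed
    ultimately have "(\<Sum>x\<in>N. x (g x)) = f a"
      using f_eq[OF a] by (simp add: sum_subtractf)
    then have "1 \<le> norm (\<Sum>x\<in>N. x (g x))" using f(4) by simp
    also have "\<dots> \<le> (\<Sum>x\<in>N. vnorm ?X x * vnorm E' (g x))"
      by (rule sum_norm_le) (use D.dual_bound(2) g N in blast)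
    finally have low: "1 \<le> (\<Sum>x\<in>N. vnorm ?X x * vnorm E' (g x))" .
    \<comment> \<open>The bound of \<open>f\<close> by \<open>p\<close> is tested on the family with
      entries \<open>r x\<close> times \<open>y x\<close>, where \<open>y x\<close> lies in the unit
      ball and nearly norms \<open>g x\<close>. Its \<open>p\<close> is at most 1.\<close>
    have "(\<Sum>x\<in>N. r x * vnorm E' (g x)) \<le> 1"
    proof (rule field_le_epsilon)
      fix e :: real assume e: "e > 0"
      \<comment> \<open>The individual errors are weighted by \<open>r\<close> when summed; the 1
        keeps the quotient defined for empty \<open>N\<close>.\<close>
      define e' where "e' = e / (1 + sum r N)"
      have sr: "0 \<le> sum r N" using r by (intro sum_nonneg) (auto intro: less_imp_le)
      have e': "e' > 0" "e' * sum r N \<le> e"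
        using e sr by (auto simp: e'_def field_simps)
      have "\<exists>y t. y \<in> carrier E \<and> vnorm E y \<le> 1 \<and> g x y = of_real t \<and> vnorm E' (g x) - e' \<le> t"
        if "x \<in> N" for x
        by (rule dual_nearly_norming[OF g[OF that] e'(1)]) blast
      then obtain y t where y: "\<And>x. x \<in> N \<Longrightarrow> y x \<in> carrier E" "\<And>x. x \<in> N \<Longrightarrow> vnorm E (y x) \<le> 1"
        and t: "\<And>x. x \<in> N \<Longrightarrow> g x (y x) = of_real (t x)" "\<And>x. x \<in> N \<Longrightarrow> vnorm E' (g x) - e' \<le> t x"
        by metis
      define u where "u i = (if i \<in> N then of_real (r i) \<odot> y i else \<zero>)" for i
      have u: "u \<in> carrier ?V" using y(1) by (simp add: u_def sm)
      have "p u \<le> 1"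
        unfolding p_le_iff
      proof (intro conjI ballI)
        fix x assume x: "x \<in> N"
        then have "vnorm E (u x) = r x * vnorm E (y x)"
          using y(1)[OF x] r[OF x] by (simp add: u_def vnorm_smult)
        also have "\<dots> \<le> r x * 1" using y(2)[OF x] r[OF x] by (intro mult_left_mono) auto
        finally show "vnorm E (u x) \<le> 1 * r x" by simp
      qed simp
      have "f u = (\<Sum>x\<in>N. of_real (r x * t x))"
        unfolding f_eq[OF u]
        by (rule sum.cong[OF refl]) (simp add: u_def dual_spaceD(4)[OF g] y(1) t(1))
      then have "f u = of_real (\<Sum>x\<in>N. r x * t x)" by simp
      then have "norm (f u) = \<bar>\<Sum>x\<in>N. r x * t x\<bar>" by (simp only: norm_of_real)
      then have "(\<Sum>x\<in>N. r x * t x) \<le> norm (f u)" by simp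
      also have "\<dots> \<le> 1" using f(2)[OF u] \<open>p u \<le> 1\<close> by simp
      finally have "(\<Sum>x\<in>N. r x * t x) \<le> 1" .
      moreover have "(\<Sum>x\<in>N. r x * (vnorm E' (g x) - e')) \<le> (\<Sum>x\<in>N. r x * t x)"
        using t(2) r by (intro sum_mono mult_left_mono) (auto intro: less_imp_le)
      moreover have "(\<Sum>x\<in>N. r x * (vnorm E' (g x) - e')) = (\<Sum>x\<in>N. r x * vnorm E' (g x)) - e' * sum r N"
        by (simp add: right_diff_distrib sum_subtractf sum_distrib_left mult.commute del: dual_space_simps)
      ultimately show "(\<Sum>x\<in>N. r x * vnorm E' (g x)) \<le> 1 + e" using e'(2) by linarith
    qed
    moreover have "(\<Sum>x\<in>N. r x * vnorm E' (g x)) =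
        (\<Sum>x\<in>N. vnorm ?X x * vnorm E' (g x)) + \<eta> * (\<Sum>x\<in>N. vnorm E' (g x))"
      by (simp add: r_def distrib_right sum.distrib sum_distrib_left del: dual_space_simps)
    \<comment> \<open>The sums in the two estimates differ by \<open>\<eta>\<close> times the sum of
      the norms of the \<open>g x\<close>, so all these norms are zero and the sum in
      \<open>low\<close> is 0 as well.\<close>
    ultimately have "\<eta> * (\<Sum>x\<in>N. vnorm E' (g x)) \<le> 0" using low by linarith
    then have le: "(\<Sum>x\<in>N. vnorm E' (g x)) \<le> 0"
      by (rule mult_le_cancel_left_pos[OF \<eta>, THEN iffD1, OF order_trans]) simp
    have nn: "0 \<le> vnorm E' (g x)" if "x \<in> N" for x using dual_bound(1)[OF g[OF that]] .
    have "(\<Sum>x\<in>N. vnorm E' (g x)) = 0" by (rule antisym[OF le sum_nonneg[OF nn]])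
    then have "vnorm E' (g x) = 0" if "x \<in> N" for x
      using sum_nonneg_eq_0_iff[OF fin, of "\<lambda>x. vnorm E' (g x)"] nn that by blast
    then have "(\<Sum>x\<in>N. vnorm ?X x * vnorm E' (g x)) = 0" by simp
    with low show False by simp
  qed
qed

end

section \<open>Isometry of both tensor maps\<close>

theorem corollary3p5:
  fixes n :: nat
    and E :: "('k::real_or_complex, 'u) nspace"
    and U :: "'i filter"
    and \<alpha> :: "('k, 'u) nspace \<Rightarrow> ('k, 'u) tensor \<Rightarrow> real"
  assumes "banach_space E"
    and "is_ultrafilter U"
    and "s_tensor_norm n \<alpha>"
    and "finitely_generated n \<alpha>"
  shows "(\<forall>J F. normed_space F \<and> isometric_isomorphism J (ultrapower U E) F \<longrightarrow>
            isometry (sym_tensor_map n (ultrapower_emb U E) E (ultrapower U E))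
              (sym_tensor_space n (\<alpha> E) E)
              (sym_tensor_space n (norm_via n \<alpha> (ultrapower U E) J F) (ultrapower U E)))
       \<and> (\<forall>J F. normed_space F \<and> isometric_isomorphism J (bidual E) F \<longrightarrow>
            isometry (sym_tensor_map n (bidual_emb E) E (bidual E))
              (sym_tensor_space n (\<alpha> E) E)
              (sym_tensor_space n (norm_via n \<alpha> (bidual E) J F) (bidual E)))"
proof (intro conjI allI impI)
  interpret E: banach_space E by fact
  have nE: "normed_space E" ..
  interpret normed_ultrapower E U using assms(2) by unfold_locales
  fix J and F :: "('k, 'u) nspace"
  assume "normed_space F \<and> isometric_isomorphism J (ultrapower U E) F"
  then show "isometry (sym_tensor_map n (ultrapower_emb U E) E (ultrapower U E))
      (sym_tensor_space n (\<alpha> E) E)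
      (sym_tensor_space n (norm_via n \<alpha> (ultrapower U E) J F) (ultrapower U E))"
    by (intro isometry_sym_tensor_map_via[OF nE banach_space_ultrapower[OF assms(1,2)] isometry_ultrapower_emb
      locally_retractable_ultrapower assms(3,4)]) auto
next
  interpret E: banach_space E by fact
  have nE: "normed_space E" ..
  interpret D: normed_space "dual_space E" by (rule E.normed_space_dual)
  fix J and F :: "('k, 'u) nspace"
  assume "normed_space F \<and> isometric_isomorphism J (bidual E) F"
  then show "isometry (sym_tensor_map n (bidual_emb E) E (bidual E))
      (sym_tensor_space n (\<alpha> E) E)
      (sym_tensor_space n (norm_via n \<alpha> (bidual E) J F) (bidual E))"
    by (intro isometry_sym_tensor_map_via[OF nE D.banach_space_dual E.isometry_bidual_emb
      E.locally_retractable_bidual_emb assms(3,4)]) auto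
qed

end
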